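(* The \textsc{Vertex Bisection} problem is W[1]-hard with respect to the combined parameter $(k,c)$, where $k$ is the desired separator size of the instance and $c$ is the maximum, over all vertex sets $S\subseteq V(G)$ with $|S|\le k$, of the number of connected components of $G-S$, where $G$ is the input graph.
   Context: All graphs are finite, simple and undirected. For a graph $G$ and $S\subseteq V(G)$, $S$ is an $A$-$B$ separator if $\{S,A,B\}$ is a partition of $V(G)$ and there is no edge between $A$ and $B$ in $G$; $S$ is a balanced separator if it is an $A$-$B$ separator for some $A,B$ with $||A|-|B||\le 1$. \textsc{Vertex Bisection}: given a graph $G$ and a positive integer $k$, decide whether $G$ has a balanced separator of size at most $k$. *)

theory Defs
  imports Main
begin

section \<open>Computation model\<close>

text \<open>
  Running times are measured in the WHILE language over binary trees (N. D. Jones,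
  Computability and Complexity from a Programming Perspective, MIT Press 1997). Trees are
  shared pointer structures, so every operation takes constant time, and the model and Turing
  machines simulate each other with polynomial overhead. In particular it yields the usual
  computable functions and the usual fpt time bounds. As an expression of a fixed program has
  constant size, an assignment or a test is charged one unit as a whole.
\<close>

datatype tree = Atom | Pair tree tree

datatype expr = Var nat | AtomE | PairE expr expr | LeftE expr | RightE expr

datatype com =
    Assign nat expr
  | Seq com com
  | Cond expr com com
  | While expr com

type_synonym state = "nat \<Rightarrow> tree"

primrec left :: "tree \<Rightarrow> tree" where
  "left Atom = Atom"
| "left (Pair a b) = a"

primrec right :: "tree \<Rightarrow> tree" where
  "right Atom = Atom"
| "right (Pair a b) = b"

primrec expr_val :: "expr \<Rightarrow> state \<Rightarrow> tree" where
  "expr_val (Var x) s = s x"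
| "expr_val AtomE s = Atom"
| "expr_val (PairE e f) s = Pair (expr_val e s) (expr_val f s)"
| "expr_val (LeftE e) s = left (expr_val e s)"
| "expr_val (RightE e) s = right (expr_val e s)"

text \<open>\<open>exec c s t s'\<close>: started in state \<open>s\<close>, the program \<open>c\<close> halts after \<open>t\<close> steps in
  state \<open>s'\<close>. A test succeeds on every tree other than \<open>Atom\<close>.\<close>

inductive exec :: "com \<Rightarrow> state \<Rightarrow> nat \<Rightarrow> state \<Rightarrow> bool" where
  Assign: "exec (Assign x e) s 1 (s(x := expr_val e s))"
| Seq: "exec c s t s' \<Longrightarrow> exec d s' u s'' \<Longrightarrow> exec (Seq c d) s (t + u) s''"
| CondTrue: "expr_val e s \<noteq> Atom \<Longrightarrow> exec c s t s' \<Longrightarrow> exec (Cond e c d) s (Suc t) s'"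
| CondFalse: "expr_val e s = Atom \<Longrightarrow> exec d s t s' \<Longrightarrow> exec (Cond e c d) s (Suc t) s'"
| WhileFalse: "expr_val e s = Atom \<Longrightarrow> exec (While e c) s 1 s"
| WhileTrue: "expr_val e s \<noteq> Atom \<Longrightarrow> exec c s t s' \<Longrightarrow> exec (While e c) s' u s'' \<Longrightarrow>
    exec (While e c) s (Suc (t + u)) s''"

inductive_cases AssignE: "exec (Assign x e) s t s'"
inductive_cases SeqE: "exec (Seq c d) s t s'"
inductive_cases CondE: "exec (Cond e c d) s t s'"
inductive_cases WhileE: "exec (While e c) s t s'"

lemma exec_deterministic:
  "exec c s t s' \<Longrightarrow> exec c s u s'' \<Longrightarrow> t = u \<and> s' = s''"
proof (induction arbitrary: u s'' rule: exec.induct)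
  case (Assign x e s)
  then show ?case by (auto elim: AssignE)
next
  case (Seq c s t s' d u s'')
  from Seq.prems show ?case
    by (rule SeqE) (use Seq.IH in blast)
next
  case (CondTrue e s c t s' d)
  from CondTrue.prems show ?case
    by (rule CondE) (use CondTrue.IH CondTrue.hyps in blast)+
next
  case (CondFalse e s d t s' c)
  from CondFalse.prems show ?case
    by (rule CondE) (use CondFalse.IH CondFalse.hyps in blast)+
next
  case (WhileFalse e s c)
  from WhileFalse.prems WhileFalse.hyps show ?case by (auto elim: WhileE)
next
  case (WhileTrue e s c t s' u s'')
  from WhileTrue.prems show ?case
    by (rule WhileE) (use WhileTrue.IH WhileTrue.hyps in blast)+
qed

text \<open>Input and output are passed in variable 0; all other variables are initially \<open>Atom\<close>.\<close>

definition halts_within :: "com \<Rightarrow> tree \<Rightarrow> tree \<Rightarrow> nat \<Rightarrow> bool" where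
  "halts_within c v w T \<longleftrightarrow>
     (\<exists>t s. exec c ((\<lambda>_. Atom)(0 := v)) t s \<and> s 0 = w \<and> t \<le> T)"

primrec nat_tree :: "nat \<Rightarrow> tree" where
  "nat_tree 0 = Atom"
| "nat_tree (Suc n) = Pair Atom (nat_tree n)"

definition bit_tree :: "bool \<Rightarrow> tree" where
  "bit_tree b = (if b then Pair Atom Atom else Atom)"

primrec string_tree :: "bool list \<Rightarrow> tree" where
  "string_tree [] = Atom"
| "string_tree (b # w) = Pair (bit_tree b) (string_tree w)"

definition computable :: "(nat \<Rightarrow> nat) \<Rightarrow> bool" where
  "computable f \<longleftrightarrow> (\<exists>c. \<forall>n. \<exists>T. halts_within c (nat_tree n) (nat_tree (f n)) T)"


section \<open>Parameterized problems and fpt reductions\<close>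

text \<open>A language together with a parameterization. The latter is not required to be
  polynomial-time computable, so that structural parameters are admitted.\<close>

type_synonym par_problem = "bool list set \<times> (bool list \<Rightarrow> nat)"

text \<open>The successor in the time bound only matters for the empty input string.\<close>

definition fpt_computable :: "(bool list \<Rightarrow> nat) \<Rightarrow> (bool list \<Rightarrow> bool list) \<Rightarrow> bool" where
  "fpt_computable \<kappa> R \<longleftrightarrow>
     (\<exists>c f a. computable f \<and>
        (\<forall>w. halts_within c (string_tree w) (string_tree (R w))
               (f (\<kappa> w) * Suc (length w) ^ a)))"

fun fpt_reducible :: "par_problem \<Rightarrow> par_problem \<Rightarrow> bool" (infix "\<le>\<^sub>f\<^sub>p\<^sub>t" 50) where
  "(L, \<kappa>) \<le>\<^sub>f\<^sub>p\<^sub>t (L', \<kappa>') \<longleftrightarrow>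
     (\<exists>R. (\<forall>w. w \<in> L \<longleftrightarrow> R w \<in> L') \<and>
          fpt_computable \<kappa> R \<and>
          (\<exists>g. computable g \<and> (\<forall>w. \<kappa>' (R w) \<le> g (\<kappa> w))))"

text \<open>The problem with instances \<open>I\<close>, yes-instances \<open>{x \<in> I. yes x}\<close> and parameter \<open>par\<close>,
  under an encoding \<open>enc\<close> that is injective on \<open>I\<close>. Strings that do not encode an instance
  are no-instances with parameter 0.\<close>

definition encoded_problem ::
    "('a \<Rightarrow> bool list) \<Rightarrow> 'a set \<Rightarrow> ('a \<Rightarrow> bool) \<Rightarrow> ('a \<Rightarrow> nat) \<Rightarrow> par_problem" where
  "encoded_problem enc I yes par =
     (enc ` {x \<in> I. yes x}, \<lambda>w. if w \<in> enc ` I then par (inv_into I enc w) else 0)"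

text \<open>Numbers are written in unary. This is polynomially equivalent to binary, as the numbers
  that occur in graphs and circuits are bounded by the number of vertices or gates, and a bound
  or weight exceeding that makes the instance trivial.\<close>

definition nats_string :: "nat list \<Rightarrow> bool list" where
  "nats_string ns = concat (map (\<lambda>n. replicate n True @ [False]) ns)"

lemma unary_append_eq:
  "replicate m True @ False # u = replicate n True @ False # v \<longleftrightarrow> m = n \<and> u = v"
proof (induction m arbitrary: n)
  case 0
  show ?case by (cases n) auto
next
  case (Suc m)
  then show ?case by (cases n) auto
qed

lemma inj_nats_string: "inj nats_string"
proof (rule injI)
  show "ms = ns" if "nats_string ms = nats_string ns" for ms ns
    using that
  proof (induction ms arbitrary: ns)
    case Nil
    then show ?case by (cases ns) (auto simp: nats_string_def)
  next
    case (Cons m ms)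
    then show ?case by (cases ns) (auto simp: nats_string_def unary_append_eq)
  qed
qed


section \<open>Boolean circuits and the W hierarchy\<close>

datatype gate = Input | Neg nat | Conj "nat list" | Disj "nat list"

primrec preds :: "gate \<Rightarrow> nat list" where
  "preds Input = []"
| "preds (Neg p) = [p]"
| "preds (Conj ps) = ps"
| "preds (Disj ps) = ps"

text \<open>A circuit is a directed acyclic graph listed in a topological order whose last element
  is the output node; a node refers to its in-neighbours by their positions.\<close>

type_synonym circuit = "gate list"

definition circuit :: "circuit \<Rightarrow> bool" where
  "circuit C \<longleftrightarrow> C \<noteq> [] \<and>
     (\<forall>i < length C. (\<forall>p \<in> set (preds (C ! i)). p < i) \<and>
        (\<forall>ps. C ! i = Conj ps \<or> C ! i = Disj ps \<longrightarrow> distinct ps \<and> 2 \<le> length ps))"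

text \<open>\<open>sweep f C\<close> lists the values of all nodes, where \<open>f vs g\<close> is the value of the node \<open>g\<close>
  at position \<open>length vs\<close>, and \<open>vs\<close> are the values of the earlier nodes.\<close>

definition sweep :: "('v list \<Rightarrow> gate \<Rightarrow> 'v) \<Rightarrow> circuit \<Rightarrow> 'v list" where
  "sweep f C = foldl (\<lambda>vs g. vs @ [f vs g]) [] C"

text \<open>An assignment is the set of positions of the input nodes that receive the value true.\<close>

primrec gate_value :: "nat set \<Rightarrow> bool list \<Rightarrow> gate \<Rightarrow> bool" where
  "gate_value X vs Input \<longleftrightarrow> length vs \<in> X"
| "gate_value X vs (Neg p) \<longleftrightarrow> \<not> vs ! p"
| "gate_value X vs (Conj ps) \<longleftrightarrow> (\<forall>p \<in> set ps. vs ! p)"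
| "gate_value X vs (Disj ps) \<longleftrightarrow> (\<exists>p \<in> set ps. vs ! p)"

definition satisfies :: "nat set \<Rightarrow> circuit \<Rightarrow> bool" where
  "satisfies X C \<longleftrightarrow> last (sweep (gate_value X) C)"

text \<open>The maximum, over all paths from an input node to the given node, of the number of edges
  (depth) and of the number of large nodes, i.e. nodes of in-degree more than 2 (weft).\<close>

definition gate_depth :: "nat list \<Rightarrow> gate \<Rightarrow> nat" where
  "gate_depth ds g =
     (if g = Input then 0 else Suc (Max ((\<lambda>p. ds ! p) ` set (preds g))))"

definition gate_weft :: "nat list \<Rightarrow> gate \<Rightarrow> nat" where
  "gate_weft ws g =
     (if g = Input then 0
      else (if 2 < length (preds g) then 1 else 0) + Max ((\<lambda>p. ws ! p) ` set (preds g)))"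

definition depth :: "circuit \<Rightarrow> nat" where
  "depth C = last (sweep gate_depth C)"

definition weft :: "circuit \<Rightarrow> nat" where
  "weft C = last (sweep gate_weft C)"

definition has_weighted_solution :: "circuit \<Rightarrow> nat \<Rightarrow> bool" where
  "has_weighted_solution C k \<longleftrightarrow>
     (\<exists>X. X \<subseteq> {i. i < length C \<and> C ! i = Input} \<and> card X = k \<and> satisfies X C)"

primrec gate_nats :: "gate \<Rightarrow> nat list" where
  "gate_nats Input = [0]"
| "gate_nats (Neg p) = [1, p]"
| "gate_nats (Conj ps) = 2 # length ps # ps"
| "gate_nats (Disj ps) = 3 # length ps # ps"

definition circuit_string :: "circuit \<times> nat \<Rightarrow> bool list" where
  "circuit_string = (\<lambda>(C, k). nats_string (k # concat (map gate_nats C)))"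

lemma gate_nats_append_eq: "gate_nats g @ u = gate_nats h @ v \<Longrightarrow> g = h \<and> u = v"
  by (cases g; cases h) auto

lemma inj_circuit_string: "inj circuit_string"
proof -
  have gates: "C = D"
    if "concat (map gate_nats C) = concat (map gate_nats D)" for C D
    using that
  proof (induction C arbitrary: D)
    case Nil
    have "gate_nats g \<noteq> []" for g by (cases g) auto
    with Nil show ?case by (cases D) auto
  next
    case (Cons g C)
    have "gate_nats g \<noteq> []" by (cases g) auto
    with Cons.prems obtain h D' where D: "D = h # D'" by (cases D) auto
    with Cons.prems have "g = h \<and> concat (map gate_nats C) = concat (map gate_nats D')"
      by (intro gate_nats_append_eq) simp
    with Cons.IH D show ?case by blast
  qed
  show ?thesis
    by (rule injI) (auto simp: circuit_string_def dest!: injD[OF inj_nats_string] gates)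
qed

text \<open>Weighted circuit satisfiability for circuits of weft at most \<open>t\<close> and depth at most \<open>d\<close>,
  parameterized by the weight.\<close>

definition WCS :: "nat \<Rightarrow> nat \<Rightarrow> par_problem" where
  "WCS t d = encoded_problem circuit_string
     {(C, k). circuit C \<and> weft C \<le> t \<and> depth C \<le> d}
     (\<lambda>(C, k). has_weighted_solution C k)
     (\<lambda>(C, k). k)"

definition W_class :: "nat \<Rightarrow> par_problem set" where
  "W_class t = {Q. \<exists>d \<ge> 1. Q \<le>\<^sub>f\<^sub>p\<^sub>t WCS t d}"

definition W_hard :: "nat \<Rightarrow> par_problem \<Rightarrow> bool" where
  "W_hard t P \<longleftrightarrow> (\<forall>Q \<in> W_class t. Q \<le>\<^sub>f\<^sub>p\<^sub>t P)"


section \<open>Graphs and vertex bisection\<close>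

type_synonym 'a graph = "'a set \<times> 'a set set"

fun simple_graph :: "'a graph \<Rightarrow> bool" where
  "simple_graph (V, E) \<longleftrightarrow> finite V \<and> (\<forall>e \<in> E. e \<subseteq> V \<and> card e = 2)"

text \<open>Each of \<open>S\<close>, \<open>A\<close>, \<open>B\<close> may be empty.\<close>

fun separator :: "'a graph \<Rightarrow> 'a set \<Rightarrow> 'a set \<Rightarrow> 'a set \<Rightarrow> bool" where
  "separator (V, E) S A B \<longleftrightarrow>
     S \<union> A \<union> B = V \<and> S \<inter> A = {} \<and> S \<inter> B = {} \<and> A \<inter> B = {} \<and>
     (\<forall>a \<in> A. \<forall>b \<in> B. {a, b} \<notin> E)"

definition balanced_separator :: "'a graph \<Rightarrow> 'a set \<Rightarrow> bool" where
  "balanced_separator G S \<longleftrightarrow>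
     (\<exists>A B. separator G S A B \<and> \<bar>int (card A) - int (card B)\<bar> \<le> 1)"

fun delete_vertices :: "'a graph \<Rightarrow> 'a set \<Rightarrow> 'a graph" where
  "delete_vertices (V, E) S = (V - S, {e \<in> E. e \<inter> S = {}})"

fun connected_in :: "'a graph \<Rightarrow> ('a \<times> 'a) set" where
  "connected_in (V, E) = {(u, v). u \<in> V \<and> v \<in> V \<and> (u, v) \<in> {(x, y). {x, y} \<in> E}\<^sup>*}"

definition components :: "'a graph \<Rightarrow> 'a set set" where
  "components G = fst G // connected_in G"

definition max_components :: "'a graph \<Rightarrow> nat \<Rightarrow> nat" where
  "max_components G k =
     Max {card (components (delete_vertices G S)) | S. S \<subseteq> fst G \<and> card S \<le> k}"

text \<open>Graphs are presented by their number \<open>n\<close> of vertices and a list of edges between the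
  vertices \<open>0, \<dots>, n - 1\<close>.\<close>

definition graph_of :: "nat \<Rightarrow> (nat \<times> nat) list \<Rightarrow> nat graph" where
  "graph_of n es = ({..<n}, {{u, v} | u v. (u, v) \<in> set es})"

definition graph_string :: "nat \<times> (nat \<times> nat) list \<times> nat \<Rightarrow> bool list" where
  "graph_string = (\<lambda>(n, es, k). nats_string (n # k # concat (map (\<lambda>(u, v). [u, v]) es)))"

lemma inj_graph_string: "inj graph_string"
proof -
  have edges: "es = fs"
    if "concat (map (\<lambda>(u, v). [u, v]) es) = concat (map (\<lambda>(u, v). [u, v]) fs)"
    for es fs :: "(nat \<times> nat) list"
    using that
  proof (induction es arbitrary: fs)
    case Nil
    then show ?case by (cases fs) (auto split: prod.splits)
  next
    case (Cons e es)
    then show ?case by (cases e; cases fs) auto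
  qed
  show ?thesis
    by (rule injI) (auto simp: graph_string_def dest!: injD[OF inj_nats_string] edges)
qed

definition vertex_bisection :: "(nat graph \<Rightarrow> nat \<Rightarrow> nat) \<Rightarrow> par_problem" where
  "vertex_bisection par = encoded_problem graph_string
     {(n, es, k). simple_graph (graph_of n es) \<and> 1 \<le> k}
     (\<lambda>(n, es, k). \<exists>S. balanced_separator (graph_of n es) S \<and> card S \<le> k)
     (\<lambda>(n, es, k). par (graph_of n es) k)"

end

theory Submission
  imports Defs
begin

text \<open>
  For fixed depth \<open>d\<close> we reduce weighted satisfiability of circuits of weft 1 to vertex bisection
  in polynomial time. Expanding all gates that are not below a large one turns the output of a circuit into a
  disjunction of polynomially many conjunctions of constraints, each of which depends on at most
  \<open>q = 2\<^sup>d\<close> inputs. For each such conjunction the number of constraints that an assignment \<open>X\<close>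
  violates is therefore a polynomial of degree at most \<open>q\<close>: it is the sum of its Moebius
  coefficients over the subsets \<open>Y\<close> of \<open>X\<close> with at most \<open>q\<close> elements.

  The graph has a large clique whose vertices include an item \<open>(i, x)\<close> for each conjunction \<open>i\<close> and
  input \<open>x\<close>. For each \<open>i\<close> and each nonempty set \<open>Y\<close> of at most \<open>q\<close> inputs a gadget clique is
  attached to the items \<open>(i, x)\<close> with \<open>x \<in> Y\<close>; its size is a large constant \<open>B\<close> minus the
  coefficient of \<open>Y\<close>. Deleting the items \<open>(i, x)\<close> with \<open>x \<in> X\<close>, where \<open>X\<close> has \<open>k\<close> elements, isolates
  as many gadget vertices as possible if and only if \<open>X\<close> violates no constraint of the conjunction
  \<open>i\<close>, and no other \<open>k\<close> deletions reach that number. A second, disjoint clique is sized so that a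
  balanced separator must isolate that many gadget vertices. Since gadgets are cliques, deleting
  \<open>k\<close> vertices leaves at most one component for each small subset of the deleted items besides
  the two big ones.
\<close>

text \<open>Two obstacles shape the weights. First, a separator may delete any \<open>k\<close>
  vertices, not only \<open>k\<close> items with one index. The constant \<open>B\<close> prices
  this: a deletion set that is not a full block \<open>{i} \<times> X\<close> covers at least one
  small subset fewer than a block does, because a missing item loses a singleton and items of two
  indices lose a mixed pair (hence \<open>2 \<le> q\<close> and \<open>1 \<le> d\<close>). That
  costs \<open>B\<close>, while the coefficients return at most \<open>k * L\<close> for each of at
  most \<open>k\<close> indices, where \<open>L\<close> bounds the number of violations. Second, a
  gadget without neighbours would be isolated from the start, so the coefficient of the empty set,
  which is the number of violations of the empty assignment, has no gadget. It is distributed over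
  the singletons; multiplying all violation numbers by \<open>k\<close> makes the shares integral.
  The polynomial-time map must finally follow an arbitrary fpt reduction, of which only the running
  time is known. As trees are shared, time bounds their height but not their size; height suffices,
  since a string is a list along the right spine.\<close>

section \<open>Data as trees\<close>

class codable =
  fixes code :: "'a \<Rightarrow> tree"

instantiation nat :: codable begin
definition code_nat :: "nat \<Rightarrow> tree" where "code_nat = nat_tree"
instance ..
end

instantiation bool :: codable begin
definition code_bool :: "bool \<Rightarrow> tree" where "code_bool = bit_tree"
instance ..
end

instantiation unit :: codable begin
definition code_unit :: "unit \<Rightarrow> tree" where "code_unit u = Atom"
instance ..
end

instantiation prod :: (codable, codable) codable begin
definition code_prod :: "'a \<times> 'b \<Rightarrow> tree" where "code_prod p = Pair (code (fst p)) (code (snd p))"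
instance ..
end

instantiation list :: (codable) codable begin
primrec code_list :: "'a list \<Rightarrow> tree" where
  "code_list [] = Atom"
| "code_list (x # xs) = Pair (code x) (code_list xs)"
instance ..
end

lemma code_simps [simp]:
  "code (0::nat) = Atom" "code (Suc n) = Pair Atom (code n)"
  "code True = Pair Atom Atom" "code False = Atom"
  "code () = Atom" "code (a, b) = Pair (code a) (code b)"
  by (simp_all add: code_nat_def code_bool_def bit_tree_def code_unit_def code_prod_def)

lemma code_string: "code (w :: bool list) = string_tree w"
  by (induction w) (simp_all add: code_bool_def)

lemma code_eq_Atom [simp]:
  fixes n :: nat and xs :: "'a::codable list"
  shows "code n = Atom \<longleftrightarrow> n = 0" and "code b = Atom \<longleftrightarrow> \<not> b" and "code xs = Atom \<longleftrightarrow> xs = []"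
proof -
  show "code n = Atom \<longleftrightarrow> n = 0" by (cases n) simp_all
  show "code b = Atom \<longleftrightarrow> \<not> b" by (cases b) simp_all
  show "code xs = Atom \<longleftrightarrow> xs = []" by (cases xs) simp_all
qed

text \<open>The size of the tree written out without sharing. Numbers count with their value, so
  polynomial bounds refer to unary notation, as in the strings of the problems.\<close>

abbreviation sz :: "'a::codable \<Rightarrow> nat" where "sz x \<equiv> size (code x)"

lemma sz_nat [simp]: "sz (n::nat) = n"
  by (induction n) auto

lemma sz_bool: "sz (b::bool) \<le> 1"
  by (cases b) auto

lemma sz_string: "sz (w :: bool list) \<le> 2 * length w"
  by (induction w) (use sz_bool in \<open>auto simp: code_bool_def bit_tree_def\<close>)

lemma sz_prod [simp]: "sz (p :: 'a::codable \<times> 'b::codable) = Suc (sz (fst p) + sz (snd p))"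
  by (simp add: code_prod_def)

lemma sz_append: "sz (xs @ ys) = sz xs + sz ys"
  by (induction xs) auto

lemma sz_rev: "sz (rev xs) = sz xs"
  by (induction xs) (auto simp: sz_append)

lemma length_le_sz: "length xs \<le> sz xs"
  by (induction xs) auto

lemma sz_mem_le: "x \<in> set xs \<Longrightarrow> sz x \<le> sz xs"
  by (induction xs) auto

lemma sz_list_le: "(\<And>x. x \<in> set xs \<Longrightarrow> sz x \<le> m) \<Longrightarrow> sz xs \<le> length xs * Suc m"
  by (induction xs) (auto simp: add_mono, fastforce)

lemma sz_take: "sz (take n xs) \<le> sz xs" and sz_drop: "sz (drop n xs) \<le> sz xs"
  by (metis append_take_drop_id sz_append le_add1) (metis append_take_drop_id sz_append le_add2)

section \<open>Polynomial bounds\<close>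

text \<open>The base is at least 2, so a single exponent absorbs constants and sums as well as
  products, and no coefficients are needed.\<close>

definition polyb :: "('a::codable \<Rightarrow> nat) \<Rightarrow> bool" where
  "polyb t \<longleftrightarrow> (\<exists>a. \<forall>x. t x \<le> (sz x + 2) ^ a)"

lemma polyb_mono: "polyb t \<Longrightarrow> (\<And>x. u x \<le> t x) \<Longrightarrow> polyb u"
  unfolding polyb_def by (meson le_trans)

lemma polyb_const: "polyb (\<lambda>_. n)"
proof -
  have "n \<le> (m + 2) ^ n" for m :: nat
  proof -
    have "n \<le> 2 ^ n" by (simp add: less_imp_le)
    also have "\<dots> \<le> (m + 2) ^ n" by (rule power_mono) auto
    finally show ?thesis .
  qed
  then show ?thesis unfolding polyb_def by blast
qed

lemma polyb_sz: "polyb sz"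
  unfolding polyb_def by (rule exI[of _ 1]) auto

lemma polyb_mult: assumes "polyb t" "polyb u" shows "polyb (\<lambda>x. t x * u x)"
proof -
  from assms obtain a b where "\<And>x. t x \<le> (sz x + 2) ^ a" "\<And>x. u x \<le> (sz x + 2) ^ b"
    unfolding polyb_def by blast
  then have "t x * u x \<le> (sz x + 2) ^ (a + b)" for x
    by (simp add: power_add mult_mono)
  then show ?thesis unfolding polyb_def by blast
qed

lemma polyb_add: assumes "polyb t" "polyb u" shows "polyb (\<lambda>x. t x + u x)"
proof -
  have "polyb (\<lambda>x. 2 * (Suc (t x) * Suc (u x)))"
  proof -
    from assms obtain a b where a: "\<And>x. t x \<le> (sz x + 2) ^ a" and b: "\<And>x. u x \<le> (sz x + 2) ^ b"
      unfolding polyb_def by blast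
    have S: "Suc m \<le> (n + 2) ^ Suc c" if "m \<le> (n + 2) ^ c" for m n c :: nat
    proof -
      have "1 \<le> (n + 2) ^ c" by simp
      then have "Suc m \<le> 2 * (n + 2) ^ c" using that by linarith
      also have "\<dots> \<le> (n + 2) ^ Suc c" by simp
      finally show ?thesis .
    qed
    have "polyb (\<lambda>x. Suc (t x))" "polyb (\<lambda>x. Suc (u x))"
      unfolding polyb_def using S a b by blast+
    then show ?thesis by (intro polyb_mult polyb_const)
  qed
  then show ?thesis by (rule polyb_mono) auto
qed

lemma polyb_Suc: "polyb t \<Longrightarrow> polyb (\<lambda>x. Suc (t x))"
  using polyb_add[OF _ polyb_const[of 1]] by simp

lemma polyb_power: "polyb t \<Longrightarrow> polyb (\<lambda>x. t x ^ n)"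
  by (induction n) (auto intro: polyb_mult polyb_const)

lemma polyb_comp:
  assumes "polyb t" "polyb (\<lambda>x. sz (g x))" shows "polyb (\<lambda>x. t (g x))"
proof -
  from assms(1) obtain a where a: "\<And>x. t x \<le> (sz x + 2) ^ a" unfolding polyb_def by blast
  have "polyb (\<lambda>x. (sz (g x) + 2) ^ a)"
    by (intro polyb_power polyb_add assms polyb_const)
  then show ?thesis by (rule polyb_mono) (rule a)
qed

lemmas polyb_intros = polyb_const polyb_sz polyb_add polyb_mult polyb_Suc polyb_power

section \<open>Polynomial-time functions\<close>

text \<open>The variables from \<open>N\<close> on come back unchanged: an enclosing program keeps
  its data there.\<close>

definition runs :: "com \<Rightarrow> nat \<Rightarrow> nat \<Rightarrow> tree \<Rightarrow> tree \<Rightarrow> bool" where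
  "runs c N T v w \<longleftrightarrow>
     (\<forall>s. s 0 = v \<longrightarrow> (\<exists>t s'. exec c s t s' \<and> t \<le> T \<and> s' 0 = w \<and> (\<forall>i\<ge>N. s' i = s i)))"

text \<open>The program may be started in any state that holds the argument in variable 0, so that
  programs can be composed without clearing their local variables.\<close>

definition ptime :: "('a::codable \<Rightarrow> 'b::codable) \<Rightarrow> bool" where
  "ptime f \<longleftrightarrow> polyb (\<lambda>x. sz (f x)) \<and>
     (\<exists>c N T. polyb T \<and> (\<forall>x. runs c N (T x) (code x) (code (f x))))"

lemma ptimeI:
  "polyb (\<lambda>x. sz (f x)) \<Longrightarrow> polyb T \<Longrightarrow> (\<And>x. runs c N (T x) (code x) (code (f x))) \<Longrightarrow> ptime f"
  unfolding ptime_def by blast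

lemma ptimeE:
  assumes "ptime f"
  obtains c N T where "polyb T" "\<And>M x. N \<le> M \<Longrightarrow> runs c M (T x) (code x) (code (f x))"
proof -
  from assms obtain c N T where T: "polyb T" and r: "\<And>x. runs c N (T x) (code x) (code (f x))"
    unfolding ptime_def by blast
  have "runs c M (T x) (code x) (code (f x))" if "N \<le> M" for M x
    using r[of x] that unfolding runs_def by (meson order_trans)
  with T that show thesis by blast
qed

lemma ptime_sz: "ptime f \<Longrightarrow> polyb (\<lambda>x. sz (f x))"
  unfolding ptime_def by blast

lemma ptime_expr:
  assumes "polyb (\<lambda>x. sz (f x))" "\<And>x s. s 0 = code x \<Longrightarrow> expr_val e s = code (f x)"
  shows "ptime f"
  by (rule ptimeI[where c = "Assign 0 e" and N = 1 and T = "\<lambda>_. 1"])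
    (auto simp: runs_def assms intro!: polyb_const exI exec.Assign)

lemma exec_assign: "s' = s(x := expr_val e s) \<Longrightarrow> exec (Assign x e) s 1 s'"
  by (simp only: exec.Assign)

lemma runsE:
  assumes "runs c N T (s 0) w"
  obtains t s' where "exec c s t s'" "t \<le> T" "s' 0 = w" "\<And>i. i \<ge> N \<Longrightarrow> s' i = s i"
  using assms unfolding runs_def by blast

section \<open>Closure of polynomial time under composition, pairing, branching and folds\<close>

lemma ptime_comp:
  assumes "ptime f" "ptime g" shows "ptime (\<lambda>x. f (g x))"
proof -
  obtain c N T where T: "polyb T" and r: "\<And>M x. N \<le> M \<Longrightarrow> runs c M (T x) (code x) (code (f x))"
    using assms(1) by (rule ptimeE) blast
  obtain d N' U where U: "polyb U" and r': "\<And>M x. N' \<le> M \<Longrightarrow> runs d M (U x) (code x) (code (g x))"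
    using assms(2) by (rule ptimeE) blast
  show ?thesis
  proof (rule ptimeI)
    show "polyb (\<lambda>x. sz (f (g x)))"
      by (rule polyb_comp[OF ptime_sz ptime_sz]) fact+
    show "polyb (\<lambda>x. U x + T (g x))"
      by (intro polyb_add U polyb_comp[OF T] ptime_sz assms)
    show "runs (Seq d c) (max N N') (U x + T (g x)) (code x) (code (f (g x)))" for x
      unfolding runs_def
    proof (intro allI impI)
      fix s :: state assume s: "s 0 = code x"
      with r'[of "max N N'" x] have "runs d (max N N') (U x) (s 0) (code (g x))" by simp
      then obtain t s' where 1: "exec d s t s'" "t \<le> U x" "s' 0 = code (g x)" "\<And>i. i \<ge> max N N' \<Longrightarrow> s' i = s i"
        by (rule runsE) blast
      with r[of "max N N'" "g x"] have "runs c (max N N') (T (g x)) (s' 0) (code (f (g x)))" by simp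
      then obtain t' s'' where 2: "exec c s' t' s''" "t' \<le> T (g x)" "s'' 0 = code (f (g x))"
        "\<And>i. i \<ge> max N N' \<Longrightarrow> s'' i = s' i"
        by (rule runsE) blast
      have "exec (Seq d c) s (t + t') s''" using 1(1) 2(1) by (rule exec.Seq)
      with 1 2 show "\<exists>t s'. exec (Seq d c) s t s' \<and> t \<le> U x + T (g x) \<and>
        s' 0 = code (f (g x)) \<and> (\<forall>i\<ge>max N N'. s' i = s i)"
        by (intro exI[of _ "t + t'"] exI[of _ s'']) auto
    qed
  qed
qed

lemma ptime_pair:
  assumes "ptime f" "ptime g" shows "ptime (\<lambda>x. (f x, g x))"
proof -
  obtain c N T where T: "polyb T" and r: "\<And>M x. N \<le> M \<Longrightarrow> runs c M (T x) (code x) (code (f x))"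
    using assms(1) by (rule ptimeE) blast
  obtain d N' U where U: "polyb U" and r': "\<And>M x. N' \<le> M \<Longrightarrow> runs d M (U x) (code x) (code (g x))"
    using assms(2) by (rule ptimeE) blast
  \<comment> \<open>Neither program changes the variables \<open>M\<close> and \<open>Suc M\<close>;
    they keep the argument and the first result.\<close>
  define M where "M = Suc (max N N')"
  define p where "p = Seq (Assign M (Var 0)) (Seq c (Seq (Assign (Suc M) (Var 0))
     (Seq (Assign 0 (Var M)) (Seq d (Assign 0 (PairE (Var (Suc M)) (Var 0)))))))"
  show ?thesis
  proof (rule ptimeI)
    show "polyb (\<lambda>x. sz (f x, g x))"
      by (simp, intro polyb_intros ptime_sz assms)
    show "polyb (\<lambda>x. 4 + T x + U x)"
      by (intro polyb_intros T U)
    show "runs p (Suc (Suc M)) (4 + T x + U x) (code x) (code (f x, g x))" for x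
      unfolding runs_def
    proof (intro allI impI)
      fix s :: state assume s: "s 0 = code x"
      let ?s1 = "s(M := s 0)"
      have "runs c M (T x) (?s1 0) (code (f x))" using r[of M x] s by (simp add: M_def)
      then obtain t2 s2 where 2: "exec c ?s1 t2 s2" "t2 \<le> T x" "s2 0 = code (f x)" "\<And>i. i \<ge> M \<Longrightarrow> s2 i = ?s1 i"
        by (rule runsE) blast
      let ?s4 = "s2(Suc M := s2 0, 0 := s2 M)"
      have "runs d M (U x) (?s4 0) (code (g x))" using r'[of M x] s 2(4)[of M] by (simp add: M_def)
      then obtain t5 s5 where 5: "exec d ?s4 t5 s5" "t5 \<le> U x" "s5 0 = code (g x)" "\<And>i. i \<ge> M \<Longrightarrow> s5 i = ?s4 i"
        by (rule runsE) blast
      let ?s6 = "s5(0 := Pair (s5 (Suc M)) (s5 0))"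
      have "exec p s (1 + (t2 + (1 + (1 + (t5 + 1))))) ?s6"
        unfolding p_def
        apply (rule exec.Seq[of _ _ _ ?s1])
         apply (rule exec_assign, simp)
        apply (rule exec.Seq[OF 2(1)])
        apply (rule exec.Seq)
         apply (rule exec_assign, rule refl)
        apply (rule exec.Seq[of _ _ _ ?s4])
        apply (rule exec_assign, simp)
        apply (rule exec.Seq[OF 5(1)])
        apply (rule exec_assign, simp)
        done
      moreover have "?s6 0 = code (f x, g x)"
      proof -
        have "s5 (Suc M) = code (f x)" using 5(4)[of "Suc M"] 2(3) by simp
        then show ?thesis using 5(3) by simp
      qed
      moreover have "?s6 i = s i" if "Suc (Suc M) \<le> i" for i
        using that 5(4)[of i] 2(4)[of i] by (simp add: M_def)
      ultimately show "\<exists>t s'. exec p s t s' \<and> t \<le> 4 + T x + U x \<and>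
        s' 0 = code (f x, g x) \<and> (\<forall>i\<ge>Suc (Suc M). s' i = s i)"
        using 2(2) 5(2) by (intro exI[of _ "1 + (t2 + (1 + (1 + (t5 + 1))))"] exI[of _ ?s6]) auto
    qed
  qed
qed

lemma ptime_if:
  assumes "ptime b" "ptime f" "ptime g" shows "ptime (\<lambda>x. if b x then f x else g x)"
proof -
  obtain e N0 V where V: "polyb V" and r0: "\<And>M x. N0 \<le> M \<Longrightarrow> runs e M (V x) (code x) (code (b x))"
    using assms(1) by (rule ptimeE) blast
  obtain c N T where T: "polyb T" and r: "\<And>M x. N \<le> M \<Longrightarrow> runs c M (T x) (code x) (code (f x))"
    using assms(2) by (rule ptimeE) blast
  obtain d N' U where U: "polyb U" and r': "\<And>M x. N' \<le> M \<Longrightarrow> runs d M (U x) (code x) (code (g x))"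
    using assms(3) by (rule ptimeE) blast
  define M where "M = Suc (max N0 (max N N'))"
  define p where "p = Seq (Assign M (Var 0)) (Seq e (Seq (Assign (Suc M) (Var 0))
     (Seq (Assign 0 (Var M)) (Cond (Var (Suc M)) c d))))"
  show ?thesis
  proof (rule ptimeI)
    show "polyb (\<lambda>x. sz (if b x then f x else g x))"
      by (rule polyb_mono[of "\<lambda>x. sz (f x) + sz (g x)"]) (intro polyb_intros ptime_sz assms, simp)
    show "polyb (\<lambda>x. 4 + V x + T x + U x)"
      by (intro polyb_intros T U V)
    show "runs p (Suc (Suc M)) (4 + V x + T x + U x) (code x) (code (if b x then f x else g x))" for x
      unfolding runs_def
    proof (intro allI impI)
      fix s :: state assume s: "s 0 = code x"
      let ?s1 = "s(M := s 0)"
      have "runs e M (V x) (?s1 0) (code (b x))" using r0[of M x] s by (simp add: M_def)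
      then obtain t2 s2 where 2: "exec e ?s1 t2 s2" "t2 \<le> V x" "s2 0 = code (b x)" "\<And>i. i \<ge> M \<Longrightarrow> s2 i = ?s1 i"
        by (rule runsE) blast
      let ?s4 = "s2(Suc M := s2 0, 0 := s2 M)"
      have x4: "?s4 0 = code x" using s 2(4)[of M] by (simp add: M_def)
      obtain t5 s5 where 5: "exec (Cond (Var (Suc M)) c d) ?s4 (Suc t5) s5" "t5 \<le> T x + U x"
        "s5 0 = code (if b x then f x else g x)" "\<And>i. i \<ge> M \<Longrightarrow> s5 i = ?s4 i"
      proof (cases "b x")
        case True
        have "runs c M (T x) (?s4 0) (code (f x))" using r[of M x] x4 by (simp add: M_def)
        then obtain t5 s5 where 5: "exec c ?s4 t5 s5" "t5 \<le> T x" "s5 0 = code (f x)" "\<And>i. i \<ge> M \<Longrightarrow> s5 i = ?s4 i"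
          by (rule runsE) blast
        show ?thesis
          by (rule that[OF exec.CondTrue[OF _ 5(1)]]) (use 5 True 2(3) in auto)
      next
        case False
        have "runs d M (U x) (?s4 0) (code (g x))" using r'[of M x] x4 by (simp add: M_def)
        then obtain t5 s5 where 5: "exec d ?s4 t5 s5" "t5 \<le> U x" "s5 0 = code (g x)" "\<And>i. i \<ge> M \<Longrightarrow> s5 i = ?s4 i"
          by (rule runsE) blast
        show ?thesis
          by (rule that[OF exec.CondFalse[OF _ 5(1)]]) (use 5 False 2(3) in auto)
      qed
      have "exec p s (1 + (t2 + (1 + (1 + Suc t5)))) s5"
        unfolding p_def
        apply (rule exec.Seq[of _ _ _ ?s1])
         apply (rule exec_assign, simp)
        apply (rule exec.Seq[OF 2(1)])
        apply (rule exec.Seq)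
         apply (rule exec_assign, rule refl)
        apply (rule exec.Seq[of _ _ _ ?s4])
        apply (rule exec_assign, simp)
        apply (rule 5(1))
        done
      moreover have "s5 i = s i" if "Suc (Suc M) \<le> i" for i
        using that 5(4)[of i] 2(4)[of i] by (simp add: M_def)
      ultimately show "\<exists>t s'. exec p s t s' \<and> t \<le> 4 + V x + T x + U x \<and>
        s' 0 = code (if b x then f x else g x) \<and> (\<forall>i\<ge>Suc (Suc M). s' i = s i)"
        using 2(2) 5(2,3) by (intro exI[of _ "1 + (t2 + (1 + (1 + Suc t5)))"] exI[of _ s5]) auto
    qed
  qed
qed

text \<open>The bound \<open>b\<close> on all partial folds is a hypothesis because it does not
  follow from the bounds on \<open>f\<close>: a step that doubles its accumulator is polynomial, but
  iterated it leaves polynomial size.\<close>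

lemma ptime_foldl:
  assumes f: "ptime (\<lambda>p. f (fst (fst p)) (snd (fst p)) (snd p))"
    and g: "ptime g" and l: "ptime l"
    and b: "polyb b" "\<And>x n. n \<le> length (l x) \<Longrightarrow> sz (foldl (f x) (g x) (take n (l x))) \<le> b x"
  shows "ptime (\<lambda>x. foldl (f x) (g x) (l x))"
proof -
  obtain c N T where T: "polyb T"
    and r: "\<And>M x. N \<le> M \<Longrightarrow> runs c M (T x) (code x) (code (f (fst (fst x)) (snd (fst x)) (snd x)))"
    using f by (rule ptimeE) blast
  obtain d N' U where U: "polyb U" and r': "\<And>M x. N' \<le> M \<Longrightarrow> runs d M (U x) (code x) (code (g x))"
    using g by (rule ptimeE) blast
  obtain e N0 V where V: "polyb V" and r0: "\<And>M x. N0 \<le> M \<Longrightarrow> runs e M (V x) (code x) (code (l x))"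
    using l by (rule ptimeE) blast
  from T obtain a where a: "\<And>x. T x \<le> (sz x + 2) ^ a" unfolding polyb_def by blast
  \<comment> \<open>Bounds one call of \<open>c\<close>: its argument \<open>((x, y), z)\<close> has
    size at most \<open>sz x + b x + sz (l x) + 2\<close>.\<close>
  define W where "W x = (sz x + b x + sz (l x) + 4) ^ a" for x
  define M where "M = Suc (max N0 (max N N'))"
  define bd where "bd = Seq (Assign 0 (PairE (PairE (Var M) (Var (Suc M))) (LeftE (Var (Suc (Suc M))))))
     (Seq (Assign (Suc (Suc M)) (RightE (Var (Suc (Suc M))))) (Seq c (Assign (Suc M) (Var 0))))"
  define lp where "lp = While (Var (Suc (Suc M))) bd"
  define p where "p = Seq (Assign M (Var 0)) (Seq d (Seq (Assign (Suc M) (Var 0))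
     (Seq (Assign 0 (Var M)) (Seq e (Seq (Assign (Suc (Suc M)) (Var 0))
     (Seq lp (Assign 0 (Var (Suc M)))))))))"
  have N: "N \<le> M" "N' \<le> M" "N0 \<le> M" "M > 0" by (auto simp: M_def)
  \<comment> \<open>The prefix \<open>xs\<close> already consumed belongs to the invariant because
    it places the accumulator \<open>y\<close> under the bound \<open>b x\<close>, and the next
    element under \<open>sz (l x)\<close>.\<close>
  have loop: "\<exists>t s'. exec lp s t s' \<and> t \<le> 1 + length ys * (4 + W x) \<and>
      s' (Suc M) = code (foldl (f x) y ys) \<and> (\<forall>i\<ge>Suc (Suc (Suc M)). s' i = s i)"
    if "s M = code x" "s (Suc M) = code y" "s (Suc (Suc M)) = code ys"
      "l x = xs @ ys" "y = foldl (f x) (g x) xs" for s x y xs ys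
    using that
  proof (induction ys arbitrary: s y xs)
    case Nil
    then have "exec lp s 1 s" unfolding lp_def by (intro exec.WhileFalse) simp
    with Nil show ?case by (intro exI[of _ 1] exI[of _ s]) auto
  next
    case (Cons z zs)
    let ?s2 = "s(0 := code ((x, y), z), Suc (Suc M) := code zs)"
    let ?y' = "f x y z"
    have "runs c M (T ((x, y), z)) (?s2 0) (code ?y')"
      using r[OF N(1), of "((x, y), z)"] by simp
    then obtain t s3 where 3: "exec c ?s2 t s3" "t \<le> T ((x, y), z)" "s3 0 = code ?y'"
      "\<And>i. i \<ge> M \<Longrightarrow> s3 i = ?s2 i"
      by (rule runsE) blast
    let ?s4 = "s3(Suc M := s3 0)"
    have ex: "exec bd s (1 + (1 + (t + 1))) ?s4"
      unfolding bd_def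
      apply (rule exec.Seq[of _ _ _ "s(0 := code ((x, y), z))"])
       apply (rule exec_assign, simp add: Cons.prems)
      apply (rule exec.Seq[of _ _ _ ?s2])
       apply (rule exec_assign, simp add: Cons.prems)
      apply (rule exec.Seq[OF 3(1)])
      apply (rule exec_assign, simp)
      done
    have "T ((x, y), z) \<le> (sz ((x, y), z) + 2) ^ a" by (rule a)
    also have "\<dots> \<le> W x"
    proof -
      have "sz y \<le> b x" using b(2)[of "length xs" x] Cons.prems(4,5) by simp
      moreover have "sz z \<le> sz (l x)" by (rule sz_mem_le) (simp add: Cons.prems(4))
      ultimately show ?thesis unfolding W_def by (intro power_mono) auto
    qed
    finally have tW: "t \<le> W x" using 3(2) by linarith
    have "\<exists>t s'. exec lp ?s4 t s' \<and> t \<le> 1 + length zs * (4 + W x) \<and>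
      s' (Suc M) = code (foldl (f x) ?y' zs) \<and> (\<forall>i\<ge>Suc (Suc (Suc M)). s' i = ?s4 i)"
    proof (rule Cons.IH)
      show "?s4 M = code x" using 3(4)[of M] Cons.prems N by simp
      show "?s4 (Suc M) = code (f x y z)" using 3(3) by simp
      show "?s4 (Suc (Suc M)) = code zs" using 3(4)[of "Suc (Suc M)"] by simp
      show "l x = (xs @ [z]) @ zs" using Cons.prems by simp
      show "f x y z = foldl (f x) (g x) (xs @ [z])" using Cons.prems by simp
    qed
    then obtain u s5 where 5: "exec lp ?s4 u s5" "u \<le> 1 + length zs * (4 + W x)"
      "s5 (Suc M) = code (foldl (f x) ?y' zs)" "\<And>i. i \<ge> Suc (Suc (Suc M)) \<Longrightarrow> s5 i = ?s4 i"
      by blast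
    have "exec lp s (Suc (1 + (1 + (t + 1)) + u)) s5"
      unfolding lp_def by (rule exec.WhileTrue[OF _ ex 5(1)[unfolded lp_def]]) (use Cons.prems in simp)
    moreover have "s5 i = s i" if "i \<ge> Suc (Suc (Suc M))" for i
      using 5(4)[of i] 3(4)[of i] that by simp
    ultimately show ?case
      using 5 tW by (intro exI[of _ "Suc (1 + (1 + (t + 1)) + u)"] exI[of _ s5]) auto
  qed
  show ?thesis
  proof (rule ptimeI)
    show "polyb (\<lambda>x. sz (foldl (f x) (g x) (l x)))"
      using b(2)[OF order_refl] by (intro polyb_mono[OF b(1)]) simp
    have W: "polyb W" unfolding W_def by (intro polyb_intros b ptime_sz l)
    show "polyb (\<lambda>x. 10 + U x + V x + sz (l x) * (4 + W x))"
      by (intro polyb_intros U V W ptime_sz l)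
    show "runs p (Suc (Suc (Suc M))) (10 + U x + V x + sz (l x) * (4 + W x)) (code x) (code (foldl (f x) (g x) (l x)))" for x
      unfolding runs_def
    proof (intro allI impI)
      fix s :: state assume s: "s 0 = code x"
      let ?s1 = "s(M := s 0)"
      have "runs d M (U x) (?s1 0) (code (g x))" using r'[of M x] s N by simp
      then obtain t2 s2 where 2: "exec d ?s1 t2 s2" "t2 \<le> U x" "s2 0 = code (g x)" "\<And>i. i \<ge> M \<Longrightarrow> s2 i = ?s1 i"
        by (rule runsE) blast
      let ?s4 = "s2(Suc M := s2 0, 0 := s2 M)"
      have "runs e M (V x) (?s4 0) (code (l x))" using r0[of M x] s N 2(4)[of M] by simp
      then obtain t5 s5 where 5: "exec e ?s4 t5 s5" "t5 \<le> V x" "s5 0 = code (l x)" "\<And>i. i \<ge> M \<Longrightarrow> s5 i = ?s4 i"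
        by (rule runsE) blast
      let ?s6 = "s5(Suc (Suc M) := s5 0)"
      have "\<exists>t s'. exec lp ?s6 t s' \<and> t \<le> 1 + length (l x) * (4 + W x) \<and>
        s' (Suc M) = code (foldl (f x) (g x) (l x)) \<and> (\<forall>i\<ge>Suc (Suc (Suc M)). s' i = ?s6 i)"
        by (rule loop[where xs = "[]"]) (use 5(3) 5(4)[of M] 5(4)[of "Suc M"] 2(3) 2(4)[of M] s N in auto)
      then obtain t7 s7 where 7: "exec lp ?s6 t7 s7" "t7 \<le> 1 + length (l x) * (4 + W x)"
        "s7 (Suc M) = code (foldl (f x) (g x) (l x))" "\<And>i. i \<ge> Suc (Suc (Suc M)) \<Longrightarrow> s7 i = ?s6 i"
        by blast
      let ?s8 = "s7(0 := s7 (Suc M))"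
      let ?t = "1 + (t2 + (1 + (1 + (t5 + (1 + (t7 + 1))))))"
      have "exec p s ?t ?s8"
        unfolding p_def
        apply (rule exec.Seq[of _ _ _ ?s1])
         apply (rule exec_assign, simp)
        apply (rule exec.Seq[OF 2(1)])
        apply (rule exec.Seq)
         apply (rule exec_assign, rule refl)
        apply (rule exec.Seq[of _ _ _ ?s4])
        apply (rule exec_assign, simp)
        apply (rule exec.Seq[OF 5(1)])
        apply (rule exec.Seq[of _ _ _ ?s6])
        apply (rule exec_assign, simp)
        apply (rule exec.Seq[OF 7(1)])
        apply (rule exec_assign, simp)
        done
      moreover have "?s8 i = s i" if "Suc (Suc (Suc M)) \<le> i" for i
        using that 7(4)[of i] 5(4)[of i] 2(4)[of i] by simp
      moreover have "?t \<le> 10 + U x + V x + sz (l x) * (4 + W x)"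
      proof -
        have "length (l x) * (4 + W x) \<le> sz (l x) * (4 + W x)"
          by (intro mult_right_mono length_le_sz) simp
        then show ?thesis using 2(2) 5(2) 7(2) by linarith
      qed
      ultimately show "\<exists>t s'. exec p s t s' \<and> t \<le> 10 + U x + V x + sz (l x) * (4 + W x) \<and>
        s' 0 = code (foldl (f x) (g x) (l x)) \<and> (\<forall>i\<ge>Suc (Suc (Suc M)). s' i = s i)"
        using 7(3) by (intro exI[of _ ?t] exI[of _ ?s8]) auto
    qed
  qed
qed

section \<open>Polynomial-time functions on numbers and lists\<close>

lemma ptime_id: "ptime (\<lambda>x. x)"
  by (rule ptime_expr[where e = "Var 0"]) (auto intro: polyb_sz)

primrec tree_expr :: "tree \<Rightarrow> expr" where
  "tree_expr Atom = AtomE"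
| "tree_expr (Pair a b) = PairE (tree_expr a) (tree_expr b)"

lemma tree_expr: "expr_val (tree_expr v) s = v"
  by (induction v) auto

lemma ptime_const: "ptime (\<lambda>_. v)"
  by (rule ptime_expr[where e = "tree_expr (code v)"]) (auto intro: polyb_const simp: tree_expr)

text \<open>Only the code matters: a cons cell and a pair, or a number and a list of units, share a
  code, so a program for one serves the other.\<close>

lemma ptime_code_eq:
  assumes "ptime f" "\<And>x. code (g x) = code (f x)" shows "ptime g"
  using assms unfolding ptime_def by simp

lemma ptime_comp2:
  assumes "ptime (\<lambda>p. h (fst p) (snd p))" "ptime f" "ptime g"
  shows "ptime (\<lambda>x. h (f x) (g x))"
  using ptime_comp[OF assms(1) ptime_pair[OF assms(2,3)]] by simp

lemma ptime_fst: "ptime f \<Longrightarrow> ptime (\<lambda>x. fst (f x))"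
  by (rule ptime_comp[of fst], rule ptime_expr[where e = "LeftE (Var 0)"])
    (auto simp: code_prod_def intro: polyb_mono[OF polyb_sz])

lemma ptime_snd: "ptime f \<Longrightarrow> ptime (\<lambda>x. snd (f x))"
  by (rule ptime_comp[of snd], rule ptime_expr[where e = "RightE (Var 0)"])
    (auto simp: code_prod_def intro: polyb_mono[OF polyb_sz])

lemma ptime_Cons: "ptime f \<Longrightarrow> ptime g \<Longrightarrow> ptime (\<lambda>x. f x # g x)"
  by (rule ptime_code_eq[OF ptime_pair]) auto

lemma ptime_Suc: assumes "ptime f" shows "ptime (\<lambda>x. Suc (f x))"
  by (rule ptime_code_eq[OF ptime_pair[OF ptime_const[of "()"] assms]]) auto

lemma ptime_not: "ptime b \<Longrightarrow> ptime (\<lambda>x. \<not> b x)"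
  using ptime_if[of b "\<lambda>_. False" "\<lambda>_. True"] by (simp add: ptime_const if_bool_eq_conj)

lemma ptime_conj: assumes "ptime b" "ptime c" shows "ptime (\<lambda>x. b x \<and> c x)"
  by (rule ptime_code_eq[OF ptime_if[of b c "\<lambda>_. False"]]) (auto intro: assms ptime_const)

lemma ptime_disj: assumes "ptime b" "ptime c" shows "ptime (\<lambda>x. b x \<or> c x)"
  by (rule ptime_code_eq[OF ptime_if[of b "\<lambda>_. True" c]]) (auto intro: assms ptime_const)

lemma ptime_imp: assumes "ptime b" "ptime c" shows "ptime (\<lambda>x. b x \<longrightarrow> c x)"
  by (rule ptime_code_eq[OF ptime_if[of b c "\<lambda>_. True"]]) (auto intro: assms ptime_const)

lemma ptime_bool_eq: "ptime b \<Longrightarrow> ptime c \<Longrightarrow> ptime (\<lambda>x. (b x :: bool) = c x)"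
  by (rule ptime_code_eq[OF ptime_if[of b c "\<lambda>x. \<not> c x"]]) (auto intro: ptime_not)

lemma ptime_null: assumes "ptime l" shows "ptime (\<lambda>x. l x = [])"
proof -
  have "ptime (\<lambda>l :: 'b list. l = [])"
  proof (rule ptimeI)
    show "polyb (\<lambda>l :: 'b list. sz (l = []))" by (rule polyb_mono[OF polyb_const[of 1]]) (rule sz_bool)
    show "polyb (\<lambda>_ :: 'b list. 2)" by (rule polyb_const)
    show "runs (Cond (Var 0) (Assign 0 AtomE) (Assign 0 (PairE AtomE AtomE))) 1 2 (code x) (code (x = []))"
      for x :: "'b list"
      unfolding runs_def
    proof (intro allI impI)
      fix s :: state assume s: "s 0 = code x"
      let ?s = "s(0 := code (x = []))"
      have "exec (Cond (Var 0) (Assign 0 AtomE) (Assign 0 (PairE AtomE AtomE))) s (Suc 1) ?s"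
      proof (cases "x = []")
        case True
        then show ?thesis using s by (intro exec.CondFalse exec_assign) auto
      next
        case False
        then show ?thesis using s by (intro exec.CondTrue exec_assign) auto
      qed
      then show "\<exists>t s'. exec (Cond (Var 0) (Assign 0 AtomE) (Assign 0 (PairE AtomE AtomE))) s t s' \<and>
        t \<le> 2 \<and> s' 0 = code (x = []) \<and> (\<forall>i\<ge>1. s' i = s i)"
        by (intro exI[of _ "Suc 1"] exI[of _ ?s]) auto
    qed
  qed
  then show ?thesis using assms by (rule ptime_comp)
qed

lemma ptime_tl: assumes "ptime l" shows "ptime (\<lambda>x. tl (l x))"
proof -
  have "ptime (tl :: 'b list \<Rightarrow> 'b list)"
  proof (rule ptime_expr[where e = "RightE (Var 0)"])
    show "polyb (\<lambda>xs :: 'b list. sz (tl xs))"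
      by (rule polyb_mono[OF polyb_sz]) (metis drop_Suc drop0 sz_drop)
    show "expr_val (RightE (Var 0)) s = code (tl x)" if "s 0 = code x" for x :: "'b list" and s
      using that by (cases x) auto
  qed
  then show ?thesis using assms by (rule ptime_comp)
qed

definition hd_or :: "'a \<Rightarrow> 'a list \<Rightarrow> 'a" where
  "hd_or d xs = (case xs of [] \<Rightarrow> d | x # _ \<Rightarrow> x)"

lemma ptime_hd_or: assumes "ptime l" shows "ptime (\<lambda>x. hd_or d (l x))"
proof -
  have "ptime (hd_or d)"
  proof (rule ptimeI)
    show "polyb (\<lambda>xs. sz (hd_or d xs))"
      by (rule polyb_mono[of "\<lambda>xs. sz d + sz xs"])
        (auto intro!: polyb_intros simp: hd_or_def split: list.splits)
    show "polyb (\<lambda>_ :: 'b list. 2)" by (rule polyb_const)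
    show "runs (Cond (Var 0) (Assign 0 (LeftE (Var 0))) (Assign 0 (tree_expr (code d)))) 1 2
      (code x) (code (hd_or d x))" (is "runs ?p _ _ _ _") for x
      unfolding runs_def
    proof (intro allI impI)
      fix s :: state assume s: "s 0 = code x"
      let ?s = "s(0 := code (hd_or d x))"
      have "exec ?p s (Suc 1) ?s"
      proof (cases x)
        case Nil
        then show ?thesis using s by (intro exec.CondFalse exec_assign) (auto simp: tree_expr hd_or_def)
      next
        case (Cons y ys)
        then show ?thesis using s by (intro exec.CondTrue exec_assign) (auto simp: hd_or_def)
      qed
      then show "\<exists>t s'. exec ?p s t s' \<and> t \<le> 2 \<and> s' 0 = code (hd_or d x) \<and> (\<forall>i\<ge>1. s' i = s i)"
        by (intro exI[of _ "Suc 1"] exI[of _ ?s]) auto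
    qed
  qed
  then show ?thesis using assms by (rule ptime_comp)
qed

text \<open>A left fold that conses yields the image in reverse order. With \<open>f\<close> the
  second projection this gives \<open>rev\<close> and then append; one more reversal gives
  \<open>map\<close>.\<close>

lemma ptime_snoc_fold:
  assumes f: "ptime (\<lambda>p. f (fst p) (snd p))" and "ptime g" and l: "ptime l"
  shows "ptime (\<lambda>x. rev (map (f x) (l x)) @ g x)"
proof -
  have eq: "foldl (\<lambda>a y. f x y # a) zs ys = rev (map (f x) ys) @ zs" for x ys zs
    by (induction ys arbitrary: zs) auto
  obtain a where a: "\<And>p. sz (f (fst p) (snd p)) \<le> (sz p + 2) ^ a"
    using ptime_sz[OF f] unfolding polyb_def by blast
  have "ptime (\<lambda>x. foldl (\<lambda>a y. f x y # a) (g x) (l x))"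
  proof (rule ptime_foldl[where b = "\<lambda>x. sz (l x) * Suc ((sz x + sz (l x) + 3) ^ a) + sz (g x)"])
    show "ptime (\<lambda>p. f (fst (fst p)) (snd p) # snd (fst p))"
      by (intro ptime_Cons ptime_fst ptime_snd ptime_id ptime_comp2[OF f])
    show "polyb (\<lambda>x. sz (l x) * Suc ((sz x + sz (l x) + 3) ^ a) + sz (g x))"
      by (intro polyb_intros ptime_sz assms)
    show "sz (foldl (\<lambda>a y. f x y # a) (g x) (take n (l x)))
      \<le> sz (l x) * Suc ((sz x + sz (l x) + 3) ^ a) + sz (g x)" for x n
    proof -
      have "sz (map (f x) (take n (l x))) \<le> length (map (f x) (take n (l x))) * Suc ((sz x + sz (l x) + 3) ^ a)"
      proof (rule sz_list_le)
        fix z assume "z \<in> set (map (f x) (take n (l x)))"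
        then obtain y where y: "y \<in> set (l x)" "z = f x y" by (auto dest: in_set_takeD)
        have "sz z \<le> (sz (x, y) + 2) ^ a" using a[of "(x, y)"] y by simp
        also have "\<dots> \<le> (sz x + sz (l x) + 3) ^ a"
          by (rule power_mono) (use sz_mem_le[OF y(1)] in auto)
        finally show "sz z \<le> (sz x + sz (l x) + 3) ^ a" .
      qed
      also have "\<dots> \<le> sz (l x) * Suc ((sz x + sz (l x) + 3) ^ a)"
        by (rule mult_right_mono) (use length_le_sz[of "l x"] in auto)
      finally show ?thesis unfolding eq by (simp add: sz_append sz_rev)
    qed
  qed (fact assms)+
  then show ?thesis unfolding eq .
qed

lemma ptime_rev: assumes "ptime l" shows "ptime (\<lambda>x. rev (l x))"
  using ptime_snoc_fold[where f = "\<lambda>x y. y", OF ptime_snd[OF ptime_id] ptime_const[of "[]"] assms] by simp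

lemma ptime_map:
  assumes "ptime (\<lambda>p. f (fst p) (snd p))" "ptime l" shows "ptime (\<lambda>x. map (f x) (l x))"
  using ptime_rev[OF ptime_snoc_fold[OF assms(1) ptime_const[of "[]"] assms(2)]] by simp

lemma ptime_append: assumes "ptime l" "ptime m" shows "ptime (\<lambda>x. l x @ m x)"
  using ptime_snoc_fold[where f = "\<lambda>x y. y", OF ptime_snd[OF ptime_id] assms(2) ptime_rev[OF assms(1)]] by simp

lemma sz_filter: "sz (filter P xs) \<le> sz xs"
  by (induction xs) auto

lemma ptime_filter:
  assumes f: "ptime (\<lambda>p. P (fst p) (snd p))" and l: "ptime l"
  shows "ptime (\<lambda>x. filter (P x) (l x))"
proof -
  have eq: "foldl (\<lambda>a y. if P x y then y # a else a) zs ys = rev (filter (P x) ys) @ zs" for x ys zs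
    by (induction ys arbitrary: zs) auto
  have "ptime (\<lambda>x. foldl (\<lambda>a y. if P x y then y # a else a) [] (l x))"
  proof (rule ptime_foldl[where b = "\<lambda>x. sz (l x)"])
    show "ptime (\<lambda>p. if P (fst (fst p)) (snd p) then snd p # snd (fst p) else snd (fst p))"
      by (intro ptime_if ptime_Cons ptime_fst ptime_snd ptime_id ptime_comp2[OF f])
    show "polyb (\<lambda>x. sz (l x))" by (intro ptime_sz assms)
    show "sz (foldl (\<lambda>a y. if P x y then y # a else a) [] (take n (l x))) \<le> sz (l x)" for x n
      unfolding eq using sz_filter[of "P x" "take n (l x)"] sz_take[of n "l x"] by (simp add: sz_rev)
  qed (fact assms ptime_const)+
  from ptime_rev[OF this] show ?thesis unfolding eq by simp
qed

lemma sz_concat: "sz (concat xss) \<le> sz xss"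
  by (induction xss) (auto simp: sz_append)

lemma ptime_concat: assumes "ptime l" shows "ptime (\<lambda>x. concat (l x))"
proof -
  have eq: "foldl (@) zs xss = zs @ concat xss" for zs :: "'b list" and xss
    by (induction xss arbitrary: zs) auto
  have "ptime (\<lambda>x. foldl (@) [] (l x))"
  proof (rule ptime_foldl[where b = "\<lambda>x. sz (l x)"])
    show "sz (foldl (@) [] (take n (l x))) \<le> sz (l x)" for x n
      unfolding eq using sz_concat[of "take n (l x)"] sz_take[of n "l x"] by simp
  qed (intro ptime_append ptime_fst ptime_snd ptime_id assms ptime_const ptime_sz)+
  then show ?thesis unfolding eq by simp
qed

lemma ptime_length: assumes "ptime l" shows "ptime (\<lambda>x. length (l x))"
proof -
  have eq: "foldl (\<lambda>n _. Suc n) m ys = length ys + m" for m and ys :: "'b list"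
    by (induction ys arbitrary: m) auto
  have "ptime (\<lambda>x. foldl (\<lambda>n _. Suc n) 0 (l x))"
  proof (rule ptime_foldl[where b = "\<lambda>x. sz (l x)"])
    show "sz (foldl (\<lambda>n _. Suc n) 0 (take n (l x))) \<le> sz (l x)" for x n
      unfolding eq using length_le_sz[of "take n (l x)"] sz_take[of n "l x"] by simp
  qed (intro ptime_Suc ptime_fst ptime_snd ptime_id assms ptime_const ptime_sz)+
  then show ?thesis unfolding eq by simp
qed

text \<open>A counter in the form of a list. It has the same code as \<open>n\<close>, so a loop
  with \<open>n\<close> rounds is a fold.\<close>

definition units :: "nat \<Rightarrow> unit list" where "units n = replicate n ()"

lemma code_units: "code (units n) = code n"
  unfolding units_def by (induction n) auto

lemma ptime_units: "ptime f \<Longrightarrow> ptime (\<lambda>x. units (f x))"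
  by (erule ptime_code_eq) (rule code_units)

lemma take_units: "take m (units n) = units (min m n)"
  by (simp add: units_def min.commute)

lemma ptime_funpow:
  fixes f :: "'a::codable \<Rightarrow> 'b::codable \<Rightarrow> 'b"
  assumes f: "ptime (\<lambda>p. f (fst p) (snd p))" and "ptime n" "ptime g"
    and b: "polyb b" "\<And>x i. i \<le> n x \<Longrightarrow> sz ((f x ^^ i) (g x)) \<le> b x"
  shows "ptime (\<lambda>x. (f x ^^ n x) (g x))"
proof -
  have eq: "foldl (\<lambda>a _. f x a) y (units m) = (f x ^^ m) y" for x y m
    unfolding units_def by (induction m arbitrary: y) (auto simp: funpow_swap1)
  have "ptime (\<lambda>x. foldl (\<lambda>a _. f x a) (g x) (units (n x)))"
  proof (rule ptime_foldl[where b = b])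
    show "sz (foldl (\<lambda>a _. f x a) (g x) (take m (units (n x)))) \<le> b x" for x m
      unfolding take_units eq by (rule b) simp
  qed (intro ptime_comp2[OF f] ptime_fst ptime_snd ptime_id assms ptime_units)+
  then show ?thesis unfolding eq .
qed

lemma ptime_drop: assumes "ptime n" "ptime l" shows "ptime (\<lambda>x. drop (n x) (l x))"
proof -
  have eq: "(tl ^^ m) xs = drop m xs" for m and xs :: "'b list"
    by (induction m arbitrary: xs) (auto simp: drop_Suc tl_drop)
  have "ptime (\<lambda>x. (tl ^^ n x) (l x))"
    by (rule ptime_funpow[where b = "\<lambda>x. sz (l x)"])
      (use ptime_tl[OF ptime_snd[OF ptime_id]] in \<open>simp_all add: eq sz_drop assms ptime_sz\<close>)
  then show ?thesis unfolding eq .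
qed

lemma ptime_add: assumes "ptime f" "ptime g" shows "ptime (\<lambda>x. f x + g x :: nat)"
proof -
  have eq: "(Suc ^^ m) n = m + n" for m n by (induction m) auto
  have "ptime (\<lambda>x. (Suc ^^ f x) (g x))"
    by (rule ptime_funpow[where b = "\<lambda>x. f x + g x"])
      (use ptime_sz[OF assms(1)] ptime_sz[OF assms(2)] in
        \<open>simp_all add: eq polyb_add assms ptime_Suc ptime_snd ptime_id\<close>)
  then show ?thesis unfolding eq .
qed

lemma ptime_pred: assumes "ptime f" shows "ptime (\<lambda>x. f x - Suc 0)"
proof -
  have "ptime (\<lambda>n. n - Suc 0)"
  proof (rule ptime_expr[where e = "RightE (Var 0)"])
    show "polyb (\<lambda>n. sz (n - Suc 0))" by (rule polyb_mono[OF polyb_sz]) simp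
    show "expr_val (RightE (Var 0)) s = code (x - Suc 0)" if "s 0 = code x" for x s
      using that by (cases x) auto
  qed
  then show ?thesis using assms by (rule ptime_comp)
qed

lemma ptime_diff: assumes "ptime f" "ptime g" shows "ptime (\<lambda>x. f x - g x :: nat)"
proof -
  have eq: "((\<lambda>k. k - Suc 0) ^^ m) n = n - m" for m n by (induction m) auto
  have "ptime (\<lambda>x. ((\<lambda>k. k - Suc 0) ^^ g x) (f x))"
    by (rule ptime_funpow[where b = "\<lambda>x. f x"])
      (use ptime_sz[OF assms(1)] ptime_pred[OF ptime_snd[OF ptime_id]] in
        \<open>simp_all add: eq assms\<close>)
  then show ?thesis unfolding eq .
qed

lemma ptime_is_0: assumes "ptime f" shows "ptime (\<lambda>x. f x = (0::nat))"
  by (rule ptime_code_eq[OF ptime_null[OF ptime_units[OF assms]]]) (simp add: units_def)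

lemma ptime_le: assumes "ptime f" "ptime g" shows "ptime (\<lambda>x. f x \<le> (g x :: nat))"
  by (rule ptime_code_eq[OF ptime_is_0[OF ptime_diff[OF assms]]]) simp

lemma ptime_less: assumes "ptime f" "ptime g" shows "ptime (\<lambda>x. f x < (g x :: nat))"
  by (rule ptime_code_eq[OF ptime_not[OF ptime_le[OF assms(2,1)]]]) (simp add: not_le)

lemma ptime_nat_eq: assumes "ptime f" "ptime g" shows "ptime (\<lambda>x. f x = (g x :: nat))"
  by (rule ptime_code_eq[OF ptime_conj[OF ptime_le[OF assms] ptime_le[OF assms(2,1)]]])
    (simp add: eq_iff)

lemma ptime_sum_list: assumes "ptime l" shows "ptime (\<lambda>x. sum_list (l x) :: nat)"
proof -
  have eq: "foldl (+) m ys = m + sum_list ys" for m and ys :: "nat list"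
    by (induction ys arbitrary: m) auto
  have le: "sum_list ys \<le> sz ys" for ys :: "nat list" by (induction ys) auto
  have "ptime (\<lambda>x. foldl (+) 0 (l x))"
  proof (rule ptime_foldl[where b = "\<lambda>x. sz (l x)"])
    show "sz (foldl (+) 0 (take n (l x))) \<le> sz (l x)" for x n
      unfolding eq using le[of "take n (l x)"] sz_take[of n "l x"] by simp
  qed (intro ptime_add ptime_fst ptime_snd ptime_id assms ptime_const ptime_sz)+
  then show ?thesis unfolding eq by simp
qed

lemma ptime_mult: assumes "ptime f" "ptime g" shows "ptime (\<lambda>x. f x * g x :: nat)"
proof -
  have "ptime (\<lambda>x. sum_list (map (\<lambda>_. g x) (units (f x))))"
    by (intro ptime_sum_list ptime_map ptime_units assms ptime_comp[OF assms(2)] ptime_fst ptime_id)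
  then show ?thesis by (simp add: units_def sum_list_replicate map_replicate_const)
qed

lemma ptime_replicate: assumes "ptime f" "ptime g" shows "ptime (\<lambda>x. replicate (f x) (g x))"
proof -
  have "ptime (\<lambda>x. map (\<lambda>_. g x) (units (f x)))"
    by (intro ptime_map ptime_units assms ptime_comp[OF assms(2)] ptime_fst ptime_id)
  then show ?thesis by (simp add: units_def map_replicate_const)
qed

lemma ptime_upt0: assumes "ptime f" shows "ptime (\<lambda>x. [0..<f x])"
proof -
  have eq: "foldl (\<lambda>a _. a @ [length a]) [] (units m) = [0..<m]" for m
  proof (induction m)
    case (Suc m)
    have "units (Suc m) = units m @ [()]" by (simp add: units_def replicate_append_same)
    then show ?case using Suc by simp
  qed (simp add: units_def)
  have "ptime (\<lambda>x. foldl (\<lambda>a _. a @ [length a]) [] (units (f x)))"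
  proof (rule ptime_foldl[where b = "\<lambda>x. f x * Suc (f x)"])
    have "polyb f" using ptime_sz[OF assms] by simp
    then show "polyb (\<lambda>x. f x * Suc (f x))" by (intro polyb_intros)
    show "sz (foldl (\<lambda>a _. a @ [length a]) [] (take n (units (f x)))) \<le> f x * Suc (f x)" for x n
    proof -
      have "sz [0..<min n (f x)] \<le> length [0..<min n (f x)] * Suc (f x)"
        by (rule sz_list_le) auto
      also have "\<dots> \<le> f x * Suc (f x)" by (rule mult_right_mono) auto
      finally show ?thesis unfolding take_units eq .
    qed
  qed (intro ptime_append ptime_Cons ptime_length ptime_fst ptime_snd ptime_id assms ptime_const ptime_units)+
  then show ?thesis unfolding eq .
qed

lemma ptime_take: assumes "ptime n" "ptime l" shows "ptime (\<lambda>x. take (n x) (l x))"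
proof -
  have "ptime (\<lambda>x. rev (drop (length (l x) - n x) (rev (l x))))"
    by (intro ptime_rev ptime_drop ptime_diff ptime_length assms)
  moreover have "rev (drop (length xs - k) (rev xs)) = take k xs" for k and xs :: "'b list"
    by (cases "k \<le> length xs") (auto simp: rev_drop)
  ultimately show ?thesis by simp
qed

text \<open>Replaces \<open>!\<close>, whose values beyond the end of the list are unspecified and
  hence not known to be computed by any program.\<close>

definition nth_or :: "'a \<Rightarrow> 'a list \<Rightarrow> nat \<Rightarrow> 'a" where
  "nth_or d xs i = hd_or d (drop i xs)"

lemma nth_or: "nth_or d xs i = (if i < length xs then xs ! i else d)"
  by (auto simp: nth_or_def hd_or_def Cons_nth_drop_Suc[symmetric])

lemma ptime_nth_or: "ptime l \<Longrightarrow> ptime n \<Longrightarrow> ptime (\<lambda>x. nth_or d (l x) (n x))"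
  unfolding nth_or_def by (intro ptime_hd_or ptime_drop)

lemma ptime_Ball:
  assumes "ptime (\<lambda>p. P (fst p) (snd p))" "ptime l" shows "ptime (\<lambda>x. \<forall>y\<in>set (l x). P x y)"
  by (rule ptime_code_eq[OF ptime_null[OF ptime_filter[OF ptime_not[OF assms(1)] assms(2)]]])
    (simp add: filter_empty_conv)

lemma ptime_Bex:
  assumes "ptime (\<lambda>p. P (fst p) (snd p))" "ptime l" shows "ptime (\<lambda>x. \<exists>y\<in>set (l x). P x y)"
  by (rule ptime_code_eq[OF ptime_not[OF ptime_Ball[OF ptime_not[OF assms(1)] assms(2)]]]) simp

lemma ptime_nat_mem:
  assumes "ptime f" "ptime l" shows "ptime (\<lambda>x. (f x :: nat) \<in> set (l x))"
  by (rule ptime_code_eq[OF ptime_Bex[of "\<lambda>x y. y = f x", OF ptime_nat_eq assms(2)]])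
    ((intro ptime_comp[OF assms(1)] ptime_fst ptime_snd ptime_id)+, auto)

lemma ptime_even: assumes "ptime f" shows "ptime (\<lambda>x. even (f x :: nat))"
proof -
  have eq: "(Not ^^ m) True = even m" for m by (induction m) auto
  have "ptime (\<lambda>x. (Not ^^ f x) True)"
    by (rule ptime_funpow[where b = "\<lambda>_. 1"])
      (intro ptime_not ptime_snd ptime_id assms ptime_const polyb_const sz_bool)+
  then show ?thesis unfolding eq .
qed

lemma ptime_list_eq:
  assumes e: "ptime (\<lambda>p :: 'b::codable \<times> 'b. fst p = snd p)" and l: "ptime l" and m: "ptime m"
  shows "ptime (\<lambda>x. l x = (m x :: 'b list))"
proof (rule ptime_code_eq)
  show "ptime (\<lambda>x. length (l x) = length (m x) \<and>
    (\<forall>i\<in>set [0..<length (l x)]. nth_or undefined (l x) i = nth_or undefined (m x) i))"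
    by (intro ptime_conj ptime_nat_eq ptime_Ball ptime_upt0 ptime_length l m ptime_nth_or
        ptime_comp2[OF e] ptime_comp[OF l] ptime_comp[OF m] ptime_fst ptime_snd ptime_id)
  have "(l x = m x) = (length (l x) = length (m x) \<and>
    (\<forall>i\<in>set [0..<length (l x)]. nth_or undefined (l x) i = nth_or undefined (m x) i))" for x
    by (subst list_eq_iff_nth_eq) (auto simp: nth_or)
  then show "code (l x = m x) = code (length (l x) = length (m x) \<and>
    (\<forall>i\<in>set [0..<length (l x)]. nth_or undefined (l x) i = nth_or undefined (m x) i))" for x
    by (rule arg_cong)
qed

lemma ptime_comp3:
  assumes "ptime (\<lambda>p. h (fst p) (fst (snd p)) (snd (snd p)))" "ptime a" "ptime b" "ptime c"
  shows "ptime (\<lambda>x. h (a x) (b x) (c x))"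
  using ptime_comp[OF assms(1) ptime_pair[OF assms(2) ptime_pair[OF assms(3,4)]]] by simp

lemma ptime_nat_list_eq: "ptime l \<Longrightarrow> ptime m \<Longrightarrow> ptime (\<lambda>x. l x = (m x :: nat list))"
  by (rule ptime_list_eq) (intro ptime_nat_eq ptime_fst ptime_snd ptime_id)+

lemma ptime_bool_list_eq: "ptime l \<Longrightarrow> ptime m \<Longrightarrow> ptime (\<lambda>x. l x = (m x :: bool list))"
  by (rule ptime_list_eq) (intro ptime_bool_eq ptime_fst ptime_snd ptime_id)+

lemmas ptime_intros =
  ptime_const ptime_id ptime_pair ptime_fst ptime_snd ptime_Cons ptime_Suc ptime_if
  ptime_not ptime_conj ptime_disj ptime_imp ptime_bool_eq ptime_null ptime_tl
  ptime_rev ptime_map ptime_append ptime_filter ptime_concat ptime_length ptime_drop ptime_take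
  ptime_add ptime_pred ptime_diff ptime_mult ptime_le ptime_less ptime_nat_eq
  ptime_sum_list ptime_replicate ptime_upt0 ptime_hd_or ptime_nth_or ptime_Ball ptime_Bex
  ptime_nat_mem ptime_even ptime_nat_list_eq ptime_bool_list_eq

section \<open>Circuits\<close>

primrec tag :: "gate \<Rightarrow> nat" where
  "tag Input = 0" | "tag (Neg p) = 1" | "tag (Conj ps) = 2" | "tag (Disj ps) = 3"

instantiation gate :: codable begin
definition code_gate :: "gate \<Rightarrow> tree" where "code_gate g = code (tag g, preds g)"
instance ..
end

lemma ptime_tag: "ptime g \<Longrightarrow> ptime (\<lambda>x. tag (g x))"
  by (rule ptime_comp[of tag], rule ptime_expr[where e = "LeftE (Var 0)"])
    (auto simp: code_gate_def intro: polyb_mono[OF polyb_sz])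

lemma ptime_preds: "ptime g \<Longrightarrow> ptime (\<lambda>x. preds (g x))"
  by (rule ptime_comp[of preds], rule ptime_expr[where e = "RightE (Var 0)"])
    (auto simp: code_gate_def intro: polyb_mono[OF polyb_sz])

lemma ptime_Neg: assumes "ptime f" shows "ptime (\<lambda>x. Neg (f x))"
proof (rule ptime_code_eq)
  show "ptime (\<lambda>x. (1 :: nat, [f x]))" by (intro ptime_intros assms)
qed (simp add: code_gate_def)

lemma ptime_Conj: assumes "ptime f" shows "ptime (\<lambda>x. Conj (f x))"
proof (rule ptime_code_eq)
  show "ptime (\<lambda>x. (2 :: nat, f x))" by (intro ptime_intros assms)
qed (simp add: code_gate_def)

lemma ptime_Disj: assumes "ptime f" shows "ptime (\<lambda>x. Disj (f x))"
proof (rule ptime_code_eq)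
  show "ptime (\<lambda>x. (3 :: nat, f x))" by (intro ptime_intros assms)
qed (simp add: code_gate_def)

definition gate_at :: "circuit \<Rightarrow> nat \<Rightarrow> gate" where "gate_at = nth_or Input"

lemma ptime_gate_at: "ptime C \<Longrightarrow> ptime i \<Longrightarrow> ptime (\<lambda>x. gate_at (C x) (i x))"
  unfolding gate_at_def by (rule ptime_nth_or)

lemmas ptime_gate_intros = ptime_intros ptime_tag ptime_preds ptime_Neg ptime_Conj ptime_Disj ptime_gate_at

text \<open>The recursion is on a bound for the depth, which is a constant of the reduction; thus
  each of the following functions is a finite composition of polynomial-time functions.\<close>

primrec depth_le :: "nat \<Rightarrow> circuit \<Rightarrow> nat \<Rightarrow> bool" where
  "depth_le 0 C i \<longleftrightarrow> tag (gate_at C i) = 0"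
| "depth_le (Suc j) C i \<longleftrightarrow> (\<forall>p\<in>set (preds (gate_at C i)). depth_le j C p)"

primrec weft_0 :: "nat \<Rightarrow> circuit \<Rightarrow> nat \<Rightarrow> bool" where
  "weft_0 0 C i \<longleftrightarrow> True"
| "weft_0 (Suc j) C i \<longleftrightarrow> length (preds (gate_at C i)) \<le> 2 \<and> (\<forall>p\<in>set (preds (gate_at C i)). weft_0 j C p)"

primrec weft_1 :: "nat \<Rightarrow> circuit \<Rightarrow> nat \<Rightarrow> bool" where
  "weft_1 0 C i \<longleftrightarrow> True"
| "weft_1 (Suc j) C i \<longleftrightarrow> (\<forall>p\<in>set (preds (gate_at C i)).
     if length (preds (gate_at C i)) \<le> 2 then weft_1 j C p else weft_0 j C p)"

primrec val :: "nat \<Rightarrow> circuit \<Rightarrow> nat list \<Rightarrow> nat \<Rightarrow> bool" where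
  "val 0 C Z i \<longleftrightarrow> i \<in> set Z"
| "val (Suc j) C Z i \<longleftrightarrow>
    (if tag (gate_at C i) = 0 then i \<in> set Z
     else if tag (gate_at C i) = 1 then \<forall>p\<in>set (preds (gate_at C i)). \<not> val j C Z p
     else if tag (gate_at C i) = 2 then \<forall>p\<in>set (preds (gate_at C i)). val j C Z p
     else \<exists>p\<in>set (preds (gate_at C i)). val j C Z p)"

text \<open>A disjunctive normal form for the condition that gate \<open>i\<close> has value \<open>b\<close>: each member is a
  list of constraints \<open>(p, b')\<close>, to be read as a conjunction. Nothing below a large gate is
  expanded, so for weft 1 every \<open>p\<close> has weft 0.\<close>

primrec dnf :: "nat \<Rightarrow> circuit \<Rightarrow> nat \<Rightarrow> bool \<Rightarrow> (nat \<times> bool) list list" where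
  "dnf 0 C i b = [[(i, b)]]"
| "dnf (Suc j) C i b =
    (if tag (gate_at C i) = 0 then [[(i, b)]]
     else if tag (gate_at C i) = 1 then concat (map (\<lambda>p. dnf j C p (\<not> b)) (preds (gate_at C i)))
     else if 2 < length (preds (gate_at C i)) then
       (if (tag (gate_at C i) = 2) = b then [map (\<lambda>p. (p, b)) (preds (gate_at C i))]
        else map (\<lambda>p. [(p, b)]) (preds (gate_at C i)))
     else if (tag (gate_at C i) = 2) = b then
       concat (map (\<lambda>u. map (\<lambda>v. u @ v) (dnf j C (nth_or 0 (preds (gate_at C i)) 1) b))
         (dnf j C (nth_or 0 (preds (gate_at C i)) 0) b))
     else concat (map (\<lambda>p. dnf j C p b) (preds (gate_at C i))))"

lemma ptime_depth_le:
  assumes "ptime C" "ptime i" shows "ptime (\<lambda>x. depth_le j (C x) (i x))"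
proof -
  have "ptime (\<lambda>p. depth_le j (fst p) (snd p))"
  proof (induction j)
    case (Suc j)
    show ?case unfolding depth_le.simps by (intro ptime_gate_intros ptime_comp2[OF Suc])
  qed (unfold depth_le.simps, intro ptime_gate_intros)
  then show ?thesis by (rule ptime_comp2) fact+
qed

lemma ptime_weft_0:
  assumes "ptime C" "ptime i" shows "ptime (\<lambda>x. weft_0 j (C x) (i x))"
proof -
  have "ptime (\<lambda>p. weft_0 j (fst p) (snd p))"
  proof (induction j)
    case (Suc j)
    show ?case unfolding weft_0.simps by (intro ptime_gate_intros ptime_comp2[OF Suc])
  qed (unfold weft_0.simps, intro ptime_gate_intros)
  then show ?thesis by (rule ptime_comp2) fact+
qed

lemma ptime_weft_1:
  assumes "ptime C" "ptime i" shows "ptime (\<lambda>x. weft_1 j (C x) (i x))"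
proof -
  have "ptime (\<lambda>p. weft_1 j (fst p) (snd p))"
  proof (induction j)
    case (Suc j)
    show ?case unfolding weft_1.simps by (intro ptime_gate_intros ptime_weft_0 ptime_comp2[OF Suc])
  qed (unfold weft_1.simps, intro ptime_gate_intros)
  then show ?thesis by (rule ptime_comp2) fact+
qed

lemma ptime_val:
  assumes "ptime C" "ptime Z" "ptime i" shows "ptime (\<lambda>x. val j (C x) (Z x) (i x))"
proof -
  have "ptime (\<lambda>p. val j (fst p) (fst (snd p)) (snd (snd p)))"
  proof (induction j)
    case (Suc j)
    show ?case unfolding val.simps by (intro ptime_gate_intros ptime_comp3[OF Suc])
  qed (unfold val.simps, intro ptime_gate_intros)
  then show ?thesis by (rule ptime_comp3) fact+
qed

lemma ptime_dnf:
  assumes "ptime C" "ptime i" "ptime b" shows "ptime (\<lambda>x. dnf j (C x) (i x) (b x))"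
proof -
  have "ptime (\<lambda>p. dnf j (fst p) (fst (snd p)) (snd (snd p)))"
  proof (induction j)
    case (Suc j)
    show ?case unfolding dnf.simps by (intro ptime_gate_intros ptime_comp3[OF Suc])
  qed (unfold dnf.simps, intro ptime_gate_intros)
  then show ?thesis by (rule ptime_comp3) fact+
qed

definition viol :: "nat \<Rightarrow> circuit \<Rightarrow> (nat \<times> bool) list \<Rightarrow> nat list \<Rightarrow> nat" where
  "viol d C w Z = length (filter (\<lambda>c. val d C Z (fst c) \<noteq> snd c) w)"

lemma ptime_viol:
  assumes "ptime C" "ptime w" "ptime Z" shows "ptime (\<lambda>x. viol d (C x) (w x) (Z x))"
proof -
  have "ptime (\<lambda>p. viol d (fst p) (fst (snd p)) (snd (snd p)))"
    unfolding viol_def by (intro ptime_gate_intros ptime_val)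
  then show ?thesis by (rule ptime_comp3) fact+
qed

definition inputs :: "circuit \<Rightarrow> nat list" where
  "inputs C = filter (\<lambda>i. tag (gate_at C i) = 0) [0..<length C]"

lemma ptime_inputs: assumes "ptime C" shows "ptime (\<lambda>x. inputs (C x))"
proof -
  have "ptime inputs" unfolding inputs_def by (intro ptime_gate_intros)
  then show ?thesis using assms by (rule ptime_comp)
qed

section \<open>Small subsets\<close>

text \<open>Increasing lists represent sets, one list per set when \<open>xs\<close> is distinct.
  The size \<open>q\<close> is a constant of the reduction, which keeps the enumeration
  polynomial.\<close>

primrec subsets_exact :: "nat \<Rightarrow> nat list \<Rightarrow> nat list list" where
  "subsets_exact 0 xs = [[]]"
| "subsets_exact (Suc q) xs =
     concat (map (\<lambda>Y. map (\<lambda>x. x # Y) (filter (\<lambda>x. \<forall>y\<in>set Y. x < y) xs)) (subsets_exact q xs))"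

text \<open>The empty list is left out because the empty set has no gadget.\<close>

primrec subsets_upto :: "nat \<Rightarrow> nat list \<Rightarrow> nat list list" where
  "subsets_upto 0 xs = []"
| "subsets_upto (Suc q) xs = subsets_upto q xs @ subsets_exact (Suc q) xs"

lemma ptime_subsets_exact: assumes "ptime l" shows "ptime (\<lambda>x. subsets_exact q (l x))"
proof -
  have "ptime (subsets_exact q)"
  proof (induction q)
    case (Suc q)
    show ?case unfolding subsets_exact.simps by (intro ptime_intros Suc)
  qed (unfold subsets_exact.simps, intro ptime_intros)
  then show ?thesis using assms by (rule ptime_comp)
qed

lemma ptime_subsets_upto: assumes "ptime l" shows "ptime (\<lambda>x. subsets_upto q (l x))"
proof -
  have "ptime (subsets_upto q)"
  proof (induction q)
    case (Suc q)
    show ?case unfolding subsets_upto.simps by (intro ptime_intros Suc ptime_subsets_exact)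
  qed (unfold subsets_upto.simps, intro ptime_intros)
  then show ?thesis using assms by (rule ptime_comp)
qed

section \<open>Moebius weights\<close>

text \<open>The Moebius transform on the lattice of finite sets; the exponent
  \<open>card Y + card Z\<close> has the parity of the customary
  \<open>card Y - card Z\<close>.\<close>

definition mob :: "('a set \<Rightarrow> int) \<Rightarrow> 'a set \<Rightarrow> int" where
  "mob H Y = (\<Sum>Z\<in>Pow Y. (- 1) ^ (card Y + card Z) * H Z)"

text \<open>The signed subset sum \<open>?g\<close> is its own inverse, by inclusion and exclusion;
  multiplying \<open>?g\<close> by its outer sign gives \<open>mob\<close>.\<close>

lemma mob_inversion:
  assumes "finite X" shows "(\<Sum>Y\<in>Pow X. mob H Y) = H X"
proof -
  let ?g = "\<lambda>S. \<Sum>T\<in>Pow S. (- 1) ^ card T * H T"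
  have "H X = (\<Sum>T\<in>Pow X. (- 1) ^ card T * ?g T)"
    by (rule inclusion_exclusion_symmetric) (use assms in auto)
  also have "\<dots> = (\<Sum>Y\<in>Pow X. mob H Y)"
    unfolding mob_def sum_distrib_left power_add by (simp add: mult.assoc)
  finally show ?thesis by simp
qed

lemma mob_cong: "(\<And>Z. Z \<subseteq> Y \<Longrightarrow> H Z = K Z) \<Longrightarrow> mob H Y = mob K Y"
  unfolding mob_def by (intro sum.cong) auto

lemma mob_add: "mob (\<lambda>Z. H Z + K Z) Y = mob H Y + mob K Y"
  unfolding mob_def by (simp add: distrib_left sum.distrib)

lemma mob_scale: "mob (\<lambda>Z. c * H Z) Y = c * mob H Y"
  unfolding mob_def by (simp add: sum_distrib_left mult.left_commute)

lemma mob_sum: "finite I \<Longrightarrow> mob (\<lambda>Z. \<Sum>i\<in>I. H i Z) Y = (\<Sum>i\<in>I. mob (H i) Y)"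
  by (induction I rule: finite_induct) (auto simp: mob_add, simp add: mob_def)

text \<open>Inserting or removing an element of \<open>Y\<close> outside \<open>A\<close> pairs the
  subsets of \<open>Y\<close>; \<open>H\<close> agrees on each pair and the signs are
  opposite.\<close>

lemma mob_junta:
  assumes H: "\<And>Z. H Z = H (Z \<inter> A)" and "finite Y" "\<not> Y \<subseteq> A"
  shows "mob H Y = 0"
proof -
  from assms(3) obtain y where y: "y \<in> Y" "y \<notin> A" by blast
  define Y' where "Y' = Y - {y}"
  have Y: "Y = insert y Y'" "y \<notin> Y'" "finite Y'" using y assms(2) by (auto simp: Y'_def)
  have inj: "inj_on (insert y) (Pow Y')" using Y(2) by (auto simp: inj_on_def)
  have "mob H Y = (\<Sum>Z\<in>Pow Y' \<union> insert y ` Pow Y'. (- 1) ^ (card Y + card Z) * H Z)"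
    unfolding mob_def Y(1) Pow_insert ..
  also have "\<dots> = (\<Sum>Z\<in>Pow Y'. (- 1) ^ (card Y + card Z) * H Z)
      + (\<Sum>Z\<in>insert y ` Pow Y'. (- 1) ^ (card Y + card Z) * H Z)"
    by (rule sum.union_disjoint) (use Y in auto)
  also have "(\<Sum>Z\<in>insert y ` Pow Y'. (- 1) ^ (card Y + card Z) * H Z)
      = (\<Sum>Z\<in>Pow Y'. - ((- 1) ^ (card Y + card Z) * H Z))"
    unfolding sum.reindex[OF inj] o_def
  proof (rule sum.cong[OF refl])
    fix Z assume Z: "Z \<in> Pow Y'"
    then have "card (insert y Z) = Suc (card Z)"
      using Y(2,3) by (intro card_insert_disjoint) (auto intro: finite_subset)
    moreover have "insert y Z \<inter> A = Z \<inter> A" using y by auto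
    then have "H (insert y Z) = H Z" using H[of "insert y Z"] H[of Z] by simp
    ultimately show "(- 1) ^ (card Y + card (insert y Z)) * H (insert y Z) = - ((- 1) ^ (card Y + card Z) * H Z)"
      by simp
  qed
  finally show ?thesis by (simp add: sum_negf)
qed

text \<open>The cardinality is a sum of membership indicators, each of which depends on one element
  only.\<close>

lemma mob_card:
  assumes "finite Y" "1 < card Y" shows "mob (\<lambda>Z. int (card Z)) Y = 0"
proof -
  have "mob (\<lambda>Z. int (card Z)) Y = mob (\<lambda>Z. \<Sum>x\<in>Y. of_bool (x \<in> Z)) Y"
  proof (rule mob_cong)
    fix Z assume "Z \<subseteq> Y"
    then show "int (card Z) = (\<Sum>x\<in>Y. of_bool (x \<in> Z))"
      using assms(1) by (simp add: Int_absorb1 flip: Int_def)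
  qed
  also have "\<dots> = (\<Sum>x\<in>Y. mob (\<lambda>Z. of_bool (x \<in> Z)) Y)" by (rule mob_sum) fact
  also have "\<dots> = 0"
  proof (rule sum.neutral, intro ballI)
    fix x assume "x \<in> Y"
    have "\<not> Y \<subseteq> {x}" using assms card_mono[of "{x}" Y] by auto
    then show "mob (\<lambda>Z. of_bool (x \<in> Z)) Y = 0" using assms by (intro mob_junta[of _ "{x}"]) auto
  qed
  finally show ?thesis .
qed

lemma mob_le:
  assumes "finite Y" "\<And>Z. Z \<subseteq> Y \<Longrightarrow> \<bar>H Z\<bar> \<le> int m" shows "\<bar>mob H Y\<bar> \<le> int (2 ^ card Y * m)"
proof -
  have "\<bar>mob H Y\<bar> \<le> (\<Sum>Z\<in>Pow Y. \<bar>(- 1) ^ (card Y + card Z) * H Z\<bar>)"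
    unfolding mob_def by (rule sum_abs)
  also have "\<dots> \<le> (\<Sum>Z\<in>Pow Y. int m)" by (rule sum_mono) (use assms in \<open>auto simp: abs_mult power_abs\<close>)
  also have "\<dots> = int (2 ^ card Y * m)" using assms(1) by (simp add: card_Pow)
  finally show ?thesis .
qed

section \<open>Counting and summing over small subsets\<close>

definition sub_q :: "nat \<Rightarrow> 'a set \<Rightarrow> 'a set set" where
  "sub_q q X = {Y. Y \<subseteq> X \<and> Y \<noteq> {} \<and> card Y \<le> q}"

lemma finite_sub_q: "finite X \<Longrightarrow> finite (sub_q q X)"
  unfolding sub_q_def by (rule finite_subset[of _ "Pow X"]) auto

lemma sub_q_empty [simp]: "sub_q q {} = {}"
  by (auto simp: sub_q_def)

lemma sub_q_mono: "X \<subseteq> X' \<Longrightarrow> sub_q q X \<subseteq> sub_q q X'"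
  by (auto simp: sub_q_def)

lemma card_sub_q_image:
  assumes "inj_on f X" shows "card (sub_q q (f ` X)) = card (sub_q q X)"
proof -
  have "sub_q q (f ` X) = (`) f ` sub_q q X"
  proof (intro equalityI subsetI)
    fix Y assume "Y \<in> sub_q q (f ` X)"
    then obtain Z where Z: "Z \<subseteq> X" "Y = f ` Z" and Y: "Y \<noteq> {}" "card Y \<le> q"
      unfolding sub_q_def by (auto simp: subset_image_iff)
    have "card Z = card Y" using card_image inj_on_subset[OF assms Z(1)] Z(2) by metis
    then show "Y \<in> (`) f ` sub_q q X" using Z Y by (auto simp: sub_q_def)
  next
    fix Y assume "Y \<in> (`) f ` sub_q q X"
    then obtain Z where Z: "Z \<subseteq> X" "Z \<noteq> {}" "card Z \<le> q" "Y = f ` Z" by (auto simp: sub_q_def)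
    moreover have "card (f ` Z) = card Z" by (rule card_image[OF inj_on_subset[OF assms Z(1)]])
    ultimately show "Y \<in> sub_q q (f ` X)" by (auto simp: sub_q_def)
  qed
  moreover have "inj_on ((`) f) (sub_q q X)"
    by (rule inj_on_subset[OF inj_on_image_Pow[OF assms]]) (auto simp: sub_q_def)
  ultimately show ?thesis by (simp add: card_image)
qed

lemma card_sub_q:
  assumes "finite X" shows "card (sub_q q X) = card (sub_q q {..<card X})"
proof -
  obtain f where "bij_betw f {..<card X} X"
    using ex_bij_betw_nat_finite[OF assms] by (auto simp: lessThan_atLeast0)
  then have "inj_on f {..<card X}" "f ` {..<card X} = X" by (auto simp: bij_betw_def)
  with card_sub_q_image show ?thesis by metis
qed

text \<open>Moebius inversion with the coefficients of order above \<open>q\<close> dropped, as they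
  vanish; the coefficient of the empty set is \<open>H {}\<close> and moves to the right.\<close>

lemma sum_mob_sub_q:
  assumes "finite X" "\<And>Y. finite Y \<Longrightarrow> q < card Y \<Longrightarrow> mob H Y = 0"
  shows "(\<Sum>Y\<in>sub_q q X. mob H Y) = H X - H {}"
proof -
  have "H X = (\<Sum>Y\<in>Pow X. mob H Y)" by (simp add: mob_inversion assms)
  also have "\<dots> = (\<Sum>Y\<in>insert {} (sub_q q X). mob H Y)"
  proof (rule sum.mono_neutral_right)
    show "\<forall>Y\<in>Pow X - insert {} (sub_q q X). mob H Y = 0"
    proof
      fix Y assume Y: "Y \<in> Pow X - insert {} (sub_q q X)"
      then have "finite Y" using assms(1) by (auto intro: finite_subset)
      then show "mob H Y = 0" using Y by (intro assms(2)) (auto simp: sub_q_def)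
    qed
  qed (use assms in \<open>auto simp: sub_q_def\<close>)
  also have "\<dots> = mob H {} + (\<Sum>Y\<in>sub_q q X. mob H Y)"
    by (rule sum.insert) (use assms finite_sub_q in \<open>auto simp: sub_q_def\<close>)
  also have "mob H {} = H {}" by (simp add: mob_def)
  finally show ?thesis by simp
qed

section \<open>Selecting a solution by weight\<close>

text \<open>Tagged with their index, the subsets counted on the left are distinct small subsets of a
  set \<open>T'\<close> of \<open>k\<close> pairs containing \<open>T\<close>. One small subset of
  \<open>T'\<close> is never reached: a singleton outside \<open>T\<close> if \<open>T\<close> has
  fewer than \<open>k\<close> elements, and otherwise a pair of elements with different indices,
  which exists because no index carries all of \<open>T\<close>.\<close>

lemma sum_card_sub_q_less:
  fixes T :: "(nat \<times> nat) set"
  assumes "finite T" "card T \<le> k" "1 \<le> k" "2 \<le> q" and less: "\<And>i. i < n \<Longrightarrow> card (T `` {i}) < k"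
    and T: "fst ` T \<subseteq> {..<n}"
  shows "(\<Sum>i<n. card (sub_q q (T `` {i}))) < card (sub_q q {..<k})"
proof -
  obtain T' where T': "T \<subseteq> T'" "card T' = k" "finite T'"
  proof -
    have "infinite (- T)" using assms(1) by (simp add: finite_prod Compl_eq_Diff_UNIV)
    then obtain D where D: "finite D" "card D = k - card T" "D \<subseteq> - T"
      using infinite_arbitrarily_large by metis
    have "card (T \<union> D) = card T + card D" by (rule card_Un_disjoint) (use D assms in auto)
    with D assms show thesis by (intro that[of "T \<union> D"]) auto
  qed
  define M where "M = (\<Union>i<n. (`) (Product_Type.Pair i) ` sub_q q (T `` {i}))"
  have fin: "finite (T `` {i})" for i using assms(1) by (rule finite_Image)
  have "card M = (\<Sum>i<n. card ((`) (Product_Type.Pair i) ` sub_q q (T `` {i})))"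
    unfolding M_def
  proof (rule card_UN_disjoint)
    show "\<forall>i\<in>{..<n}. finite ((`) (Product_Type.Pair i) ` sub_q q (T `` {i}))"
      using fin by (auto intro!: finite_sub_q)
    show "\<forall>i\<in>{..<n}. \<forall>j\<in>{..<n}. i \<noteq> j \<longrightarrow>
      (`) (Product_Type.Pair i) ` sub_q q (T `` {i}) \<inter> (`) (Product_Type.Pair j) ` sub_q q (T `` {j}) = {}"
    proof (intro ballI impI equals0I)
      fix i j U assume ij: "i \<noteq> j"
        and U: "U \<in> (`) (Product_Type.Pair i) ` sub_q q (T `` {i}) \<inter> (`) (Product_Type.Pair j) ` sub_q q (T `` {j})"
      then obtain x where "(i, x) \<in> U" by (auto simp: sub_q_def)
      with U ij show False by auto
    qed
  qed simp
  also have "\<dots> = (\<Sum>i<n. card (sub_q q (T `` {i})))"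
  proof (rule sum.cong[OF refl])
    fix i show "card ((`) (Product_Type.Pair i) ` sub_q q (T `` {i})) = card (sub_q q (T `` {i}))"
      by (intro card_image inj_on_subset[OF inj_on_image_Pow, of _ UNIV]) (auto simp: inj_on_def)
  qed
  finally have cM: "(\<Sum>i<n. card (sub_q q (T `` {i}))) = card M" ..
  have M: "\<exists>i. U \<subseteq> {i} \<times> T `` {i}" "U \<in> sub_q q T'" if U: "U \<in> M" for U
  proof -
    obtain i Y where Y: "U = Product_Type.Pair i ` Y" "Y \<in> sub_q q (T `` {i})" using U by (auto simp: M_def)
    then show "\<exists>i. U \<subseteq> {i} \<times> T `` {i}" by (auto simp: sub_q_def)
    have "card U = card Y" unfolding Y(1) by (rule card_image) (auto simp: inj_on_def)
    with Y T'(1) show "U \<in> sub_q q T'" by (auto simp: sub_q_def)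
  qed
  obtain U where U: "U \<in> sub_q q T'" "U \<notin> M"
  proof (cases "T = T'")
    case True
    with T' assms obtain i a where a: "(i, a) \<in> T" by (metis card.empty equals0I not_one_le_zero surj_pair)
    have "i < n" using a T by force
    obtain j b where b: "(j, b) \<in> T" "j \<noteq> i"
    proof (rule ccontr)
      assume "\<not> thesis"
      with that have "T \<subseteq> Product_Type.Pair i ` (T `` {i})" by force
      then have "card T \<le> card (Product_Type.Pair i ` (T `` {i}))" using fin by (intro card_mono) auto
      also have "\<dots> \<le> card (T `` {i})" by (rule card_image_le[OF fin])
      finally show False using less[OF \<open>i < n\<close>] True T' by simp
    qed
    show thesis
    proof (rule that[of "{(i, a), (j, b)}"])
      show "{(i, a), (j, b)} \<in> sub_q q T'" using a b True assms by (auto simp: sub_q_def card_insert_if)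
      show "{(i, a), (j, b)} \<notin> M" using M(1) b by fastforce
    qed
  next
    case False
    with T' obtain x where x: "x \<in> T'" "x \<notin> T" by blast
    show thesis
    proof (rule that[of "{x}"])
      show "{x} \<in> sub_q q T'" using x assms by (auto simp: sub_q_def)
      show "{x} \<notin> M" using M(1)[of "{x}"] x by auto
    qed
  qed
  have "card M < card (sub_q q T')"
    by (rule psubset_card_mono) (use finite_sub_q[OF T'(3)] M(2) U in auto)
  then show ?thesis using cM card_sub_q[OF T'(3)] T'(2) by simp
qed

text \<open>The empty set has no gadget. The term \<open>card Z * v {}\<close> makes \<open>pot k v Z - pot k v {}\<close>, the sum
  of the coefficients of the nonempty subsets of \<open>Z\<close>, equal to \<open>k * v Z\<close> when \<open>card Z = k\<close>.\<close>

definition pot :: "nat \<Rightarrow> (nat set \<Rightarrow> nat) \<Rightarrow> nat set \<Rightarrow> int" where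
  "pot k v Z = int (k * v Z + card Z * v {})"

text \<open>Anticipates the graph: the number of gadget vertices isolated by deleting the items in
  \<open>T\<close>, where the gadget of \<open>i\<close> and \<open>Y\<close> has
  \<open>int B - mob (pot k (v i)) Y\<close> vertices.\<close>

definition isolated_weight :: "nat \<Rightarrow> nat \<Rightarrow> nat \<Rightarrow> nat \<Rightarrow> (nat \<Rightarrow> nat set \<Rightarrow> nat) \<Rightarrow> (nat \<times> nat) set \<Rightarrow> int" where
  "isolated_weight n q k B v T = (\<Sum>i<n. \<Sum>Y\<in>sub_q q (T `` {i}). int B - mob (pot k (v i)) Y)"

context
  fixes n q k B L :: nat and v :: "nat \<Rightarrow> nat set \<Rightarrow> nat"
  assumes k: "1 \<le> k" and q: "2 \<le> q" and B: "k * k * L < B"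
    and L: "\<And>i Z. i < n \<Longrightarrow> v i Z \<le> L"
    and v: "\<And>i Y. i < n \<Longrightarrow> finite Y \<Longrightarrow> q < card Y \<Longrightarrow> mob (\<lambda>Z. int (v i Z)) Y = 0"
begin

text \<open>\<open>pot\<close> is a linear combination of \<open>v i\<close> and the cardinality,
  and the coefficients of the latter vanish above order 1.\<close>

lemma mob_pot: "i < n \<Longrightarrow> finite Y \<Longrightarrow> q < card Y \<Longrightarrow> mob (pot k (v i)) Y = 0"
proof -
  assume *: "i < n" "finite Y" "q < card Y"
  have "pot k (v i) = (\<lambda>Z. int k * int (v i Z) + int (v i {}) * int (card Z))"
    by (auto simp: pot_def fun_eq_iff)
  then show ?thesis using * q by (simp add: mob_add mob_scale v mob_card)
qed

lemma isolated_weight_eq: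
  assumes "finite T"
  shows "isolated_weight n q k B v T =
    (\<Sum>i<n. int B * int (card (sub_q q (T `` {i}))) - (pot k (v i) (T `` {i}) - pot k (v i) {}))"
  unfolding isolated_weight_def
  by (intro sum.cong refl)
    (simp add: sum_subtractf sum_mob_sub_q[OF finite_Image[OF assms] mob_pot] mult.commute)

text \<open>As \<open>card X = k\<close>, the contributions of \<open>v i {}\<close> cancel, and the
  distance to the target \<open>B * card (sub_q q {..<k})\<close> is \<open>k\<close> times the
  number of violations.\<close>

lemma isolated_weight_full:
  assumes "finite X" "card X = k" "i < n"
  shows "isolated_weight n q k B v ({i} \<times> X) = int (B * card (sub_q q {..<k})) - int (k * v i X)"
proof -
  have *: "({i} \<times> X) `` {j} = (if j = i then X else {})" for j by auto
  have "isolated_weight n q k B v ({i} \<times> X) =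
    (\<Sum>j<n. if j = i then int B * int (card (sub_q q X)) - (pot k (v i) X - pot k (v i) {}) else 0)"
    unfolding isolated_weight_eq[OF finite_cartesian_product[OF finite.emptyI[THEN finite.insertI] assms(1)]] *
    by (intro sum.cong) auto
  also have "\<dots> = int B * int (card (sub_q q X)) - (pot k (v i) X - pot k (v i) {})"
    using assms(3) by simp
  also have "\<dots> = int (B * card (sub_q q {..<k})) - int (k * v i X)"
    using card_sub_q[OF assms(1), of q] assms(2) by (simp add: pot_def)
  finally show ?thesis .
qed

text \<open>At least one small subset is lost against a full block, which costs \<open>B\<close>. An
  index that \<open>T\<close> touches can win back at most \<open>k * v i {}\<close>, hence at most
  \<open>k * L\<close>; there are at most \<open>k\<close> such indices, and
  \<open>k * k * L < B\<close>.\<close>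

lemma isolated_weight_not_full:
  assumes "finite T" "card T \<le> k" "fst ` T \<subseteq> {..<n}" "\<And>i. i < n \<Longrightarrow> card (T `` {i}) < k"
  shows "isolated_weight n q k B v T < int (B * card (sub_q q {..<k}))"
proof -
  define P where "P = fst ` T"
  have P: "card P \<le> k" "finite P" "P \<subseteq> {..<n}"
    using assms card_image_le[OF assms(1), of fst] by (auto simp: P_def)
  have "(\<Sum>i<n. pot k (v i) {} - pot k (v i) (T `` {i})) = (\<Sum>i\<in>P. pot k (v i) {} - pot k (v i) (T `` {i}))"
  proof (rule sum.mono_neutral_right)
    show "\<forall>i\<in>{..<n} - P. pot k (v i) {} - pot k (v i) (T `` {i}) = 0"
    proof
      fix i assume "i \<in> {..<n} - P"
      then have "T `` {i} = {}" by (force simp: P_def)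
      then show "pot k (v i) {} - pot k (v i) (T `` {i}) = 0" by simp
    qed
  qed (use P in auto)
  also have "\<dots> \<le> (\<Sum>i\<in>P. int (k * L))"
  proof (rule sum_mono)
    fix i assume "i \<in> P"
    then have "v i {} \<le> L" using P L by auto
    then have "int (k * v i {}) \<le> int (k * L)" by (simp only: of_nat_le_iff mult_le_mono2)
    then show "pot k (v i) {} - pot k (v i) (T `` {i}) \<le> int (k * L)"
      unfolding pot_def by (simp only: card.empty)
  qed
  also have "\<dots> \<le> int (k * (k * L))" using P(1) by (simp add: mult_right_mono flip: of_nat_mult)
  finally have slack0: "(\<Sum>i<n. pot k (v i) {} - pot k (v i) (T `` {i})) \<le> int (k * (k * L))" .
  have slack: "(\<Sum>i<n. pot k (v i) {} - pot k (v i) (T `` {i})) < int B"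
  proof -
    have "int (k * (k * L)) < int B" using B by (simp only: of_nat_less_iff mult.assoc)
    with slack0 show ?thesis by linarith
  qed
  let ?N = "\<Sum>i<n. card (sub_q q (T `` {i}))"
  have "?N + 1 \<le> card (sub_q q {..<k})"
    using sum_card_sub_q_less[OF assms(1,2) k q assms(4,3)] by simp
  then have le: "B * (?N + 1) \<le> B * card (sub_q q {..<k})" by (rule mult_le_mono2)
  have "isolated_weight n q k B v T = int (B * ?N) + (\<Sum>i<n. pot k (v i) {} - pot k (v i) (T `` {i}))"
    unfolding isolated_weight_eq[OF assms(1)] by (simp add: sum_subtractf sum_distrib_left)
  also have "\<dots> < int (B * (?N + 1))" using slack by (simp add: distrib_left)
  also have "\<dots> \<le> int (B * card (sub_q q {..<k}))" using le by (simp only: of_nat_le_iff)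
  finally show ?thesis .
qed

lemma full_cases:
  assumes "finite T" "card T \<le> k" "fst ` T \<subseteq> {..<n}"
  obtains i X where "i < n" "finite X" "card X = k" "T = {i} \<times> X"
  | "isolated_weight n q k B v T < int (B * card (sub_q q {..<k}))"
proof (cases "\<exists>i<n. k \<le> card (T `` {i})")
  case True
  then obtain i where i: "i < n" "k \<le> card (T `` {i})" by blast
  have sub: "{i} \<times> T `` {i} \<subseteq> T" by auto
  have c: "card ({i} \<times> T `` {i}) = card (T `` {i})" by (simp add: card_cartesian_product)
  have le: "card (T `` {i}) \<le> card T" using card_mono[OF assms(1) sub] c by simp
  have "{i} \<times> T `` {i} = T"
    by (rule card_subset_eq[OF assms(1) sub]) (use i c le assms(2) in linarith)
  then show thesis using that(1)[of i "T `` {i}"] i le assms finite_Image[OF assms(1), of "{i}"]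
    by (metis le_antisym order_trans)
next
  case False
  then show thesis using that(2) isolated_weight_not_full[OF assms] by (meson not_le)
qed

lemma isolated_weight_le:
  assumes "finite T" "card T \<le> k" "fst ` T \<subseteq> {..<n}"
  shows "isolated_weight n q k B v T \<le> int (B * card (sub_q q {..<k}))"
  using assms
proof (cases rule: full_cases)
  case (1 i X)
  then show ?thesis using isolated_weight_full[of X i] by simp
qed simp

text \<open>By \<open>full_cases\<close> only a block \<open>{i} \<times> X\<close> with
  \<open>card X = k\<close> can reach the target, and there the deficit \<open>k * v i X\<close> has
  to vanish.\<close>

lemma isolated_weight_attained:
  "(\<exists>T. finite T \<and> card T \<le> k \<and> T \<subseteq> {..<n} \<times> I \<and>
      int (B * card (sub_q q {..<k})) \<le> isolated_weight n q k B v T) \<longleftrightarrow>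
   (\<exists>i X. i < n \<and> finite X \<and> X \<subseteq> I \<and> card X = k \<and> v i X = 0)" (is "?l \<longleftrightarrow> ?r")
proof
  assume ?l
  then obtain T where T: "finite T" "card T \<le> k" "T \<subseteq> {..<n} \<times> I"
    "int (B * card (sub_q q {..<k})) \<le> isolated_weight n q k B v T" by blast
  have "fst ` T \<subseteq> {..<n}" using T by auto
  with T(1,2) show ?r
  proof (cases rule: full_cases)
    case (1 i X)
    then have "int (k * v i X) \<le> 0" using T(4) isolated_weight_full[OF 1(2,3,1)] by simp
    then have "k * v i X = 0" by (simp only: of_nat_le_0_iff)
    moreover have "X \<subseteq> I" using T(3) 1 by auto
    ultimately show ?thesis using 1 k by auto
  next
    case 2
    with T(4) show ?thesis by simp
  qed
next
  assume ?r
  then obtain i X where *: "i < n" "finite X" "X \<subseteq> I" "card X = k" "v i X = 0" by blast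
  then show ?l using isolated_weight_full[of X i]
    by (intro exI[of _ "{i} \<times> X"]) (auto simp: card_cartesian_product)
qed

end

section \<open>Bisection and isolated gadgets\<close>

text \<open>Vertices with equal value of \<open>f\<close> are connected, so mapping a value to the
  component of some vertex that has it reaches every component. A component may well carry several
  values.\<close>

lemma card_components_le:
  assumes fin: "finite V" and conn: "\<And>u v. u \<in> V \<Longrightarrow> v \<in> V \<Longrightarrow> f u = f v \<Longrightarrow> (u, v) \<in> connected_in (V, E)"
  shows "card (components (V, E)) \<le> card (f ` V)"
proof -
  let ?R = "connected_in (V, E)"
  have "sym {(x, y). {x, y} \<in> E}" by (auto simp: sym_def insert_commute)
  then have "sym ({(x, y). {x, y} \<in> E}\<^sup>*)" by (rule sym_rtrancl)
  then have "equiv V ?R"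
  proof (intro equivI)
    assume s: "sym ({(x, y). {x, y} \<in> E}\<^sup>*)"
    show "?R \<subseteq> V \<times> V" "refl_on V ?R" by (auto simp: refl_on_def)
    show "sym ?R" by (rule symI) (use symD[OF s] in auto)
    show "trans ?R" by (rule transI) (simp, blast intro: rtrancl_trans)
  qed
  define g where "g u = (SOME v. v \<in> V \<and> f v = f u)" for u
  have g: "g u \<in> V \<and> f (g u) = f u" if "u \<in> V" for u
    unfolding g_def by (rule someI[of _ u]) (use that in simp)
  have "components (V, E) \<subseteq> (\<lambda>c. ?R `` {SOME v. v \<in> V \<and> f v = c}) ` f ` V"
  proof
    fix X assume "X \<in> components (V, E)"
    then obtain u where u: "u \<in> V" "X = ?R `` {u}" unfolding components_def by (auto elim: quotientE)
    have "(u, g u) \<in> ?R" by (rule conn) (use u(1) g[OF u(1)] in auto)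
    then have "X = ?R `` {g u}" using equiv_class_eq[OF \<open>equiv V ?R\<close>] u(2) by metis
    then show "X \<in> (\<lambda>c. ?R `` {SOME v. v \<in> V \<and> f v = c}) ` f ` V"
      using u(1) unfolding g_def by blast
  qed
  then have "card (components (V, E)) \<le> card ((\<lambda>c. ?R `` {SOME v. v \<in> V \<and> f v = c}) ` f ` V)"
    using fin by (intro card_mono) auto
  also have "\<dots> \<le> card (f ` V)" using fin by (intro card_image_le) auto
  finally show ?thesis .
qed

text \<open>A clique \<open>Q\<close>, a disjoint clique \<open>K\<close>, and the gadgets: the vertices of \<open>D\<close>, which form one
  clique for each value of \<open>cl\<close>, attached to the set \<open>nb\<close> of vertices of \<open>Q\<close>.\<close>

locale gadget_graph =
  fixes Q D K :: "'a set" and nb :: "'a \<Rightarrow> 'a set" and cl :: "'a \<Rightarrow> 'b" and E :: "'a set set"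
    and k C :: nat
  assumes fin: "finite Q" "finite D" "finite K"
    and disj: "Q \<inter> D = {}" "Q \<inter> K = {}" "D \<inter> K = {}"
    and nb: "\<And>g. g \<in> D \<Longrightarrow> nb g \<subseteq> Q"
    and cl: "\<And>g h. g \<in> D \<Longrightarrow> h \<in> D \<Longrightarrow> cl g = cl h \<Longrightarrow> nb g = nb h"
    and edge: "\<And>a b. {a, b} \<in> E \<longleftrightarrow> a \<noteq> b \<and>
      (a \<in> Q \<and> b \<in> Q \<or> a \<in> K \<and> b \<in> K \<or> a \<in> D \<and> b \<in> D \<and> cl a = cl b \<or>
       a \<in> D \<and> b \<in> nb a \<or> b \<in> D \<and> a \<in> nb b)"
    and size_K: "card Q + card D = card K + k + 2 * C"
    and size_Q: "k + 2 * C + 2 \<le> card Q"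
begin

definition iso :: "'a set \<Rightarrow> 'a set" where "iso S = {g \<in> D. nb g \<subseteq> S}"

lemma iso_subset: "iso S \<subseteq> D"
  by (auto simp: iso_def)

lemma finite_iso: "finite (iso S)"
  using fin by (simp add: iso_def)

text \<open>\<open>A\<close> misses \<open>Q\<close>, so it consists of vertices of \<open>K\<close>
  and of gadget vertices that \<open>S\<close> isolates. Balance forces it to meet \<open>K\<close>,
  hence to contain all of \<open>K - S\<close>, and still asks for \<open>C\<close> further
  vertices.\<close>

lemma separator_large_iso:
  assumes sep: "separator (Q \<union> D \<union> K, E) S A B" and S: "card S \<le> k"
    and core: "Q - S \<subseteq> B" and iso_le: "card (iso (S \<inter> Q)) \<le> C" and bal: "card B \<le> card A + 1"
  shows "C \<le> card (iso (S \<inter> Q))"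
proof -
  have V: "S \<union> A \<union> B = Q \<union> D \<union> K" and dj: "S \<inter> A = {}" "S \<inter> B = {}" "A \<inter> B = {}"
    and noedge: "\<And>a b. a \<in> A \<Longrightarrow> b \<in> B \<Longrightarrow> {a, b} \<notin> E" using sep by auto
  have finV: "finite (S \<union> A \<union> B)" unfolding V using fin by auto
  then have finS: "finite S" "finite A" "finite B" by auto
  have AQ: "A \<inter> Q = {}" using core dj by auto
  have AD: "A \<inter> D \<subseteq> iso (S \<inter> Q)"
  proof
    fix g assume g: "g \<in> A \<inter> D"
    have "x \<in> S" if x: "x \<in> nb g" for x
    proof (rule ccontr)
      assume "x \<notin> S"
      with x g nb have "x \<in> Q" "x \<in> B" using core by auto
      with g x disj have "{g, x} \<in> E" by (auto simp: edge)
      with noedge g \<open>x \<in> B\<close> show False by blast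
    qed
    with g nb show "g \<in> iso (S \<inter> Q)" by (auto simp: iso_def)
  qed
  have cAD: "card (A \<inter> D) \<le> card (iso (S \<inter> Q))" by (rule card_mono[OF finite_iso AD])
  have cV: "card S + card A + card B = card Q + card D + card K"
  proof -
    have "card (S \<union> A \<union> B) = card S + card A + card B"
      using finS dj by (subst card_Un_disjoint, auto)+
    moreover have "card (Q \<union> D \<union> K) = card Q + card D + card K"
      using fin disj by (subst card_Un_disjoint, auto)+
    ultimately show ?thesis using V by simp
  qed
  have cA: "card A = card (A \<inter> D) + card (A \<inter> K)"
  proof -
    have "A = (A \<inter> D) \<union> (A \<inter> K)" using V AQ by auto
    then have "card A = card ((A \<inter> D) \<union> (A \<inter> K))" by simp
    also have "\<dots> = card (A \<inter> D) + card (A \<inter> K)" using finS disj by (intro card_Un_disjoint) auto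
    finally show ?thesis .
  qed
  show ?thesis
  proof (cases "A \<inter> K = {}")
    \<comment> \<open>Then \<open>A\<close> has at most \<open>C\<close> vertices, \<open>B\<close>
      at most \<open>C + 1\<close> and \<open>S\<close> at most \<open>k\<close>; together these are
      fewer than \<open>Q\<close> has by \<open>size_Q\<close>.\<close>
    case True
    then have "card A \<le> C" using cA cAD iso_le by simp
    with cV size_Q S bal show ?thesis by linarith
  next
    case False
    then obtain a where a: "a \<in> A" "a \<in> K" by blast
    have "K \<subseteq> (A \<inter> K) \<union> (S \<inter> K)"
    proof
      fix b assume b: "b \<in> K"
      have "b \<notin> B"
      proof
        assume bB: "b \<in> B"
        with a dj have "a \<noteq> b" by auto
        with a b have "{a, b} \<in> E" by (auto simp: edge)
        with noedge a bB show False by blast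
      qed
      with b V show "b \<in> (A \<inter> K) \<union> (S \<inter> K)" by auto
    qed
    then have K: "K = (A \<inter> K) \<union> (S \<inter> K)" by auto
    have "card K = card ((A \<inter> K) \<union> (S \<inter> K))" using K by simp
    also have "\<dots> = card (A \<inter> K) + card (S \<inter> K)" using finS dj by (intro card_Un_disjoint) auto
    finally have cK: "card K = card (A \<inter> K) + card (S \<inter> K)" .
    \<comment> \<open>All vertices together number \<open>2 * card K + k + 2 * C\<close>, so
      \<open>2 * card A + 1\<close> is at least \<open>2 * (card K + C)\<close>. By parity the
      tolerance of one in the balance gains nothing: \<open>card A\<close> is at least
      \<open>card K + C\<close>.\<close>
    with cV cA cAD size_K S bal show ?thesis by linarith
  qed
qed

lemma core_one_side:
  assumes sep: "separator (Q \<union> D \<union> K, E) S A B"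
  shows "Q - S \<subseteq> A \<or> Q - S \<subseteq> B"
proof (rule ccontr)
  assume "\<not> ?thesis"
  then obtain a b where "a \<in> Q" "b \<in> Q" "a \<notin> S" "b \<notin> S" "a \<notin> A" "b \<notin> B" by blast
  moreover from this have "a \<in> B" "b \<in> A" "a \<noteq> b" using sep by auto
  moreover from this have "{b, a} \<notin> E" using sep by auto
  ultimately show False by (auto simp: edge)
qed

text \<open>By \<open>size_K\<close>, the sizes \<open>card K + C\<close> and
  \<open>(card Q - k) + (card D - C)\<close> agree. Hence \<open>k\<close> deletions in
  \<open>Q\<close> that isolate exactly \<open>C\<close> gadget vertices bisect the graph once these
  vertices join \<open>K\<close>.\<close>

theorem balanced_separator_iff:
  assumes iso_le: "\<And>S. S \<subseteq> Q \<Longrightarrow> card S \<le> k \<Longrightarrow> card (iso S) \<le> C"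
  shows "(\<exists>S. balanced_separator (Q \<union> D \<union> K, E) S \<and> card S \<le> k) \<longleftrightarrow>
    (\<exists>S\<subseteq>Q. card S \<le> k \<and> C \<le> card (iso S))" (is "?l \<longleftrightarrow> ?r")
proof
  assume ?l
  then obtain S A B where sep: "separator (Q \<union> D \<union> K, E) S A B" and S: "card S \<le> k"
    and bal: "\<bar>int (card A) - int (card B)\<bar> \<le> 1"
    unfolding balanced_separator_def by blast
  have sep': "separator (Q \<union> D \<union> K, E) S B A"
    using sep unfolding separator.simps by (metis Int_commute Un_assoc Un_commute insert_commute)
  have "finite S" by (rule finite_subset[of _ "Q \<union> D \<union> K"]) (use sep fin in auto)
  then have SQ: "card (S \<inter> Q) \<le> k" using S card_mono[of S "S \<inter> Q"] by simp
  have "C \<le> card (iso (S \<inter> Q))"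
    using core_one_side[OF sep]
  proof
    assume "Q - S \<subseteq> A"
    then show ?thesis by (rule separator_large_iso[OF sep' S]) (use bal SQ iso_le in auto)
  next
    assume "Q - S \<subseteq> B"
    then show ?thesis by (rule separator_large_iso[OF sep S]) (use bal SQ iso_le in auto)
  qed
  then show ?r using SQ by (intro exI[of _ "S \<inter> Q"]) auto
next
  assume ?r
  then obtain S0 where S0: "S0 \<subseteq> Q" "card S0 \<le> k" "C \<le> card (iso S0)" by blast
  \<comment> \<open>Padding to exactly \<open>k\<close> vertices serves the size equation. It only
    enlarges \<open>iso\<close>, and \<open>iso_le\<close> keeps the number of isolated vertices at
    \<open>C\<close>.\<close>
  obtain S where S: "S0 \<subseteq> S" "S \<subseteq> Q" "card S = k"
    using exists_subset_between[of S0 k Q] S0 size_Q fin(1) by auto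
  have "iso S0 \<subseteq> iso S" using S(1) by (auto simp: iso_def)
  then have cI: "card (iso S) = C"
    using S0(3) iso_le[OF S(2)] S(3) card_mono[OF finite_iso, of "iso S0" S] by linarith
  let ?A = "K \<union> iso S" and ?B = "(Q - S) \<union> (D - iso S)"
  have finS: "finite S" using S(2) fin(1) by (rule finite_subset)
  have "separator (Q \<union> D \<union> K, E) S ?A ?B"
    unfolding separator.simps
  proof (intro conjI ballI)
    show "S \<union> ?A \<union> ?B = Q \<union> D \<union> K" using S(2) iso_subset[of S] by blast
    show "S \<inter> ?A = {}" using S(2) disj iso_subset[of S] by blast
    show "S \<inter> ?B = {}" using S(2) disj by auto
    show "?A \<inter> ?B = {}" using S(2) disj iso_subset[of S] by blast
    fix a b assume a: "a \<in> ?A" and b: "b \<in> ?B"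
    show "{a, b} \<notin> E"
    proof
      assume e: "{a, b} \<in> E"
      show False
      proof (cases "a \<in> K")
        case True
        then have "a \<notin> Q" "a \<notin> D" "b \<notin> K" using disj b by auto
        with e True show False using nb[of b] by (auto simp: edge)
      next
        case False
        then have "a \<in> D" "nb a \<subseteq> S" using a by (auto simp: iso_def)
        then have "a \<notin> Q" using disj by auto
        have "b \<in> nb a \<or> b \<in> D \<and> cl a = cl b"
          using e \<open>a \<in> D\<close> \<open>a \<notin> Q\<close> False nb[of b] by (auto simp: edge)
        then show False
        proof
          assume "b \<in> nb a"
          then have "b \<in> S" using \<open>nb a \<subseteq> S\<close> by auto
          with b S(2) disj show False by auto
        next
          assume "b \<in> D \<and> cl a = cl b"
          then have "b \<in> iso S" using cl[of a b] \<open>a \<in> D\<close> \<open>nb a \<subseteq> S\<close> by (auto simp: iso_def)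
          with b iso_subset[of S] disj show False by blast
        qed
      qed
    qed
  qed
  moreover have "card ?A = card K + C"
  proof -
    have "K \<inter> iso S = {}" using disj iso_subset[of S] by blast
    then show ?thesis using card_Un_disjoint[OF fin(3) finite_iso] cI by simp
  qed
  moreover have "card ?B = (card Q - k) + (card D - C)"
  proof -
    have "(Q - S) \<inter> (D - iso S) = {}" using disj by blast
    then have "card ?B = card (Q - S) + card (D - iso S)" by (intro card_Un_disjoint) (simp_all add: fin)
    then show ?thesis
      using card_Diff_subset[OF finS S(2)] card_Diff_subset[OF finite_iso iso_subset] cI S(3) by simp
  qed
  moreover have "C \<le> card D" using card_mono[OF fin(2) iso_subset[of S]] cI by simp
  ultimately have "balanced_separator (Q \<union> D \<union> K, E) S"
    unfolding balanced_separator_def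
  proof (intro exI conjI)
    assume sizes: "card ?A = card K + C" "card ?B = (card Q - k) + (card D - C)" "C \<le> card D"
    show "\<bar>int (card ?A) - int (card ?B)\<bar> \<le> 1"
      unfolding sizes(1,2) using sizes(3) size_K size_Q by simp
  qed
  then show ?l using S(3) by blast
qed

text \<open>A surviving gadget vertex that is not isolated has a surviving neighbour in
  \<open>Q\<close>, so together with the rest of \<open>Q\<close> these form one component. The
  isolated vertices are grouped by \<open>cl\<close> into cliques.\<close>

lemma components_le:
  assumes S: "S \<subseteq> Q \<union> D \<union> K" "card S \<le> k"
  shows "card (components (delete_vertices (Q \<union> D \<union> K, E) S)) \<le> 2 + card (cl ` iso (S \<inter> Q))"
proof -
  let ?V = "Q \<union> D \<union> K - S" and ?E = "{e \<in> E. e \<inter> S = {}}"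
  let ?r = "{(x, y). {x, y} \<in> ?E}"
  \<comment> \<open>\<open>None\<close> stands for \<open>K\<close>, \<open>Some None\<close> for
    the component of the rest of \<open>Q\<close>, and \<open>Some (Some c)\<close> for an isolated
    gadget clique.\<close>
  let ?f = "\<lambda>v. if v \<in> K then None else if v \<in> iso (S \<inter> Q) then Some (Some (cl v)) else Some None"
  have finS: "finite S" by (rule finite_subset[OF S(1)]) (use fin in auto)
  obtain q0 where q0: "q0 \<in> Q" "q0 \<notin> S"
  proof -
    have "\<not> Q \<subseteq> S" using card_mono[OF finS, of Q] S(2) size_Q by linarith
    with that show thesis by blast
  qed
  have edge_in: "(a, b) \<in> ?r" if "{a, b} \<in> E" "a \<notin> S" "b \<notin> S" for a b using that by auto
  have sym: "sym (?r\<^sup>*)" by (rule sym_rtrancl) (auto simp: sym_def insert_commute)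
  have main: "(v, q0) \<in> ?r\<^sup>*" if v: "v \<in> ?V" "v \<notin> K" "v \<notin> iso (S \<inter> Q)" for v
  proof (cases "v \<in> Q")
    case True
    show ?thesis
    proof (cases "v = q0")
      case False
      then have "(v, q0) \<in> ?r" using True q0 v by (intro edge_in) (auto simp: edge)
      then show ?thesis by blast
    qed simp
  next
    case False
    then have vD: "v \<in> D" using v by auto
    with v nb[OF vD] obtain x where x: "x \<in> nb v" "x \<in> Q" "x \<notin> S" by (auto simp: iso_def)
    then have vx: "(v, x) \<in> ?r" using vD False v by (intro edge_in) (auto simp: edge)
    show ?thesis
    proof (cases "x = q0")
      case False
      then have "(x, q0) \<in> ?r" using x q0 by (intro edge_in) (auto simp: edge)
      with vx show ?thesis by (meson converse_rtrancl_into_rtrancl rtrancl.rtrancl_refl)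
    qed (use vx in blast)
  qed
  have "card (components (?V, ?E)) \<le> card (?f ` ?V)"
  proof (rule card_components_le)
    show "finite ?V" using fin by auto
    fix u v assume u: "u \<in> ?V" and v: "v \<in> ?V" and eq: "?f u = ?f v"
    have "(u, v) \<in> ?r\<^sup>*"
    proof (cases "u = v")
      case neq: False
      show ?thesis
      proof (cases "u \<in> K")
        case True
        then have "v \<in> K" using eq by (auto split: if_splits)
        then have "(u, v) \<in> ?r" using True neq u v by (intro edge_in) (auto simp: edge)
        then show ?thesis by blast
      next
        case uK: False
        then have vK: "v \<notin> K" using eq by (auto split: if_splits)
        show ?thesis
        proof (cases "u \<in> iso (S \<inter> Q)")
          case True
          then have "v \<in> iso (S \<inter> Q)" "cl u = cl v" using eq uK vK by (auto split: if_splits)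
          then have "(u, v) \<in> ?r" using True neq u v iso_subset[of "S \<inter> Q"]
            by (intro edge_in) (auto simp: edge)
          then show ?thesis by blast
        next
          case False
          then have "v \<notin> iso (S \<inter> Q)" using eq uK vK by (auto split: if_splits)
          then have "(v, q0) \<in> ?r\<^sup>*" using v vK by (intro main) auto
          then have "(q0, v) \<in> ?r\<^sup>*" by (rule symD[OF sym])
          moreover have "(u, q0) \<in> ?r\<^sup>*" using u uK False by (intro main) auto
          ultimately show ?thesis by (meson rtrancl_trans)
        qed
      qed
    qed simp
    with u v show "(u, v) \<in> connected_in (?V, ?E)" by simp
  qed
  also have "\<dots> \<le> card ({None, Some None} \<union> (\<lambda>c. Some (Some c)) ` cl ` iso (S \<inter> Q))"
    by (rule card_mono) (use finite_iso in auto)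
  also have "\<dots> \<le> card {None, Some (None :: 'b option)} + card ((\<lambda>c. Some (Some c)) ` cl ` iso (S \<inter> Q))"
    by (rule card_Un_le)
  also have "\<dots> \<le> 2 + card (cl ` iso (S \<inter> Q))"
    using card_image_le[of "cl ` iso (S \<inter> Q)" "\<lambda>c. Some (Some c)"] finite_iso by simp
  finally show ?thesis by simp
qed

lemma max_components_le:
  assumes "\<And>S. S \<subseteq> Q \<Longrightarrow> card S \<le> k \<Longrightarrow> card (cl ` iso S) \<le> m"
  shows "max_components (Q \<union> D \<union> K, E) k \<le> 2 + m"
proof -
  let ?V = "Q \<union> D \<union> K"
  let ?c = "\<lambda>S. card (components (delete_vertices (?V, E) S))"
  let ?N = "{?c S | S. S \<subseteq> ?V \<and> card S \<le> k}"
  have "finite ?V" using fin by auto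
  then have "finite (?c ` Pow ?V)" by blast
  then have "finite ?N" by (rule rev_finite_subset) blast
  moreover have "?c {} \<in> ?N" by (rule CollectI, rule exI[of _ "{}"]) simp
  then have "?N \<noteq> {}" by blast
  moreover have "x \<le> 2 + m" if "x \<in> ?N" for x
  proof -
    from that obtain S where S: "S \<subseteq> ?V" "card S \<le> k" and x: "x = ?c S"
      by blast
    have "finite S" using S(1) \<open>finite ?V\<close> by (rule finite_subset)
    then have "card (S \<inter> Q) \<le> k" using S(2) card_mono[of S "S \<inter> Q"] by simp
    then have "card (cl ` iso (S \<inter> Q)) \<le> m" by (intro assms) auto
    with components_le[OF S] show ?thesis unfolding x by linarith
  qed
  ultimately show ?thesis unfolding max_components_def fst_conv by (subst Max_le_iff) blast+
qed

end

section \<open>Increasing lists as small subsets, and gadget sizes computed from them\<close>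

lemma set_subsets_exact:
  "set (subsets_exact q xs) = {Y. sorted_wrt (<) Y \<and> set Y \<subseteq> set xs \<and> length Y = q}"
proof (induction q)
  case (Suc q)
  show ?case
  proof (intro set_eqI iffI)
    fix Y assume "Y \<in> set (subsets_exact (Suc q) xs)"
    then show "Y \<in> {Y. sorted_wrt (<) Y \<and> set Y \<subseteq> set xs \<and> length Y = Suc q}"
      using Suc by auto
  next
    fix Y assume "Y \<in> {Y. sorted_wrt (<) Y \<and> set Y \<subseteq> set xs \<and> length Y = Suc q}"
    then obtain x Z where "Y = x # Z" "sorted_wrt (<) (x # Z)" "set (x # Z) \<subseteq> set xs" "length Z = q"
      by (cases Y) auto
    then show "Y \<in> set (subsets_exact (Suc q) xs)" using Suc by auto
  qed
qed auto

lemma distinct_concat_map: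
  assumes "distinct xs" "\<And>x. x \<in> set xs \<Longrightarrow> distinct (f x)"
    "\<And>x y. x \<in> set xs \<Longrightarrow> y \<in> set xs \<Longrightarrow> x \<noteq> y \<Longrightarrow> set (f x) \<inter> set (f y) = {}"
  shows "distinct (concat (map f xs))"
  using assms
proof (induction xs)
  case (Cons x xs)
  have "set (f x) \<inter> set (f y) = {}" if "y \<in> set xs" for y
    using Cons.prems(1) that by (intro Cons.prems(3)) auto
  then have "set (f x) \<inter> set (concat (map f xs)) = {}" by auto
  moreover have "distinct (concat (map f xs))" using Cons.prems by (intro Cons.IH) auto
  ultimately show ?case using Cons.prems(2) by simp
qed simp

lemma distinct_subsets_exact: "distinct xs \<Longrightarrow> distinct (subsets_exact q xs)"
proof (induction q)
  case (Suc q)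
  show ?case unfolding subsets_exact.simps
    by (rule distinct_concat_map) (use Suc in \<open>auto simp: distinct_map inj_on_def\<close>)
qed simp

lemma set_subsets_upto:
  "set (subsets_upto q xs) = {Y. sorted_wrt (<) Y \<and> set Y \<subseteq> set xs \<and> Y \<noteq> [] \<and> length Y \<le> q}"
proof (induction q)
  case (Suc q)
  show ?case unfolding subsets_upto.simps set_append Suc set_subsets_exact
    by (auto simp del: sorted_wrt.simps)
qed auto

lemma distinct_subsets_upto: "distinct xs \<Longrightarrow> distinct (subsets_upto q xs)"
proof (induction q)
  case (Suc q)
  have "set (subsets_upto q xs) \<inter> set (subsets_exact (Suc q) xs) = {}"
    unfolding set_subsets_upto set_subsets_exact by auto
  then show ?case unfolding subsets_upto.simps distinct_append
    using Suc distinct_subsets_exact by blast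
qed simp

lemma sorted_card: "sorted_wrt (<) (Y :: nat list) \<Longrightarrow> card (set Y) = length Y"
  by (intro distinct_card) (simp add: strict_sorted_iff)

lemma bij_subsets_upto: "bij_betw set (set (subsets_upto q xs)) (sub_q q (set xs))"
  unfolding bij_betw_def
proof
  show "inj_on set (set (subsets_upto q xs))"
    unfolding set_subsets_upto by (rule inj_onI) (auto intro: strict_sorted_equal)
  show "set ` set (subsets_upto q xs) = sub_q q (set xs)"
  proof (intro equalityI subsetI)
    fix Z assume "Z \<in> set ` set (subsets_upto q xs)"
    then show "Z \<in> sub_q q (set xs)"
      unfolding set_subsets_upto by (auto simp: sub_q_def sorted_card)
  next
    fix Z assume Z: "Z \<in> sub_q q (set xs)"
    then have "finite Z" by (auto simp: sub_q_def intro: finite_subset)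
    then have "sorted_list_of_set Z \<in> set (subsets_upto q xs)"
      unfolding set_subsets_upto using Z by (auto simp: sub_q_def)
    with \<open>finite Z\<close> show "Z \<in> set ` set (subsets_upto q xs)"
      by (intro image_eqI[of _ _ "sorted_list_of_set Z"]) auto
  qed
qed

lemma sum_list_subsets_upto:
  assumes "distinct xs" "\<And>Y. Y \<in> set (subsets_upto q xs) \<Longrightarrow> f Y = g (set Y)"
  shows "sum_list (map f (subsets_upto q xs)) = (\<Sum>Z\<in>sub_q q (set xs). g Z)"
proof -
  have "sum_list (map f (subsets_upto q xs)) = (\<Sum>Y\<in>set (subsets_upto q xs). g (set Y))"
    using assms by (simp add: sum_list_distinct_conv_sum_set distinct_subsets_upto)
  also have "\<dots> = (\<Sum>Z\<in>sub_q q (set xs). g Z)" by (rule sum.reindex_bij_betw[OF bij_subsets_upto])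
  finally show ?thesis .
qed

lemma length_subsets_upto:
  assumes "distinct xs" shows "length (subsets_upto q xs) = card (sub_q q (set xs))"
  using sum_list_subsets_upto[of xs q "\<lambda>_. 1 :: nat" "\<lambda>_. 1"] assms by (simp add: sum_list_triv)

text \<open>\<open>int B - mob H (set Y)\<close> in natural numbers: what has a negative sign in
  \<open>mob\<close> is added before the rest is subtracted. The empty list is put back because
  \<open>subsets_upto\<close> lacks it.\<close>

definition weight :: "nat \<Rightarrow> nat \<Rightarrow> (nat list \<Rightarrow> nat) \<Rightarrow> nat list \<Rightarrow> nat" where
  "weight B q h Y =
     B + sum_list (map h (filter (\<lambda>Z. \<not> even (length Y + length Z)) ([] # subsets_upto q Y)))
       - sum_list (map h (filter (\<lambda>Z. even (length Y + length Z)) ([] # subsets_upto q Y)))"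

text \<open>\<open>length Y \<le> q\<close> lets the enumeration reach every nonempty subset of
  \<open>Y\<close>, and \<open>mob H (set Y) \<le> int B\<close> makes the truncated subtraction
  exact.\<close>

lemma weight_eq:
  assumes Y: "sorted_wrt (<) Y" "length Y \<le> q"
    and h: "\<And>Z. sorted_wrt (<) Z \<Longrightarrow> int (h Z) = H (set Z)" and B: "mob H (set Y) \<le> int B"
  shows "int (weight B q h Y) = int B - mob H (set Y)"
proof -
  let ?L = "[] # subsets_upto q Y"
  have split: "sum_list (map h (filter P zs)) = sum_list (map (\<lambda>Z. if P Z then h Z else 0) zs)"
    for P and zs :: "nat list list" by (induction zs) auto
  have sub_q: "sub_q q (set Y) = Pow (set Y) - {{}}"
  proof -
    have "card Z \<le> q" if "Z \<subseteq> set Y" for Z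
      using card_mono[OF _ that] sorted_card[OF Y(1)] Y(2) by simp
    then show ?thesis by (auto simp: sub_q_def)
  qed
  have "mob H (set Y) = (\<Sum>Z\<in>insert {} (sub_q q (set Y)). (- 1) ^ (length Y + card Z) * H Z)"
    unfolding mob_def sorted_card[OF Y(1)] sub_q by (rule sum.cong) auto
  also have "\<dots> = (- 1) ^ (length Y + card ({} :: nat set)) * H {}
      + (\<Sum>Z\<in>sub_q q (set Y). (- 1) ^ (length Y + card Z) * H Z)"
    by (rule sum.insert) (auto simp: sub_q)
  also have "(\<Sum>Z\<in>sub_q q (set Y). (- 1) ^ (length Y + card Z) * H Z)
      = sum_list (map (\<lambda>Z. (- 1) ^ (length Y + length Z) * int (h Z)) (subsets_upto q Y))"
    using Y(1) by (intro sum_list_subsets_upto[symmetric])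
      (auto simp: strict_sorted_iff set_subsets_upto sorted_card h)
  also have "(- 1) ^ (length Y + card ({} :: nat set)) * H {} = (- 1) ^ (length Y + length ([] :: nat list)) * int (h [])"
    using h[of "[]"] by simp
  finally have "mob H (set Y) = sum_list (map (\<lambda>Z. (- 1) ^ (length Y + length Z) * int (h Z)) ?L)"
    by simp
  also have "\<dots> = int (sum_list (map h (filter (\<lambda>Z. even (length Y + length Z)) ?L)))
      - int (sum_list (map h (filter (\<lambda>Z. \<not> even (length Y + length Z)) ?L)))"
  proof -
    have "sum_list (map (\<lambda>Z. (- 1) ^ (length Y + length Z) * int (h Z)) zs)
      = int (sum_list (map h (filter (\<lambda>Z. even (length Y + length Z)) zs)))
        - int (sum_list (map h (filter (\<lambda>Z. \<not> even (length Y + length Z)) zs)))" for zs :: "nat list list"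
      by (induction zs) (auto simp: minus_one_power_iff)
    then show ?thesis .
  qed
  finally show ?thesis using B unfolding weight_def by linarith
qed

section \<open>The bisection instance\<close>

text \<open>A vertex is described by a label \<open>(t, i, Y)\<close>. Type \<open>t = 0\<close> is the large clique, which
  contains the items \<open>(0, i, [x])\<close> and padding \<open>(0, 0, [])\<close>; type 2 are the gadget vertices,
  and type 3 is the clique on the other side.\<close>

type_synonym label = "nat \<times> nat \<times> nat list"

text \<open>Between different types below 3 the last clause joins items to gadgets:
  \<open>[x]\<close> meets \<open>Y\<close> just when \<open>x\<close> lies in \<open>Y\<close>, and
  padding, with its empty list, meets nothing.\<close>

definition adj :: "label \<Rightarrow> label \<Rightarrow> bool" where
  "adj a b \<longleftrightarrow> (if fst a = fst b
     then \<not> fst a = 2 \<or> fst (snd a) = fst (snd b) \<and> snd (snd a) = snd (snd b)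
     else fst a < 3 \<and> fst b < 3 \<and> fst (snd a) = fst (snd b) \<and>
       (\<exists>x\<in>set (snd (snd a)). x \<in> set (snd (snd b))))"

definition item_labels :: "nat \<Rightarrow> nat list \<Rightarrow> label list" where
  "item_labels n xs = concat (map (\<lambda>i. map (\<lambda>x. (0, i, [x])) xs) [0..<n])"

definition gadget_labels :: "nat \<Rightarrow> nat list \<Rightarrow> nat \<Rightarrow> (nat \<Rightarrow> nat list \<Rightarrow> nat) \<Rightarrow> label list" where
  "gadget_labels n xs q wt =
     concat (map (\<lambda>i. concat (map (\<lambda>Y. replicate (wt i Y) (2, i, Y)) (subsets_upto q xs))) [0..<n])"

text \<open>The padding alone gives the large clique the size that \<open>size_Q\<close> asks for;
  the length of the last block is then the one that solves \<open>size_K\<close>.\<close>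

definition graph_labels ::
    "nat \<Rightarrow> nat list \<Rightarrow> nat \<Rightarrow> (nat \<Rightarrow> nat list \<Rightarrow> nat) \<Rightarrow> nat \<Rightarrow> nat \<Rightarrow> label list" where
  "graph_labels n xs q wt k C =
     item_labels n xs @ replicate (k + 2 * C + 2) (0, 0, []) @ gadget_labels n xs q wt @
     replicate (length (item_labels n xs) + length (gadget_labels n xs q wt) + 2) (3, 0, [])"

definition label_edges :: "label list \<Rightarrow> (nat \<times> nat) list" where
  "label_edges ls =
     filter (\<lambda>e. adj (nth_or (0, 0, []) ls (fst e)) (nth_or (0, 0, []) ls (snd e)))
       (concat (map (\<lambda>a. map (\<lambda>b. (a, b)) [0..<a]) [0..<length ls]))"

definition label_graph :: "label list \<Rightarrow> nat graph" where
  "label_graph ls = graph_of (length ls) (label_edges ls)"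

lemma adj_sym: "adj a b \<longleftrightarrow> adj b a"
  by (auto simp: adj_def)

lemma label_graph_edge:
  "{a, b} \<in> snd (label_graph ls) \<longleftrightarrow> a < length ls \<and> b < length ls \<and> a \<noteq> b \<and> adj (ls ! a) (ls ! b)"
proof -
  have "set (label_edges ls) = {(a, b). b < a \<and> a < length ls \<and> adj (ls ! a) (ls ! b)}"
    by (force simp: label_edges_def nth_or image_iff)
  then have "{a, b} \<in> snd (label_graph ls) \<longleftrightarrow>
      (\<exists>u v. {a, b} = {u, v} \<and> v < u \<and> u < length ls \<and> adj (ls ! u) (ls ! v))"
    by (auto simp: label_graph_def graph_of_def)
  also have "\<dots> \<longleftrightarrow> a < length ls \<and> b < length ls \<and> a \<noteq> b \<and> adj (ls ! a) (ls ! b)"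
    using adj_sym[of "ls ! a" "ls ! b"] by (cases a b rule: linorder_cases) (auto simp: doubleton_eq_iff)
  finally show ?thesis .
qed

lemma fst_label_graph: "fst (label_graph ls) = {..<length ls}"
  by (simp add: label_graph_def graph_of_def)

lemma simple_label_graph: "simple_graph (label_graph ls)"
proof -
  have "e \<subseteq> {..<length ls} \<and> card e = 2" if e: "e \<in> snd (label_graph ls)" for e
  proof -
    obtain a b where ab: "e = {a, b}" using e by (auto simp: label_graph_def graph_of_def)
    then show ?thesis using e label_graph_edge[of a b ls] by auto
  qed
  then show ?thesis by (cases "label_graph ls") (metis finite_lessThan fst_conv fst_label_graph simple_graph.simps snd_conv)
qed

lemma ptime_adj: assumes "ptime a" "ptime b" shows "ptime (\<lambda>x. adj (a x) (b x))"
proof -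
  have "ptime (\<lambda>p. adj (fst p) (snd p))" unfolding adj_def by (intro ptime_intros)
  then show ?thesis by (rule ptime_comp2) fact+
qed

lemma ptime_label_edges: assumes "ptime l" shows "ptime (\<lambda>x. label_edges (l x))"
proof -
  have "ptime label_edges" unfolding label_edges_def by (intro ptime_intros ptime_adj)
  then show ?thesis using assms by (rule ptime_comp)
qed

lemma ptime_graph_labels:
  assumes "ptime n" "ptime xs" "ptime k" "ptime C"
    and wt: "ptime (\<lambda>p. wt (fst (fst p)) (snd (fst p)) (snd p))"
  shows "ptime (\<lambda>x. graph_labels (n x) (xs x) q (wt x) (k x) (C x))"
proof -
  have items: "ptime (\<lambda>x. item_labels (n x) (xs x))"
    unfolding item_labels_def by (intro ptime_intros assms ptime_comp[OF assms(2)])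
  have "ptime (\<lambda>x. gadget_labels (n x) (xs x) q (wt x))"
    unfolding gadget_labels_def
    by (intro ptime_intros assms ptime_subsets_upto ptime_comp[OF assms(2)] wt)
  with items show ?thesis unfolding graph_labels_def by (intro ptime_intros assms)
qed

lemma card_nth_eq_filter: "card {a. a < length ls \<and> P (ls ! a)} = length (filter P ls)"
  by (simp add: length_filter_conv_card)

lemma length_filter_concat: "length (filter P (concat xss)) = sum_list (map (\<lambda>xs. length (filter P xs)) xss)"
  by (induction xss) auto

lemma int_sum_list: "int (sum_list (map f ys)) = (\<Sum>y\<leftarrow>ys. int (f y))"
  by (induction ys) auto

section \<open>The labelled graph as a gadget graph\<close>

locale bisection_instance =
  fixes n q k B L :: nat and v :: "nat \<Rightarrow> nat set \<Rightarrow> nat" and xs :: "nat list"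
    and wt :: "nat \<Rightarrow> nat list \<Rightarrow> nat"
  assumes k: "1 \<le> k" and q: "2 \<le> q" and B: "k * k * L < B"
    and L: "\<And>i Z. i < n \<Longrightarrow> v i Z \<le> L"
    and v: "\<And>i Y. i < n \<Longrightarrow> finite Y \<Longrightarrow> q < card Y \<Longrightarrow> mob (\<lambda>Z. int (v i Z)) Y = 0"
    and xs: "distinct xs"
    and wt: "\<And>i Y. i < n \<Longrightarrow> Y \<in> set (subsets_upto q xs) \<Longrightarrow>
      int (wt i Y) = int B - mob (pot k (v i)) (set Y)"
begin

text \<open>The target: \<open>B\<close> vertices for each nonempty subset of at most
  \<open>q\<close> out of \<open>k\<close> items. It is written with a list because the reduction
  has to compute it.\<close>

abbreviation "C \<equiv> B * length (subsets_upto q [0..<k])"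

abbreviation "ls \<equiv> graph_labels n xs q wt k C"

definition "typed t = {a. a < length ls \<and> fst (ls ! a) = t}"

definition "nb g = {a. a < length ls \<and> (\<exists>x\<in>set (snd (snd (ls ! g))). ls ! a = (0, fst (snd (ls ! g)), [x]))}"

definition "chosen S = {(i, x). \<exists>a\<in>S. ls ! a = (0, i, [x])}"

lemma labels_0:
  assumes "a \<in> typed 0"
  obtains i x where "i < n" "x \<in> set xs" "ls ! a = (0, i, [x])" | "ls ! a = (0, 0, [])"
proof -
  have "ls ! a \<in> set ls" "fst (ls ! a) = 0" using assms by (auto simp: typed_def)
  then show thesis using that
    by (auto simp: graph_labels_def item_labels_def gadget_labels_def split: if_splits)
qed

lemma labels_1:
  assumes "a \<in> typed 2"
  obtains i Y where "i < n" "Y \<in> set (subsets_upto q xs)" "ls ! a = (2, i, Y)"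
proof -
  have "ls ! a \<in> set ls" "fst (ls ! a) = 2" using assms by (auto simp: typed_def)
  then show thesis using that
    by (auto simp: graph_labels_def item_labels_def gadget_labels_def split: if_splits)
qed

lemma typed_Un: "typed 0 \<union> typed 2 \<union> typed 3 = {..<length ls}"
proof -
  have *: "fst l \<in> {0, 2, 3}" if "l \<in> set ls" for l
    using that by (auto simp: graph_labels_def item_labels_def gadget_labels_def split: if_splits)
  have "a \<in> typed 0 \<union> typed 2 \<union> typed 3 \<longleftrightarrow> a < length ls" for a
    using *[OF nth_mem, of a] by (auto simp: typed_def)
  then show ?thesis by blast
qed

lemma filter_type:
  "filter (\<lambda>l. fst l = t) (item_labels n xs) = (if t = 0 then item_labels n xs else [])"
  "filter (\<lambda>l. fst l = t) (gadget_labels n xs q wt) = (if t = 2 then gadget_labels n xs q wt else [])"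
proof -
  have "fst l = 0" if "l \<in> set (item_labels n xs)" for l
    using that by (auto simp: item_labels_def)
  moreover have "fst l = 2" if "l \<in> set (gadget_labels n xs q wt)" for l
    using that by (auto simp: gadget_labels_def split: if_splits)
  ultimately show "filter (\<lambda>l. fst l = t) (item_labels n xs) = (if t = 0 then item_labels n xs else [])"
    "filter (\<lambda>l. fst l = t) (gadget_labels n xs q wt) = (if t = 2 then gadget_labels n xs q wt else [])"
    by (auto simp: filter_empty_conv filter_id_conv)
qed

lemma card_typed:
  "card (typed 0) = length (item_labels n xs) + (k + 2 * C + 2)"
  "card (typed 2) = length (gadget_labels n xs q wt)"
  "card (typed 3) = length (item_labels n xs) + length (gadget_labels n xs q wt) + 2"
proof -
  have "card (typed t) = length (filter (\<lambda>l. fst l = t) ls)" for t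
    unfolding typed_def by (rule card_nth_eq_filter)
  then show "card (typed 0) = length (item_labels n xs) + (k + 2 * C + 2)"
    "card (typed 2) = length (gadget_labels n xs q wt)"
    "card (typed 3) = length (item_labels n xs) + length (gadget_labels n xs q wt) + 2"
    by (simp_all add: graph_labels_def filter_type)
qed

text \<open>If a label of an item occurred twice, deleting one vertex with it would leave the other
  as a surviving neighbour of the gadgets.\<close>

lemma item_unique:
  assumes "i < n" "x \<in> set xs"
  shows "\<exists>!a. a < length ls \<and> ls ! a = (0, i, [x])"
proof -
  have "distinct (item_labels n xs)"
    unfolding item_labels_def using xs by (intro distinct_concat_map) (auto simp: distinct_map inj_on_def)
  moreover have "(0, i, [x]) \<in> set (item_labels n xs)" using assms by (auto simp: item_labels_def)
  ultimately have "length (filter (\<lambda>l. l = (0, i, [x])) (item_labels n xs)) = 1"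
  proof -
    assume d: "distinct (item_labels n xs)" and m: "(0, i, [x]) \<in> set (item_labels n xs)"
    have "length (filter (\<lambda>l. l = (0, i, [x])) (item_labels n xs))
      = card (set (filter (\<lambda>l. l = (0, i, [x])) (item_labels n xs)))"
      using d by (intro distinct_card[symmetric]) simp
    also have "set (filter (\<lambda>l. l = (0, i, [x])) (item_labels n xs)) = {(0, i, [x])}" using m by auto
    finally show ?thesis by simp
  qed
  moreover have "filter (\<lambda>l. l = (0, i, [x])) (gadget_labels n xs q wt) = []"
    by (auto simp: gadget_labels_def filter_empty_conv split: if_splits)
  ultimately have "length (filter (\<lambda>l. l = (0, i, [x])) ls) = 1"
    by (simp add: graph_labels_def)
  then have "card {a. a < length ls \<and> ls ! a = (0, i, [x])} = 1"
    by (simp only: card_nth_eq_filter[of ls "\<lambda>l. l = (0, i, [x])"])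
  then obtain a where a: "{a. a < length ls \<and> ls ! a = (0, i, [x])} = {a}" by (rule card_1_singletonE)
  have "b < length ls \<and> ls ! b = (0, i, [x]) \<longleftrightarrow> b = a" for b
    using a by (simp only: set_eq_iff mem_Collect_eq singleton_iff)
  then show ?thesis by simp
qed

lemma C_eq: "C = B * card (sub_q q {..<k})"
  by (simp add: length_subsets_upto lessThan_atLeast0)

sublocale gadget_graph "typed 0" "typed 2" "typed 3" nb "\<lambda>a. snd (ls ! a)" "snd (label_graph ls)" k C
proof
  show "finite (typed 0)" "finite (typed 2)" "finite (typed 3)" by (simp_all add: typed_def)
  show "typed 0 \<inter> typed 2 = {}" "typed 0 \<inter> typed 3 = {}" "typed 2 \<inter> typed 3 = {}"
    by (auto simp: typed_def)
  show "nb g \<subseteq> typed 0" for g by (auto simp: nb_def typed_def)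
  show "nb g = nb h" if "snd (ls ! g) = snd (ls ! h)" for g h using that by (simp add: nb_def)
  show "card (typed 0) + card (typed 2) = card (typed 3) + k + 2 * C" by (simp add: card_typed)
  show "k + 2 * C + 2 \<le> card (typed 0)" by (simp add: card_typed)
  have cross: "adj (ls ! a) (ls ! b) \<longleftrightarrow> b \<in> nb a" if a: "a \<in> typed 2" and b: "b \<in> typed 0" for a b
    using a
  proof (rule labels_1)
    fix i Y assume i: "ls ! a = (2, i, Y)"
    have "b < length ls" using b by (simp add: typed_def)
    then show ?thesis by (rule_tac labels_0[OF b]) (auto simp: adj_def nb_def i)
  qed
  have nb0: "b \<in> nb a \<Longrightarrow> b \<in> typed 0" for a b by (auto simp: nb_def typed_def)
  fix a b
  show "{a, b} \<in> snd (label_graph ls) \<longleftrightarrow> a \<noteq> b \<and>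
    (a \<in> typed 0 \<and> b \<in> typed 0 \<or> a \<in> typed 3 \<and> b \<in> typed 3 \<or>
     a \<in> typed 2 \<and> b \<in> typed 2 \<and> snd (ls ! a) = snd (ls ! b) \<or>
     a \<in> typed 2 \<and> b \<in> nb a \<or> b \<in> typed 2 \<and> a \<in> nb b)"
  proof (cases "a \<in> {..<length ls} \<and> b \<in> {..<length ls}")
    case False
    then show ?thesis unfolding label_graph_edge using nb0 by (auto simp: typed_def)
  next
    case True
    then have ab: "a < length ls" "b < length ls" by auto
    have dj: "typed s \<inter> typed t = {}" if "s \<noteq> t" for s t using that by (auto simp: typed_def)
    have same: "adj (ls ! a) (ls ! b) \<longleftrightarrow> \<not> t = 2 \<or> snd (ls ! a) = snd (ls ! b)"
      if "a \<in> typed t" "b \<in> typed t" for t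
      using that by (auto simp: typed_def adj_def prod_eq_iff)
    have no2: "\<not> adj (ls ! a) (ls ! b)" if "a \<in> typed s" "b \<in> typed t" "s = 3 \<or> t = 3" "s \<noteq> t" for s t
      using that by (auto simp: typed_def adj_def)
    from True typed_Un have "a \<in> typed 0 \<or> a \<in> typed 2 \<or> a \<in> typed 3" "b \<in> typed 0 \<or> b \<in> typed 2 \<or> b \<in> typed 3"
      by blast+
    \<comment> \<open>Equal types, a gadget vertex against the large clique in either order, and
      pairs with exactly one vertex in the clique of type 3.\<close>
    then consider t where "a \<in> typed t" "b \<in> typed t" "t = 0 \<or> t = 2 \<or> t = 3"
      | "a \<in> typed 2" "b \<in> typed 0" | "a \<in> typed 0" "b \<in> typed 2"
      | s t where "a \<in> typed s" "b \<in> typed t" "s = 3 \<or> t = 3" "s \<noteq> t"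
      by (metis zero_neq_numeral numeral_eq_iff semiring_norm(89))
    then show ?thesis
    proof cases
      case (1 t)
      have "a \<notin> typed s" "b \<notin> typed s" if "s \<noteq> t" for s using 1 dj[OF that] by auto
      moreover have "t \<noteq> 0 \<Longrightarrow> b \<notin> nb a \<and> a \<notin> nb b" using nb0 calculation[of 0] by metis
      ultimately show ?thesis unfolding label_graph_edge using same[OF 1(1,2)] 1 ab by auto
    next
      case 2
      then have "a \<notin> typed 0" "a \<notin> typed 3" "b \<notin> typed 2" "b \<notin> typed 3" "a \<noteq> b"
        by (auto simp: typed_def)
      then show ?thesis unfolding label_graph_edge using cross[OF 2] 2 ab by simp
    next
      case 3
      then have "b \<notin> typed 0" "b \<notin> typed 3" "a \<notin> typed 2" "a \<notin> typed 3" "a \<noteq> b"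
        by (auto simp: typed_def)
      then show ?thesis unfolding label_graph_edge using cross[OF 3(2,1)] adj_sym 3 ab by simp
    next
      case (4 s t)
      then show ?thesis unfolding label_graph_edge using no2[OF 4] nb0 by (auto simp: typed_def)
    qed
  qed
qed

lemma chosen_subset: "S \<subseteq> typed 0 \<Longrightarrow> chosen S \<subseteq> {..<n} \<times> set xs"
  by (force simp: chosen_def elim: labels_0)

lemma finite_chosen: "S \<subseteq> typed 0 \<Longrightarrow> finite (chosen S)"
  using chosen_subset by (rule finite_subset) auto

lemma card_chosen: assumes "S \<subseteq> typed 0" shows "card (chosen S) \<le> card S"
proof -
  have "finite S" using assms fin(1) by (rule finite_subset)
  have "chosen S \<subseteq> (\<lambda>a. (fst (snd (ls ! a)), hd (snd (snd (ls ! a))))) ` S"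
    by (force simp: chosen_def)
  then have "card (chosen S) \<le> card ((\<lambda>a. (fst (snd (ls ! a)), hd (snd (snd (ls ! a))))) ` S)"
    using \<open>finite S\<close> by (intro card_mono) auto
  also have "\<dots> \<le> card S" using \<open>finite S\<close> by (rule card_image_le)
  finally show ?thesis .
qed

lemma ex_chosen:
  assumes "finite T" "T \<subseteq> {..<n} \<times> set xs"
  shows "\<exists>S\<subseteq>typed 0. card S \<le> card T \<and> chosen S = T"
proof -
  have "\<exists>it. \<forall>p\<in>T. it p < length ls \<and> ls ! it p = (0, fst p, [snd p])"
  proof (rule bchoice, rule ballI)
    fix p assume "p \<in> T"
    then have "fst p < n" "snd p \<in> set xs" using assms(2) by auto
    then show "\<exists>a. a < length ls \<and> ls ! a = (0, fst p, [snd p])" by (rule item_unique[THEN ex1_implies_ex])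
  qed
  then obtain it where it': "\<And>p. p \<in> T \<Longrightarrow> it p < length ls \<and> ls ! it p = (0, fst p, [snd p])"
    by blast
  show ?thesis
  proof (intro exI[of _ "it ` T"] conjI)
    show "it ` T \<subseteq> typed 0" using it' by (auto simp: typed_def)
    show "card (it ` T) \<le> card T" using assms(1) by (rule card_image_le)
    have "(i, x) \<in> chosen (it ` T) \<longleftrightarrow> (\<exists>p\<in>T. fst p = i \<and> snd p = x)" for i x
      using it' by (simp add: chosen_def)
    then show "chosen (it ` T) = T" by (auto simp: set_eq_iff) (metis fst_conv snd_conv)
  qed
qed

lemma nb_subset_iff:
  assumes S: "S \<subseteq> typed 0" and g: "ls ! g = (2, i, Y)" "i < n" "Y \<in> set (subsets_upto q xs)"
  shows "nb g \<subseteq> S \<longleftrightarrow> set Y \<subseteq> chosen S `` {i}"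
proof
  assume "nb g \<subseteq> S"
  show "set Y \<subseteq> chosen S `` {i}"
  proof
    fix x assume x: "x \<in> set Y"
    with g have "x \<in> set xs" by (auto simp: set_subsets_upto)
    with item_unique[OF g(2)] obtain a where "a < length ls" "ls ! a = (0, i, [x])" by metis
    then have "a \<in> nb g" using x g by (auto simp: nb_def)
    with \<open>nb g \<subseteq> S\<close> \<open>ls ! a = (0, i, [x])\<close> show "x \<in> chosen S `` {i}" by (auto simp: chosen_def)
  qed
next
  assume *: "set Y \<subseteq> chosen S `` {i}"
  show "nb g \<subseteq> S"
  proof
    fix a assume "a \<in> nb g"
    then obtain x where x: "x \<in> set Y" "a < length ls" "ls ! a = (0, i, [x])" using g by (auto simp: nb_def)
    with * obtain b where b: "b \<in> S" "ls ! b = (0, i, [x])" by (auto simp: chosen_def)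
    have "x \<in> set xs" using x g by (auto simp: set_subsets_upto)
    moreover have "b < length ls" using b S by (auto simp: typed_def)
    ultimately have "a = b" using item_unique[OF g(2), of x] x b by (metis ex1_implies_ex)
    with b show "a \<in> S" by simp
  qed
qed

text \<open>The gadget of \<open>i\<close> and \<open>Y\<close> contributes all its
  \<open>wt i Y\<close> vertices if the deleted items with index \<open>i\<close> cover
  \<open>Y\<close>, and none otherwise.\<close>

lemma card_iso:
  assumes S: "S \<subseteq> typed 0"
  shows "int (card (iso S)) = isolated_weight n q k B v (chosen S)"
proof -
  let ?P = "\<lambda>l. fst l = 2 \<and> set (snd (snd l)) \<subseteq> chosen S `` {fst (snd l)}"
  have "iso S = {a. a < length ls \<and> ?P (ls ! a)}"
  proof (intro set_eqI iffI)
    fix a assume "a \<in> iso S"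
    then have a: "a \<in> typed 2" "nb a \<subseteq> S" by (auto simp: iso_def)
    from a(1) show "a \<in> {a. a < length ls \<and> ?P (ls ! a)}"
    proof (rule labels_1)
      fix i Y assume l: "i < n" "Y \<in> set (subsets_upto q xs)" "ls ! a = (2, i, Y)"
      have "set Y \<subseteq> chosen S `` {i}" using nb_subset_iff[OF S l(3,1,2)] a(2) by blast
      moreover have "a < length ls" using a(1) by (simp add: typed_def)
      ultimately show ?thesis using l(3) by simp
    qed
  next
    fix a assume *: "a \<in> {a. a < length ls \<and> ?P (ls ! a)}"
    then have a: "a \<in> typed 2" by (simp add: typed_def)
    then show "a \<in> iso S"
    proof (rule labels_1)
      fix i Y assume l: "i < n" "Y \<in> set (subsets_upto q xs)" "ls ! a = (2, i, Y)"
      then have "set Y \<subseteq> chosen S `` {i}" using * by simp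
      then show ?thesis using nb_subset_iff[OF S l(3,1,2)] a by (simp add: iso_def)
    qed
  qed
  then have "card (iso S) = length (filter ?P ls)" by (simp only: card_nth_eq_filter[of ls ?P])
  also have "\<dots> = length (filter ?P (gadget_labels n xs q wt))"
  proof -
    have "filter ?P (item_labels n xs) = []" by (auto simp: filter_empty_conv item_labels_def)
    then show ?thesis by (simp add: graph_labels_def)
  qed
  also have "\<dots> = (\<Sum>i<n. \<Sum>Y\<leftarrow>subsets_upto q xs. if set Y \<subseteq> chosen S `` {i} then wt i Y else 0)"
    unfolding gadget_labels_def length_filter_concat map_map o_def
    by (simp add: sum_list_distinct_conv_sum_set lessThan_atLeast0 filter_replicate if_distrib cong: if_cong)
  finally have "int (card (iso S)) =
      (\<Sum>i<n. \<Sum>Y\<leftarrow>subsets_upto q xs. int (if set Y \<subseteq> chosen S `` {i} then wt i Y else 0))"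
    by (simp add: int_sum_list)
  also have "\<dots> = (\<Sum>i<n. \<Sum>Y\<in>sub_q q (chosen S `` {i}). int B - mob (pot k (v i)) Y)"
  proof (rule sum.cong[OF refl])
    fix i assume i: "i \<in> {..<n}"
    let ?g = "\<lambda>Z. if Z \<subseteq> chosen S `` {i} then int B - mob (pot k (v i)) Z else 0"
    have sub: "chosen S `` {i} \<subseteq> set xs" using chosen_subset[OF S] by auto
    have "(\<Sum>Y\<leftarrow>subsets_upto q xs. int (if set Y \<subseteq> chosen S `` {i} then wt i Y else 0))
      = (\<Sum>Z\<in>sub_q q (set xs). ?g Z)"
      using i by (intro sum_list_subsets_upto[OF xs]) (auto simp: wt)
    also have "\<dots> = (\<Sum>Z\<in>sub_q q (chosen S `` {i}). ?g Z)"
      by (rule sum.mono_neutral_right)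
        (use finite_sub_q[of "set xs"] sub_q_mono[OF sub] in \<open>auto simp: sub_q_def\<close>)
    also have "\<dots> = (\<Sum>Z\<in>sub_q q (chosen S `` {i}). int B - mob (pot k (v i)) Z)"
      by (rule sum.cong) (auto simp: sub_q_def)
    finally show "(\<Sum>Y\<leftarrow>subsets_upto q xs. int (if set Y \<subseteq> chosen S `` {i} then wt i Y else 0))
      = (\<Sum>Y\<in>sub_q q (chosen S `` {i}). int B - mob (pot k (v i)) Y)" .
  qed
  finally show ?thesis unfolding isolated_weight_def .
qed

text \<open>A class \<open>(i, Y)\<close> is determined by the set
  \<open>{i} \<times> set Y\<close>, which is a small subset of the at most \<open>k\<close> deleted
  items. The bound therefore depends on \<open>k\<close> and \<open>q\<close> only, however large
  the gadgets are.\<close>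

lemma card_classes:
  assumes S: "S \<subseteq> typed 0" "card S \<le> k"
  shows "card ((\<lambda>a. snd (ls ! a)) ` iso S) \<le> card (sub_q q {..<k})"
proof -
  let ?T = "chosen S" and ?f = "\<lambda>c :: nat \<times> nat list. {fst c} \<times> set (snd c)"
  have c: "snd p \<in> set (subsets_upto q xs) \<and> set (snd p) \<subseteq> ?T `` {fst p}"
    if p: "p \<in> (\<lambda>a. snd (ls ! a)) ` iso S" for p
  proof -
    from p obtain a where a: "a \<in> typed 2" "nb a \<subseteq> S" "p = snd (ls ! a)" by (auto simp: iso_def)
    from a(1) show ?thesis
    proof (rule labels_1)
      fix i Y assume l: "i < n" "Y \<in> set (subsets_upto q xs)" "ls ! a = (2, i, Y)"
      with nb_subset_iff[OF S(1) l(3,1,2)] a(2,3) show ?thesis by simp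
    qed
  qed
  have "card ((\<lambda>a. snd (ls ! a)) ` iso S) \<le> card (sub_q q ?T)"
  proof (rule card_inj_on_le)
    show "inj_on ?f ((\<lambda>a. snd (ls ! a)) ` iso S)"
    proof (rule inj_onI)
      fix p p' assume "p \<in> (\<lambda>a. snd (ls ! a)) ` iso S" "p' \<in> (\<lambda>a. snd (ls ! a)) ` iso S" and eq: "?f p = ?f p'"
      with c have Y: "snd p \<in> set (subsets_upto q xs)" "snd p' \<in> set (subsets_upto q xs)" by auto
      then have "set (snd p) \<noteq> {}" "set (snd p') \<noteq> {}" by (auto simp: set_subsets_upto)
      with eq have "fst p = fst p'" "set (snd p) = set (snd p')" by (auto simp: times_eq_iff)
      moreover have "sorted_wrt (<) (snd p)" "sorted_wrt (<) (snd p')" using Y by (auto simp: set_subsets_upto)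
      ultimately show "p = p'" using strict_sorted_equal by (metis prod_eqI)
    qed
    show "?f ` (\<lambda>a. snd (ls ! a)) ` iso S \<subseteq> sub_q q ?T"
    proof
      fix U assume "U \<in> ?f ` (\<lambda>a. snd (ls ! a)) ` iso S"
      then obtain p where p: "U = ?f p" "p \<in> (\<lambda>a. snd (ls ! a)) ` iso S" by blast
      have "card U = card (set (snd p))" by (simp add: p(1) card_cartesian_product)
      with p c[OF p(2)] show "U \<in> sub_q q ?T"
        by (auto simp: sub_q_def set_subsets_upto sorted_card)
    qed
    show "finite (sub_q q ?T)" by (rule finite_sub_q[OF finite_chosen[OF S(1)]])
  qed
  also have "\<dots> = card (sub_q q {..<card ?T})" by (rule card_sub_q[OF finite_chosen[OF S(1)]])
  also have "\<dots> \<le> card (sub_q q {..<k})"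
    using card_chosen[OF S(1)] S(2) by (intro card_mono finite_sub_q sub_q_mono) auto
  finally show ?thesis .
qed

lemma label_graph_eq: "label_graph ls = (typed 0 \<union> typed 2 \<union> typed 3, snd (label_graph ls))"
  unfolding typed_Un by (metis fst_label_graph prod.collapse)

text \<open>\<open>chosen\<close> and \<open>ex_chosen\<close> pass between deleted vertices and
  deleted items without increasing their number; padding among the deleted vertices isolates
  nothing.\<close>

theorem label_graph_bisection_iff:
  "(\<exists>S. balanced_separator (label_graph ls) S \<and> card S \<le> k) \<longleftrightarrow>
    (\<exists>i X. i < n \<and> X \<subseteq> set xs \<and> card X = k \<and> v i X = 0)"
proof -
  have le: "card (iso S) \<le> C" if S: "S \<subseteq> typed 0" "card S \<le> k" for S
  proof -
    have "isolated_weight n q k B v (chosen S) \<le> int (B * card (sub_q q {..<k}))"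
      using finite_chosen[OF S(1)] card_chosen[OF S(1)] S(2) chosen_subset[OF S(1)]
      by (intro isolated_weight_le[where L = L] k q B L v) auto
    then show ?thesis unfolding card_iso[OF S(1), symmetric] C_eq by (simp only: of_nat_le_iff)
  qed
  have "(\<exists>S. balanced_separator (label_graph ls) S \<and> card S \<le> k) \<longleftrightarrow>
    (\<exists>S\<subseteq>typed 0. card S \<le> k \<and> C \<le> card (iso S))"
    by (subst label_graph_eq) (rule balanced_separator_iff[OF le])
  also have "\<dots> \<longleftrightarrow> (\<exists>T. finite T \<and> card T \<le> k \<and> T \<subseteq> {..<n} \<times> set xs \<and>
      int (B * card (sub_q q {..<k})) \<le> isolated_weight n q k B v T)"
  proof
    assume "\<exists>S\<subseteq>typed 0. card S \<le> k \<and> C \<le> card (iso S)"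
    then obtain S where S: "S \<subseteq> typed 0" "card S \<le> k" "C \<le> card (iso S)" by blast
    have "int (B * card (sub_q q {..<k})) \<le> isolated_weight n q k B v (chosen S)"
      using S(3) unfolding card_iso[OF S(1), symmetric] C_eq by (simp only: of_nat_le_iff)
    then show "\<exists>T. finite T \<and> card T \<le> k \<and> T \<subseteq> {..<n} \<times> set xs \<and>
        int (B * card (sub_q q {..<k})) \<le> isolated_weight n q k B v T"
      using finite_chosen[OF S(1)] card_chosen[OF S(1)] S(2) chosen_subset[OF S(1)]
      by (intro exI[of _ "chosen S"]) auto
  next
    assume "\<exists>T. finite T \<and> card T \<le> k \<and> T \<subseteq> {..<n} \<times> set xs \<and>
        int (B * card (sub_q q {..<k})) \<le> isolated_weight n q k B v T"
    then obtain T where T: "finite T" "card T \<le> k" "T \<subseteq> {..<n} \<times> set xs"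
        "int (B * card (sub_q q {..<k})) \<le> isolated_weight n q k B v T" by blast
    from ex_chosen[OF T(1,3)] obtain S where S: "S \<subseteq> typed 0" "card S \<le> card T" "chosen S = T" by blast
    have "C \<le> card (iso S)"
      using T(4) unfolding S(3)[symmetric] card_iso[OF S(1), symmetric] C_eq by (simp only: of_nat_le_iff)
    then show "\<exists>S\<subseteq>typed 0. card S \<le> k \<and> C \<le> card (iso S)" using S T(2) by (intro exI[of _ S]) auto
  qed
  also have "\<dots> \<longleftrightarrow> (\<exists>i X. i < n \<and> finite X \<and> X \<subseteq> set xs \<and> card X = k \<and> v i X = 0)"
    by (rule isolated_weight_attained[where L = L]) (use k q B L v in auto)
  also have "\<dots> \<longleftrightarrow> (\<exists>i X. i < n \<and> X \<subseteq> set xs \<and> card X = k \<and> v i X = 0)"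
    using finite_subset[OF _ finite_set] by blast
  finally show ?thesis .
qed

theorem label_graph_max_components:
  "max_components (label_graph ls) k \<le> 2 + length (subsets_upto q [0..<k])"
  by (subst label_graph_eq, rule max_components_le)
    (use card_classes in \<open>simp add: length_subsets_upto lessThan_atLeast0\<close>)

end

section \<open>Evaluation of circuits by recursion on the depth\<close>

lemma length_sweep [simp]: "length (sweep f C) = length C"
  by (induction C rule: rev_induct) (auto simp: sweep_def)

lemma sweep_nth: "i < length C \<Longrightarrow> sweep f C ! i = f (take i (sweep f C)) (C ! i)"
proof (induction C rule: rev_induct)
  case (snoc g C)
  have "sweep f (C @ [g]) = sweep f C @ [f (sweep f C) g]" by (simp add: sweep_def)
  with snoc show ?case by (cases "i = length C") (auto simp: nth_append)
qed simp

definition gval :: "circuit \<Rightarrow> nat set \<Rightarrow> nat \<Rightarrow> bool" where "gval C X i = sweep (gate_value X) C ! i"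
definition gdepth :: "circuit \<Rightarrow> nat \<Rightarrow> nat" where "gdepth C i = sweep gate_depth C ! i"
definition gweft :: "circuit \<Rightarrow> nat \<Rightarrow> nat" where "gweft C i = sweep gate_weft C ! i"

lemma last_sweep: "C \<noteq> [] \<Longrightarrow> last (sweep f C) = sweep f C ! (length C - 1)"
  by (metis last_conv_nth length_0_conv length_sweep)

lemma output_gate:
  assumes "circuit C"
  shows "satisfies X C \<longleftrightarrow> gval C X (length C - 1)" "depth C = gdepth C (length C - 1)"
    "weft C = gweft C (length C - 1)" "length C - 1 < length C"
  using assms by (auto simp: circuit_def satisfies_def depth_def weft_def gval_def gdepth_def gweft_def last_sweep)

lemma gate_at [simp]: "i < length C \<Longrightarrow> gate_at C i = C ! i"
  by (simp add: gate_at_def nth_or)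

lemma tag_0 [simp]: "tag g = 0 \<longleftrightarrow> g = Input"
  by (cases g) auto

lemma tag_1_preds: "tag g = 1 \<Longrightarrow> length (preds g) = 1"
  by (cases g) auto

context
  fixes C :: circuit
  assumes C: "circuit C"
begin

lemma preds_less: "i < length C \<Longrightarrow> p \<in> set (preds (C ! i)) \<Longrightarrow> p < i"
  using C by (auto simp: circuit_def)

lemma preds_less_length: "i < length C \<Longrightarrow> p \<in> set (preds (C ! i)) \<Longrightarrow> p < length C"
  using preds_less less_trans by blast

lemma preds_length: "i < length C \<Longrightarrow> C ! i = Conj ps \<or> C ! i = Disj ps \<Longrightarrow> 2 \<le> length ps"
  using C by (auto simp: circuit_def)

lemma preds_nonempty: "i < length C \<Longrightarrow> C ! i \<noteq> Input \<Longrightarrow> preds (C ! i) \<noteq> []"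
  using preds_length[of i] by (cases "C ! i") auto

lemma gval_gate:
  assumes "i < length C"
  shows "gval C X i \<longleftrightarrow> (case C ! i of Input \<Rightarrow> i \<in> X | Neg p \<Rightarrow> \<not> gval C X p
    | Conj ps \<Rightarrow> \<forall>p\<in>set ps. gval C X p | Disj ps \<Rightarrow> \<exists>p\<in>set ps. gval C X p)"
  using assms preds_less[of i] unfolding gval_def
  by (subst sweep_nth) (auto split: gate.splits)

lemma gdepth_gate:
  assumes "i < length C"
  shows "gdepth C i = (if C ! i = Input then 0 else Suc (Max (gdepth C ` set (preds (C ! i)))))"
proof -
  have "(\<lambda>p. take i (sweep gate_depth C) ! p) ` set (preds (C ! i)) = gdepth C ` set (preds (C ! i))"
    using preds_less[OF assms] by (intro image_cong) (auto simp: gdepth_def)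
  then show ?thesis unfolding gdepth_def by (subst sweep_nth[OF assms]) (simp add: gate_depth_def gdepth_def)
qed

lemma gweft_gate:
  assumes "i < length C"
  shows "gweft C i = (if C ! i = Input then 0 else
    (if 2 < length (preds (C ! i)) then 1 else 0) + Max (gweft C ` set (preds (C ! i))))"
proof -
  have "(\<lambda>p. take i (sweep gate_weft C) ! p) ` set (preds (C ! i)) = gweft C ` set (preds (C ! i))"
    using preds_less[OF assms] by (intro image_cong) (auto simp: gweft_def)
  then show ?thesis unfolding gweft_def by (subst sweep_nth[OF assms]) (simp add: gate_weft_def gweft_def)
qed

lemma gdepth_le_0: "i < length C \<Longrightarrow> gdepth C i \<le> 0 \<longleftrightarrow> C ! i = Input"
  by (simp add: gdepth_gate)

lemma gdepth_le_Suc: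
  "i < length C \<Longrightarrow> gdepth C i \<le> Suc j \<longleftrightarrow> (\<forall>p\<in>set (preds (C ! i)). gdepth C p \<le> j)"
  using preds_nonempty[of i] by (auto simp: gdepth_gate)

lemma gweft_le:
  "i < length C \<Longrightarrow> gweft C i \<le> t \<longleftrightarrow> C ! i = Input \<or>
    (\<forall>p\<in>set (preds (C ! i)). (if 2 < length (preds (C ! i)) then 1 else 0) + gweft C p \<le> t)"
proof -
  assume i: "i < length C"
  have "m + Max A \<le> t \<longleftrightarrow> (\<forall>a\<in>A. m + a \<le> t)" if "finite A" "A \<noteq> {}" for m :: nat and A
    using that Max_in[OF that] Max_ge[OF that(1)] by (meson add_left_mono le_trans)
  then show ?thesis using preds_nonempty[OF i] by (auto simp: gweft_gate[OF i])
qed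

lemma depth_le_iff: "i < length C \<Longrightarrow> depth_le j C i \<longleftrightarrow> gdepth C i \<le> j"
proof (induction j arbitrary: i)
  case 0
  then show ?case using gdepth_le_0[of i] by simp
next
  case (Suc j)
  have "\<forall>p\<in>set (preds (C ! i)). depth_le j C p \<longleftrightarrow> gdepth C p \<le> j"
    by (intro ballI Suc.IH preds_less_length[OF Suc.prems])
  then show ?case unfolding depth_le.simps gate_at[OF Suc.prems] gdepth_le_Suc[OF Suc.prems] by simp
qed

text \<open>The depth bound is what makes the recursion end correctly: \<open>weft_0 0\<close>
  accepts every gate, and a gate of depth 0 is an input.\<close>

lemma weft_0_iff: "i < length C \<Longrightarrow> gdepth C i \<le> j \<Longrightarrow> weft_0 j C i \<longleftrightarrow> gweft C i \<le> 0"
proof (induction j arbitrary: i)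
  case 0
  then show ?case using gdepth_le_0[of i] gweft_le[of i 0] by simp
next
  case (Suc j)
  note i = Suc.prems(1)
  have *: "\<forall>p\<in>set (preds (C ! i)). weft_0 j C p \<longleftrightarrow> gweft C p \<le> 0"
    using Suc.prems gdepth_le_Suc[OF i] by (intro ballI Suc.IH preds_less_length[OF i]) simp_all
  show ?case
  proof (cases "C ! i = Input")
    case True
    then show ?thesis unfolding weft_0.simps gate_at[OF i] gweft_le[OF i] by simp
  next
    case False
    then show ?thesis using * preds_nonempty[OF i] unfolding weft_0.simps gate_at[OF i] gweft_le[OF i]
      by (cases "2 < length (preds (C ! i))") auto
  qed
qed

lemma weft_1_iff: "i < length C \<Longrightarrow> gdepth C i \<le> j \<Longrightarrow> weft_1 j C i \<longleftrightarrow> gweft C i \<le> 1"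
proof (induction j arbitrary: i)
  case 0
  then show ?case using gdepth_le_0[of i] gweft_le[of i 1] by simp
next
  case (Suc j)
  note i = Suc.prems(1)
  have 1: "\<forall>p\<in>set (preds (C ! i)). weft_1 j C p \<longleftrightarrow> gweft C p \<le> 1"
    using Suc.prems gdepth_le_Suc[OF i] by (intro ballI Suc.IH preds_less_length[OF i]) simp_all
  have 0: "\<forall>p\<in>set (preds (C ! i)). weft_0 j C p \<longleftrightarrow> gweft C p \<le> 0"
    using Suc.prems gdepth_le_Suc[OF i] by (intro ballI weft_0_iff preds_less_length[OF i]) simp_all
  have "weft_1 (Suc j) C i \<longleftrightarrow>
    (\<forall>p\<in>set (preds (C ! i)). (if 2 < length (preds (C ! i)) then 1 else 0) + gweft C p \<le> 1)"
    unfolding weft_1.simps gate_at[OF i]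
  proof (rule ball_cong[OF refl])
    fix p assume p: "p \<in> set (preds (C ! i))"
    show "(if length (preds (C ! i)) \<le> 2 then weft_1 j C p else weft_0 j C p) \<longleftrightarrow>
      (if 2 < length (preds (C ! i)) then 1 else 0) + gweft C p \<le> 1"
      using 0[rule_format, OF p] 1[rule_format, OF p] by (simp add: not_le)
  qed
  also have "\<dots> \<longleftrightarrow> gweft C i \<le> 1"
    using gweft_le[OF i, of 1] by (cases "C ! i = Input") simp_all
  finally show ?case .
qed

lemma val_eq: "i < length C \<Longrightarrow> gdepth C i \<le> j \<Longrightarrow> val j C Z i \<longleftrightarrow> gval C (set Z) i"
proof (induction j arbitrary: i)
  case 0
  then show ?case using gdepth_le_0[of i] by (simp add: gval_gate)
next
  case (Suc j)
  have "\<forall>p\<in>set (preds (C ! i)). val j C Z p \<longleftrightarrow> gval C (set Z) p"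
    using Suc.prems by (auto simp: gdepth_le_Suc preds_less_length intro!: Suc.IH)
  then show ?case using Suc.prems(1) by (cases "C ! i") (auto simp: gval_gate[of i])
qed

section \<open>Locality and normal form for circuits of small weft\<close>

text \<open>Weft 0 means in-degree at most 2 everywhere below the gate, so each level of depth at
  most doubles the number of inputs that matter.\<close>

lemma gval_junta:
  "i < length C \<Longrightarrow> gdepth C i \<le> j \<Longrightarrow> gweft C i = 0 \<Longrightarrow>
    \<exists>A. finite A \<and> card A \<le> 2 ^ j \<and> (\<forall>X. gval C X i = gval C (X \<inter> A) i)"
proof (induction j arbitrary: i)
  case 0
  then have "C ! i = Input" using gdepth_le_0[of i] by simp
  then show ?case using 0 by (intro exI[of _ "{i}"]) (simp add: gval_gate)
next
  case (Suc j)
  show ?case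
  proof (cases "C ! i = Input")
    case True
    then show ?thesis using Suc.prems by (intro exI[of _ "{i}"]) (simp add: gval_gate)
  next
    case False
    let ?P = "set (preds (C ! i))"
    have *: "\<forall>p\<in>?P. (if 2 < length (preds (C ! i)) then 1 else 0) + gweft C p \<le> 0"
      using gweft_le[OF Suc.prems(1), of 0] Suc.prems(3) False by simp
    then have small: "card ?P \<le> 2" using card_length[of "preds (C ! i)"] preds_nonempty[OF Suc.prems(1) False]
      by (cases "2 < length (preds (C ! i))") auto
    have "\<exists>A. finite A \<and> card A \<le> 2 ^ j \<and> (\<forall>X. gval C X p = gval C (X \<inter> A) p)" if "p \<in> ?P" for p
      using Suc.prems that * by (intro Suc.IH) (auto simp: gdepth_le_Suc preds_less_length)
    then have "\<exists>A. \<forall>p\<in>?P. finite (A p) \<and> card (A p) \<le> 2 ^ j \<and> (\<forall>X. gval C X p = gval C (X \<inter> A p) p)"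
      by (intro bchoice ballI)
    then obtain A where A: "\<And>p. p \<in> ?P \<Longrightarrow> finite (A p)" "\<And>p. p \<in> ?P \<Longrightarrow> card (A p) \<le> 2 ^ j"
      "\<And>p X. p \<in> ?P \<Longrightarrow> gval C X p = gval C (X \<inter> A p) p" by blast
    let ?A = "\<Union>p\<in>?P. A p"
    have "card ?A \<le> (\<Sum>p\<in>?P. card (A p))" by (rule card_UN_le) simp
    also have "\<dots> \<le> (\<Sum>p\<in>?P. 2 ^ j)" by (rule sum_mono) (rule A)
    also have "\<dots> \<le> 2 ^ Suc j" using small by simp
    finally have "card ?A \<le> 2 ^ Suc j" .
    moreover have "gval C X i = gval C (X \<inter> ?A) i" for X
    proof -
      have "\<forall>p\<in>?P. gval C (X \<inter> ?A) p = gval C X p"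
      proof
        fix p assume p: "p \<in> ?P"
        then have "X \<inter> ?A \<inter> A p = X \<inter> A p" by auto
        then show "gval C (X \<inter> ?A) p = gval C X p"
          using A(3)[OF p, of X] A(3)[OF p, of "X \<inter> ?A"] by metis
      qed
      then show ?thesis
        using False unfolding gval_gate[OF Suc.prems(1)] by (cases "C ! i") auto
    qed
    ultimately show ?thesis using A(1) by (intro exI[of _ ?A]) simp
  qed
qed

text \<open>By de Morgan, a \<open>Conj\<close> gate required to be true and a \<open>Disj\<close>
  gate required to be false ask for \<open>b\<close> at all predecessors, so the two forms are
  multiplied out; in the opposite cases one predecessor suffices and the forms are
  collected.\<close>

lemma dnf_correct:
  "i < length C \<Longrightarrow> gdepth C i \<le> j \<Longrightarrow>
    (\<exists>w\<in>set (dnf j C i b). \<forall>c\<in>set w. gval C X (fst c) = snd c) \<longleftrightarrow> gval C X i = b"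
proof (induction j arbitrary: i b)
  case (Suc j)
  let ?sat = "\<lambda>w. \<forall>c\<in>set w. gval C X (fst c) = snd c"
  have IH: "(\<exists>w\<in>set (dnf j C p b). ?sat w) \<longleftrightarrow> gval C X p = b" if "p \<in> set (preds (C ! i))" for p b
    using that Suc.prems gdepth_le_Suc[OF Suc.prems(1)]
    by (intro Suc.IH preds_less_length[OF Suc.prems(1)]) auto
  have any: "(\<exists>w\<in>set (concat (map (\<lambda>p. dnf j C p b) ps)). ?sat w) \<longleftrightarrow> (\<exists>p\<in>set ps. gval C X p = b)"
    if "preds (C ! i) = ps" for ps b
    using IH[unfolded that] by (simp add: bex_UN)
  have all: "(\<exists>w\<in>set (concat (map (\<lambda>u. map (\<lambda>v. u @ v) (dnf j C (nth_or 0 ps 1) b))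
      (dnf j C (nth_or 0 ps 0) b))). ?sat w) \<longleftrightarrow> (\<forall>p\<in>set ps. gval C X p = b)"
    if ps: "preds (C ! i) = ps" and "length ps = 2" for ps b
  proof -
    obtain p p' where p: "ps = [p, p']" using \<open>length ps = 2\<close> by (metis length_0_conv length_Suc_conv numeral_2_eq_2)
    have "(\<exists>w\<in>set (concat (map (\<lambda>u. map (\<lambda>v. u @ v) (dnf j C p' b)) (dnf j C p b))). ?sat w)
      \<longleftrightarrow> (\<exists>u\<in>set (dnf j C p b). ?sat u) \<and> (\<exists>v\<in>set (dnf j C p' b). ?sat v)"
      by (auto simp: ball_Un)
    then show ?thesis using IH[of p b] IH[of p' b] ps p by (simp add: nth_or)
  qed
  have big_all: "(\<exists>w\<in>set [map (\<lambda>p. (p, b)) ps]. ?sat w) \<longleftrightarrow> (\<forall>p\<in>set ps. gval C X p = b)" for ps b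
    by simp
  have big_any: "(\<exists>w\<in>set (map (\<lambda>p. [(p, b)]) ps). ?sat w) \<longleftrightarrow> (\<exists>p\<in>set ps. gval C X p = b)" for ps b
    by simp
  have at: "gate_at C i = C ! i" using Suc.prems by simp
  have len: "length ps = 2" if "\<not> 2 < length ps" "C ! i = Conj ps \<or> C ! i = Disj ps" for ps
    using that preds_length[OF Suc.prems(1), of ps] by linarith
  show ?case
  proof (cases "C ! i")
    case Input
    then show ?thesis using Suc.prems by simp
  next
    case (Neg p)
    then show ?thesis using Suc.prems IH[of p "\<not> b"] by (auto simp: gval_gate[of i])
  next
    case g: (Conj ps)
    have ev: "gval C X i \<longleftrightarrow> (\<forall>p\<in>set ps. gval C X p)" using gval_gate[OF Suc.prems(1)] g by simp
    have p: "preds (C ! i) = ps" using g by simp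
    show ?thesis
    proof (cases "2 < length ps")
      case True
      show ?thesis
      proof (cases b)
        case b: True
        have "dnf (Suc j) C i b = [map (\<lambda>p. (p, b)) ps]" using True b g at by simp
        then show ?thesis using big_all[where b = b and ps = ps] ev b by simp
      next
        case b: False
        have "dnf (Suc j) C i b = map (\<lambda>p. [(p, b)]) ps" using True b g at by simp
        then show ?thesis using big_any[where b = b and ps = ps] ev b by simp
      qed
    next
      case False
      show ?thesis
      proof (cases b)
        case b: True
        have "dnf (Suc j) C i b = concat (map (\<lambda>u. map (\<lambda>v. u @ v) (dnf j C (nth_or 0 ps 1) b))
          (dnf j C (nth_or 0 ps 0) b))" using False b g at by simp
        then show ?thesis using all[OF p len[OF False], of b] ev b g by (simp only: refl simp_thms)
      next
        case b: False
        have "dnf (Suc j) C i b = concat (map (\<lambda>p. dnf j C p b) ps)" using False b g at by simp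
        then show ?thesis using any[OF p, of b] ev b by (simp only: refl simp_thms) blast
      qed
    qed
  next
    case g: (Disj ps)
    have ev: "gval C X i \<longleftrightarrow> (\<exists>p\<in>set ps. gval C X p)" using gval_gate[OF Suc.prems(1)] g by simp
    have p: "preds (C ! i) = ps" using g by simp
    show ?thesis
    proof (cases "2 < length ps")
      case True
      show ?thesis
      proof (cases b)
        case b: False
        have "dnf (Suc j) C i b = [map (\<lambda>p. (p, b)) ps]" using True b g at by simp
        then show ?thesis using big_all[where b = b and ps = ps] ev b by simp
      next
        case b: True
        have "dnf (Suc j) C i b = map (\<lambda>p. [(p, b)]) ps" using True b g at by simp
        then show ?thesis using big_any[where b = b and ps = ps] ev b by simp
      qed
    next
      case False
      show ?thesis
      proof (cases b)
        case b: False
        have "dnf (Suc j) C i b = concat (map (\<lambda>u. map (\<lambda>v. u @ v) (dnf j C (nth_or 0 ps 1) b))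
          (dnf j C (nth_or 0 ps 0) b))" using False b g at by simp
        then show ?thesis using all[OF p len[OF False], of b] ev b g by (simp only: refl simp_thms) blast
      next
        case b: True
        have "dnf (Suc j) C i b = concat (map (\<lambda>p. dnf j C p b) ps)" using False b g at by simp
        then show ?thesis using any[OF p, of b] ev b by (simp only: refl simp_thms)
      qed
    qed
  qed
qed simp

text \<open>Expansion ends at inputs or at the predecessors of a large gate. That gate uses up the
  weft of 1, so its predecessors have weft 0.\<close>

lemma dnf_constraints:
  "i < length C \<Longrightarrow> gdepth C i \<le> j \<Longrightarrow> gweft C i \<le> 1 \<Longrightarrow> w \<in> set (dnf j C i b) \<Longrightarrow> c \<in> set w \<Longrightarrow>
    fst c < length C \<and> gdepth C (fst c) \<le> j \<and> gweft C (fst c) = 0"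
proof (induction j arbitrary: i b w)
  case 0
  then show ?case using gdepth_le_0[of i] gweft_gate[of i] by simp
next
  case (Suc j)
  let ?ps = "preds (C ! i)"
  let ?good = "\<lambda>c. fst c < length C \<and> gdepth C (fst c) \<le> Suc j \<and> gweft C (fst c) = 0"
  note i = Suc.prems(1)
  have "\<forall>p\<in>set ?ps. gdepth C p \<le> j" using Suc.prems(2) gdepth_le_Suc[OF i] by simp
  moreover have "\<forall>p\<in>set ?ps. (if 2 < length ?ps then 1 else 0) + gweft C p \<le> 1"
    using Suc.prems(3) gweft_le[OF i, of 1] by (cases "C ! i = Input") simp_all
  ultimately have p: "p < length C" "gdepth C p \<le> j" "(if 2 < length ?ps then 1 else 0) + gweft C p \<le> 1"
    if "p \<in> set ?ps" for p
    using that preds_less_length[OF i that] by blast+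
  have IH: "?good c" if "p \<in> set ?ps" "w \<in> set (dnf j C p b)" "c \<in> set w" for p b w
  proof -
    have "gweft C p \<le> 1" using p(3)[OF that(1)] by linarith
    from Suc.IH[OF p(1,2)[OF that(1)] this that(2,3)] show ?thesis by simp
  qed
  have big: "?good (p, b)" if "2 < length ?ps" "p \<in> set ?ps" for p b
    using p[OF that(2)] that(1) by simp
  show ?case
  proof (cases "C ! i = Input")
    case True
    then show ?thesis using Suc.prems gweft_gate[OF i] gdepth_gate[OF i] by simp
  next
    case False
    have at: "gate_at C i = C ! i" using i by simp
    show ?thesis
    proof (cases "2 < length ?ps")
      case True
      then have "tag (C ! i) \<noteq> 1" using tag_1_preds[of "C ! i"] by linarith
      then have "dnf (Suc j) C i b = (if (tag (C ! i) = 2) = b then [map (\<lambda>p. (p, b)) ?ps]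
          else map (\<lambda>p. [(p, b)]) ?ps)"
        using True False at by simp
      then have "w = map (\<lambda>p. (p, b)) ?ps \<or> (\<exists>p\<in>set ?ps. w = [(p, b)])"
        using Suc.prems(4) by (simp only: split: if_splits) auto
      then obtain p where p: "p \<in> set ?ps" "c = (p, b)" using Suc.prems(5) by auto
      show ?thesis unfolding p(2) by (rule big[OF True p(1)])
    next
      case small: False
      have "\<exists>p\<in>set ?ps. \<exists>b'. \<exists>w\<in>set (dnf j C p b'). c \<in> set w"
      proof (cases "tag (C ! i) = 1")
        case True
        then have "dnf (Suc j) C i b = concat (map (\<lambda>p. dnf j C p (\<not> b)) ?ps)" using False at by simp
        then show ?thesis using Suc.prems(4,5) by (simp only: set_concat set_map) blast
      next
        case no1: False
        have two: "nth_or 0 ?ps 0 \<in> set ?ps" "nth_or 0 ?ps 1 \<in> set ?ps"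
        proof -
          have "2 \<le> length ?ps" using no1 False preds_length[OF i] by (cases "C ! i") simp_all
          then have "0 < length ?ps" "1 < length ?ps" by linarith+
          then show "nth_or 0 ?ps 0 \<in> set ?ps" "nth_or 0 ?ps 1 \<in> set ?ps" by (simp_all add: nth_or)
        qed
        show ?thesis
        proof (cases "(tag (C ! i) = 2) = b")
          case True
          then have "dnf (Suc j) C i b = concat (map (\<lambda>u. map (\<lambda>v. u @ v) (dnf j C (nth_or 0 ?ps 1) b))
              (dnf j C (nth_or 0 ?ps 0) b))"
            using False no1 small at by simp
          then obtain u v where "u \<in> set (dnf j C (nth_or 0 ?ps 0) b)" "v \<in> set (dnf j C (nth_or 0 ?ps 1) b)"
            "w = u @ v"
            using Suc.prems(4) by (auto simp del: dnf.simps)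
          then show ?thesis using two Suc.prems(5) by (simp only: set_append) blast
        next
          case no: False
          then have "dnf (Suc j) C i b = concat (map (\<lambda>p. dnf j C p b) ?ps)" using False no1 small at by simp
          then show ?thesis using Suc.prems(4,5) by (simp only: set_concat set_map) blast
        qed
      qed
      then obtain p b' w' where "p \<in> set ?ps" "w' \<in> set (dnf j C p b')" "c \<in> set w'" by blast
      then show ?thesis by (rule IH)
    qed
  qed
qed

section \<open>The number of violated constraints as a function of low degree\<close>

definition gviol :: "(nat \<times> bool) list \<Rightarrow> nat set \<Rightarrow> nat" where
  "gviol w Z = length (filter (\<lambda>c. gval C Z (fst c) \<noteq> snd c) w)"

lemma gviol_le: "gviol w Z \<le> length w"
  by (simp add: gviol_def)

lemma viol_eq:
  assumes "\<And>c. c \<in> set w \<Longrightarrow> fst c < length C \<and> gdepth C (fst c) \<le> d"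
  shows "viol d C w Z = gviol w (set Z)"
  unfolding viol_def gviol_def using assms by (intro arg_cong[of _ _ length] filter_cong) (auto simp: val_eq)

text \<open>Each constraint depends on at most \<open>2 ^ d\<close> inputs by
  \<open>gval_junta\<close>, so its indicator has no coefficient of higher order; the transform is
  additive over the constraints.\<close>

lemma mob_gviol:
  assumes w: "\<And>c. c \<in> set w \<Longrightarrow> fst c < length C \<and> gdepth C (fst c) \<le> d \<and> gweft C (fst c) = 0"
    and Y: "finite Y" "2 ^ d < card Y"
  shows "mob (\<lambda>Z. int (gviol w Z)) Y = 0"
  using w
proof (induction w)
  case Nil
  then show ?case by (simp add: gviol_def mob_def)
next
  case (Cons c w)
  let ?H = "\<lambda>Z. of_bool (gval C Z (fst c) \<noteq> snd c) :: int"
  have "fst c < length C" "gdepth C (fst c) \<le> d" "gweft C (fst c) = 0" using Cons.prems[of c] by auto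
  then obtain A where A: "finite A" "card A \<le> 2 ^ d" "\<And>X. gval C X (fst c) = gval C (X \<inter> A) (fst c)"
    using gval_junta by blast
  have "mob ?H Y = 0"
  proof (rule mob_junta[OF _ Y(1)])
    show "?H Z = ?H (Z \<inter> A)" for Z using A(3)[of Z] by simp
    show "\<not> Y \<subseteq> A" using card_mono[OF A(1), of Y] A(2) Y(2) by linarith
  qed
  moreover have "mob (\<lambda>Z. int (gviol w Z)) Y = 0" using Cons.prems by (intro Cons.IH) auto
  moreover have "(\<lambda>Z. int (gviol (c # w) Z)) = (\<lambda>Z. ?H Z + int (gviol w Z))"
    by (auto simp: gviol_def fun_eq_iff)
  ultimately show ?case by (simp add: mob_add)
qed

end

section \<open>The reduction on circuits\<close>

text \<open>The function passed to \<open>weight\<close> is \<open>pot\<close> transcribed to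
  lists.\<close>

definition circuit_weight :: "nat \<Rightarrow> circuit \<Rightarrow> nat \<Rightarrow> nat \<Rightarrow> (nat \<times> bool) list \<Rightarrow> nat list \<Rightarrow> nat" where
  "circuit_weight d C k B w Y =
     weight B (2 ^ d) (\<lambda>Z. k * viol d C w Z + length Z * viol d C w []) Y"

text \<open>With \<open>L = length (concat ws)\<close> bounding the violations, the first product
  bounds every coefficient of \<open>pot\<close>, so that no gadget size is truncated;
  \<open>k * k * L\<close> is what deletions outside a full block can win back, and the final 1
  makes this strict.\<close>

definition base_weight :: "nat \<Rightarrow> nat \<Rightarrow> (nat \<times> bool) list list \<Rightarrow> nat" where
  "base_weight d k ws = (2 ^ 2 ^ d * (k + 2 ^ d) + k * k) * length (concat ws) + 1"

definition circuit_labels :: "nat \<Rightarrow> circuit \<Rightarrow> nat \<Rightarrow> label list" where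
  "circuit_labels d C k =
     graph_labels (length (dnf d C (length C - 1) True)) (inputs C) (2 ^ d)
       (\<lambda>i. circuit_weight d C k (base_weight d k (dnf d C (length C - 1) True))
         (nth_or [] (dnf d C (length C - 1) True) i))
       k (base_weight d k (dnf d C (length C - 1) True) * length (subsets_upto (2 ^ d) [0..<k]))"

lemma ptime_circuit_labels:
  assumes "ptime C" "ptime k" shows "ptime (\<lambda>x. circuit_labels d (C x) (k x))"
proof -
  have base: "ptime (\<lambda>x. base_weight d (k x) (ws x))" if "ptime k" "ptime ws"
    for k :: "'x::codable \<Rightarrow> nat" and ws
    unfolding base_weight_def by (intro ptime_intros that)
  have weight: "ptime (\<lambda>x. circuit_weight d (C x) (k x) (B x) (w x) (Y x))"
    if "ptime C" "ptime k" "ptime B" "ptime w" "ptime Y" for C :: "'x::codable \<Rightarrow> circuit" and k B w Y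
    unfolding circuit_weight_def weight_def
    by (intro ptime_intros ptime_subsets_upto ptime_viol that[THEN ptime_comp] that)
  have "ptime (\<lambda>p. circuit_labels d (fst p) (snd p))"
    unfolding circuit_labels_def
    by (intro ptime_graph_labels weight base ptime_gate_intros ptime_dnf ptime_inputs ptime_subsets_upto)
  then show ?thesis by (rule ptime_comp2) fact+
qed

lemma set_inputs: "set (inputs C) = {i. i < length C \<and> C ! i = Input}"
  by (auto simp: inputs_def)

theorem circuit_labels_correct:
  assumes C: "circuit C" "weft C \<le> 1" "depth C \<le> d" and d: "1 \<le> d" and k: "1 \<le> k"
  shows "(\<exists>S. balanced_separator (label_graph (circuit_labels d C k)) S \<and> card S \<le> k) \<longleftrightarrow>
      has_weighted_solution C k" (is ?iff)
    and "max_components (label_graph (circuit_labels d C k)) k \<le> 2 + length (subsets_upto (2 ^ d) [0..<k])" (is ?le)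
proof -
  define ws where "ws = dnf d C (length C - 1) True"
  define out where "out = length C - 1"
  define L where "L = length (concat ws)"
  define B where "B = base_weight d k ws"
  let ?q = "2 ^ d :: nat"
  let ?v = "\<lambda>i. gviol C (ws ! i)"
  have out: "out < length C" "gdepth C out \<le> d" "gweft C out \<le> 1"
    using output_gate[OF C(1)] C(2,3) by (simp_all add: out_def)
  have ok: "fst c < length C \<and> gdepth C (fst c) \<le> d \<and> gweft C (fst c) = 0"
    if "w \<in> set ws" "c \<in> set w" for w c
    using dnf_constraints[OF C(1) out] that unfolding ws_def out_def by blast
  have vL: "?v i Z \<le> L" if i: "i < length ws" for i Z
  proof -
    have "length (ws ! i) \<le> L" unfolding L_def length_concat
      using i by (intro member_le_sum_list) auto
    with gviol_le[OF C(1)] show ?thesis by (meson le_trans)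
  qed
  \<comment> \<open>\<open>1 \<le> d\<close> enters here: pairs of items with different indices have
    to count as small subsets.\<close>
  have q: "2 \<le> ?q" using power_increasing[of 1 d "2 :: nat"] d by simp
  interpret bisection_instance "length ws" ?q k B L ?v "inputs C" "\<lambda>i. circuit_weight d C k B (nth_or [] ws i)"
  proof
    show "1 \<le> k" by (rule k)
    show "2 \<le> ?q" by (rule q)
    show "k * k * L < B" by (simp add: B_def base_weight_def L_def algebra_simps)
    show "?v i Z \<le> L" if "i < length ws" for i Z using that by (rule vL)
    show "mob (\<lambda>Z. int (?v i Z)) Y = 0" if "i < length ws" "finite Y" "?q < card Y" for i Y
      using that(2,3) ok[OF nth_mem[OF that(1)]] by (intro mob_gviol[OF C(1), of _ d])
    show "distinct (inputs C)" by (simp add: inputs_def)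
    show "int (circuit_weight d C k B (nth_or [] ws i) Y) = int B - mob (pot k (?v i)) (set Y)"
      if i: "i < length ws" and Y: "Y \<in> set (subsets_upto ?q (inputs C))" for i Y
    proof -
      have Y': "sorted_wrt (<) Y" "length Y \<le> ?q" using Y by (auto simp: set_subsets_upto)
      have w: "nth_or [] ws i = ws ! i" using i by (simp add: nth_or)
      have viol: "viol d C (ws ! i) Z = ?v i (set Z)" for Z
        using ok[OF nth_mem[OF i]] by (intro viol_eq[OF C(1)]) blast
      show ?thesis
        unfolding circuit_weight_def w
      proof (rule weight_eq[OF Y'])
        show "int (k * viol d C (ws ! i) Z + length Z * viol d C (ws ! i) []) = pot k (?v i) (set Z)"
          if "sorted_wrt (<) Z" for Z
          using that by (simp add: pot_def viol sorted_card)
        have "\<bar>mob (pot k (?v i)) (set Y)\<bar> \<le> int (2 ^ card (set Y) * ((k + ?q) * L))"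
        proof (rule mob_le)
          fix Z assume Z: "Z \<subseteq> set Y"
          have "card Z \<le> ?q" using card_mono[OF _ Z] Y' sorted_card by force
          then have "k * ?v i Z + card Z * ?v i {} \<le> k * L + ?q * L"
            by (intro add_mono mult_le_mono vL i order_refl)
          then show "\<bar>pot k (?v i) Z\<bar> \<le> int ((k + ?q) * L)"
            unfolding pot_def distrib_right by (simp only: abs_of_nat of_nat_le_iff)
        qed simp
        moreover have "2 ^ card (set Y) * ((k + ?q) * L) \<le> 2 ^ ?q * ((k + ?q) * L)"
          using Y' by (intro mult_right_mono power_increasing) (auto simp: sorted_card)
        moreover have "2 ^ ?q * ((k + ?q) * L) \<le> B" by (simp add: B_def base_weight_def L_def algebra_simps)
        ultimately show "mob (pot k (?v i)) (set Y) \<le> int B" by linarith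
      qed
    qed
  qed
  have labels: "circuit_labels d C k = ls"
    by (simp add: circuit_labels_def ws_def B_def)
  show ?le unfolding labels by (rule label_graph_max_components)
  have "(\<exists>S. balanced_separator (label_graph (circuit_labels d C k)) S \<and> card S \<le> k) \<longleftrightarrow>
      (\<exists>i X. i < length ws \<and> X \<subseteq> set (inputs C) \<and> card X = k \<and> ?v i X = 0)"
    unfolding labels by (rule label_graph_bisection_iff)
  also have "\<dots> \<longleftrightarrow> (\<exists>X. X \<subseteq> set (inputs C) \<and> card X = k \<and>
      (\<exists>w\<in>set ws. \<forall>c\<in>set w. gval C X (fst c) = snd c))"
  proof -
    have "?v i X = 0 \<longleftrightarrow> (\<forall>c\<in>set (ws ! i). gval C X (fst c) = snd c)" for i X
      by (simp add: gviol_def[OF C(1)] filter_empty_conv)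
    then show ?thesis by (simp only: set_conv_nth[of ws] bex_simps) (auto simp: in_set_conv_nth)
  qed
  also have "\<dots> \<longleftrightarrow> (\<exists>X. X \<subseteq> set (inputs C) \<and> card X = k \<and> gval C X out)"
    using dnf_correct[OF C(1) out(1,2), where b = True] unfolding ws_def out_def by simp
  also have "\<dots> \<longleftrightarrow> has_weighted_solution C k"
    unfolding has_weighted_solution_def set_inputs output_gate(1)[OF C(1)] out_def ..
  finally show ?iff .
qed

section \<open>Reading circuits\<close>

lemma ptime_nats_string: assumes "ptime l" shows "ptime (\<lambda>x. nats_string (l x))"
  unfolding nats_string_def by (intro ptime_intros assms)

lemma gate_nats_eq:
  "gate_nats g = (if tag g = 0 then [0] else if tag g = 1 then 1 # preds g
    else tag g # length (preds g) # preds g)"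
  by (cases g) auto

lemma ptime_circuit_string:
  assumes "ptime C" "ptime k" shows "ptime (\<lambda>x. circuit_string (C x, k x))"
  unfolding circuit_string_def prod.case gate_nats_eq
  by (intro ptime_nats_string ptime_gate_intros assms)

lemma ptime_graph_string:
  assumes "ptime n" "ptime es" "ptime k" shows "ptime (\<lambda>x. graph_string (n x, es x, k x))"
proof -
  have *: "(\<lambda>(u, v). [u, v]) = (\<lambda>e. [fst e, snd e])" for e :: "nat \<times> nat" by auto
  show ?thesis unfolding graph_string_def prod.case *
    by (intro ptime_nats_string ptime_intros assms)
qed

definition decode_nats :: "bool list \<Rightarrow> nat list" where
  "decode_nats w =
     rev (snd (foldl (\<lambda>a b. if b then (Suc (fst a), snd a) else (0, fst a # snd a)) (0, []) w))"

lemma decode_nats_string: "decode_nats (nats_string ns) = ns"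
proof -
  let ?f = "\<lambda>a b. if b then (Suc (fst a), snd a) else (0 :: nat, fst a # snd a)"
  have "foldl ?f (m, acc) (replicate n True) = (m + n, acc)" for m n acc
    by (induction n arbitrary: m) auto
  then have "foldl ?f (0, acc) (nats_string ns) = (0, rev ns @ acc)" for acc
    by (induction ns arbitrary: acc) (auto simp: nats_string_def)
  then show ?thesis by (simp add: decode_nats_def)
qed

lemma ptime_decode_nats: assumes "ptime w" shows "ptime (\<lambda>x. decode_nats (w x))"
proof -
  let ?f = "\<lambda>a b. if b then (Suc (fst a), snd a) else (0 :: nat, fst a # snd a)"
  have sz: "sz (foldl ?f a w) \<le> sz a + length w" for a w
  proof (induction w arbitrary: a)
    case (Cons b w)
    have "sz (?f a b) \<le> Suc (sz a)" by simp
    with Cons[of "?f a b"] show ?case unfolding foldl_Cons length_Cons by linarith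
  qed simp
  have "ptime (\<lambda>w. foldl ?f (0, []) w)"
  proof (rule ptime_foldl[where b = "\<lambda>w. Suc (sz w)"])
    show "polyb (\<lambda>w :: bool list. Suc (sz w))" by (intro polyb_intros)
    show "sz (foldl ?f (0, []) (take n w)) \<le> Suc (sz w)" for n and w :: "bool list"
      using sz[of "(0, [])" "take n w"] length_le_sz[of w] by simp
  qed (intro ptime_intros)+
  then have "ptime decode_nats" unfolding decode_nats_def by (intro ptime_intros)
  then show ?thesis using assms by (rule ptime_comp)
qed

text \<open>Total on arbitrary lists. Whatever it makes of malformed input is rejected by the
  comparison in \<open>reduce_string\<close>.\<close>

definition decode_gate :: "nat list \<times> gate list \<Rightarrow> nat list \<times> gate list" where
  "decode_gate s =
     (if fst s = [] then s
      else if hd_or 0 (fst s) = 0 then (tl (fst s), Input # snd s)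
      else if hd_or 0 (fst s) = 1 then (drop 2 (fst s), Neg (nth_or 0 (fst s) 1) # snd s)
      else if hd_or 0 (fst s) = 2 then (drop (nth_or 0 (fst s) 1) (drop 2 (fst s)),
        Conj (take (nth_or 0 (fst s) 1) (drop 2 (fst s))) # snd s)
      else (drop (nth_or 0 (fst s) 1) (drop 2 (fst s)),
        Disj (take (nth_or 0 (fst s) 1) (drop 2 (fst s))) # snd s))"

lemma decode_gate_gate_nats: "decode_gate (gate_nats g @ ns, gs) = (ns, g # gs)"
  by (cases g) (auto simp: decode_gate_def hd_or_def nth_or)

text \<open>A step only moves numbers from the list into the gate that it builds, so the size grows
  by a constant, and iteration stays within a linear bound.\<close>

lemma sz_decode_gate: "sz (decode_gate s) \<le> sz s + 6"
proof (cases "fst s")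
  case Nil
  then show ?thesis by (simp add: decode_gate_def)
next
  case (Cons t ns)
  then obtain gs where s: "s = (t # ns, gs)" by (cases s) auto
  have tl: "sz (tl ns) + nth_or 0 (t # ns) 1 \<le> sz ns"
    by (cases ns) (auto simp: nth_or)
  have split: "sz (take m xs) + sz (drop m xs) = sz xs" for m and xs :: "nat list"
    by (metis append_take_drop_id sz_append)
  have d2: "drop 2 (t # ns) = tl ns" by (simp add: drop_Suc numeral_2_eq_2)
  show ?thesis
    using tl split[of "nth_or 0 (t # ns) 1" "tl ns"] unfolding decode_gate_def s fst_conv snd_conv d2
    by (auto simp: hd_or_def code_gate_def numeral_2_eq_2 numeral_3_eq_3)
qed

text \<open>Every gate takes up at least one number, so \<open>length ns\<close> rounds suffice;
  surplus rounds leave an empty list as it is.\<close>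

definition decode_gates :: "nat list \<Rightarrow> circuit" where
  "decode_gates ns = rev (snd ((decode_gate ^^ length ns) (ns, [])))"

lemma decode_gates: "decode_gates (concat (map gate_nats C)) = C"
proof -
  have Nil: "(decode_gate ^^ n) ([], gs) = ([], gs)" for n gs
    by (induction n) (auto simp: decode_gate_def)
  have "(decode_gate ^^ (length C + n)) (concat (map gate_nats C), gs) = ([], rev C @ gs)" for n gs
    by (induction C arbitrary: gs) (auto simp: funpow_swap1 decode_gate_gate_nats Nil)
  moreover have "length C \<le> length (concat (map gate_nats C))"
  proof (induction C)
    case (Cons g C)
    then show ?case by (cases g) auto
  qed simp
  ultimately show ?thesis unfolding decode_gates_def
    by (metis append_Nil2 le_add_diff_inverse rev_rev_ident snd_conv)
qed

lemma ptime_decode_gates: assumes "ptime l" shows "ptime (\<lambda>x. decode_gates (l x))"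
proof -
  have "ptime (\<lambda>ns. (decode_gate ^^ length ns) (ns, []))"
  proof (rule ptime_funpow[where b = "\<lambda>ns. sz (ns, [] :: gate list) + 6 * sz ns"])
    show "ptime (\<lambda>p. decode_gate (snd p))"
      unfolding decode_gate_def by (intro ptime_gate_intros)
    show "polyb (\<lambda>ns :: nat list. sz (ns, [] :: gate list) + 6 * sz ns)"
      by (simp, intro polyb_intros)
    have "sz ((decode_gate ^^ i) s) \<le> sz s + 6 * i" for i s
    proof (induction i)
      case (Suc i)
      then show ?case using sz_decode_gate[of "(decode_gate ^^ i) s"] by simp
    qed simp
    note this[of i "(ns, [])" for i ns]
    moreover have "6 * i \<le> 6 * sz ns" if "i \<le> length ns" for i and ns :: "nat list"
      using that length_le_sz[of ns] by simp
    ultimately show "sz ((decode_gate ^^ i) (ns, [])) \<le> sz (ns, [] :: gate list) + 6 * sz ns"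
      if "i \<le> length ns" for i ns
      using that by (meson add_left_mono le_trans)
  qed (intro ptime_intros)+
  then have "ptime decode_gates" unfolding decode_gates_def by (intro ptime_intros)
  then show ?thesis using assms by (rule ptime_comp)
qed

definition valid_circuit :: "nat \<Rightarrow> circuit \<Rightarrow> bool" where
  "valid_circuit d C \<longleftrightarrow> \<not> C = [] \<and>
     (\<forall>i\<in>set [0..<length C]. (\<forall>p\<in>set (preds (gate_at C i)). p < i) \<and>
        (2 \<le> tag (gate_at C i) \<longrightarrow> 2 \<le> length (preds (gate_at C i)) \<and>
          (\<forall>j\<in>set [0..<length (preds (gate_at C i))].
            \<not> nth_or 0 (preds (gate_at C i)) j \<in> set (take j (preds (gate_at C i)))))) \<and>
     weft_1 d C (length C - 1) \<and> depth_le d C (length C - 1)"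

text \<open>Puts distinctness into a form made of operations already shown to be
  polynomial-time.\<close>

lemma distinct_take: "distinct xs \<longleftrightarrow> (\<forall>j\<in>set [0..<length xs]. \<not> nth_or 0 xs j \<in> set (take j xs))"
proof (induction xs rule: rev_induct)
  case (snoc x xs)
  have "(\<forall>j\<in>set [0..<length (xs @ [x])]. \<not> nth_or 0 (xs @ [x]) j \<in> set (take j (xs @ [x]))) \<longleftrightarrow>
    x \<notin> set xs \<and> (\<forall>j\<in>set [0..<length xs]. \<not> nth_or 0 xs j \<in> set (take j xs))"
    by (auto simp: nth_or nth_append)
  then show ?case using snoc by auto
qed simp

text \<open>The recursive weft test agrees with \<open>weft\<close> only under the depth bound,
  which \<open>valid_circuit\<close> tests along with it.\<close>

lemma valid_circuit_iff: "valid_circuit d C \<longleftrightarrow> circuit C \<and> weft C \<le> 1 \<and> depth C \<le> d"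
proof -
  have tag2: "2 \<le> tag g \<longleftrightarrow> (\<exists>ps. g = Conj ps \<or> g = Disj ps)" for g by (cases g) auto
  have gates: "circuit C \<longleftrightarrow> \<not> C = [] \<and>
     (\<forall>i\<in>set [0..<length C]. (\<forall>p\<in>set (preds (gate_at C i)). p < i) \<and>
        (2 \<le> tag (gate_at C i) \<longrightarrow> 2 \<le> length (preds (gate_at C i)) \<and>
          (\<forall>j\<in>set [0..<length (preds (gate_at C i))].
            \<not> nth_or 0 (preds (gate_at C i)) j \<in> set (take j (preds (gate_at C i))))))"
    unfolding circuit_def distinct_take[symmetric] tag2 by auto
  show ?thesis
    unfolding valid_circuit_def conj_assoc[symmetric] gates[unfolded conj_assoc[symmetric], symmetric]
    using output_gate weft_1_iff[of C "length C - 1" d] depth_le_iff[of C "length C - 1" d]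
    by auto
qed

lemma ptime_valid_circuit: assumes "ptime C" shows "ptime (\<lambda>x. valid_circuit d (C x))"
proof -
  have "ptime (valid_circuit d)" unfolding valid_circuit_def
    by (intro ptime_gate_intros ptime_weft_1 ptime_depth_le ptime_diff)
  then show ?thesis using assms by (rule ptime_comp)
qed

section \<open>The reduction on strings\<close>

text \<open>Vertex bisection requires a positive bound, so weight 0 is decided outright by
  evaluating the circuit on the empty assignment. The empty graph with bound 1 is a yes-instance,
  and \<open>[]\<close> encodes no graph.\<close>

definition reduce_circuit :: "nat \<Rightarrow> circuit \<Rightarrow> nat \<Rightarrow> bool list" where
  "reduce_circuit d C k =
     (if k = 0 then if val d C [] (length C - 1) then graph_string (0, [], 1) else []
      else graph_string (length (circuit_labels d C k), label_edges (circuit_labels d C k), k))"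

definition decode_circuit :: "bool list \<Rightarrow> circuit" where
  "decode_circuit w = decode_gates (tl (decode_nats w))"

definition decode_weight :: "bool list \<Rightarrow> nat" where
  "decode_weight w = hd_or 0 (decode_nats w)"

text \<open>Encoding the decoded circuit again decides whether \<open>w\<close> is an encoding at
  all.\<close>

definition reduce_string :: "nat \<Rightarrow> bool list \<Rightarrow> bool list" where
  "reduce_string d w =
     (if circuit_string (decode_circuit w, decode_weight w) = w \<and> valid_circuit d (decode_circuit w)
      then reduce_circuit d (decode_circuit w) (decode_weight w) else [])"

lemma decode_circuit_string:
  "decode_circuit (circuit_string (C, k)) = C" "decode_weight (circuit_string (C, k)) = k"
  by (simp_all add: decode_circuit_def decode_weight_def circuit_string_def decode_nats_string
      decode_gates hd_or_def)

lemma reduce_string_cases: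
  obtains C k where "w = circuit_string (C, k)" "circuit C" "weft C \<le> 1" "depth C \<le> d"
      "reduce_string d w = reduce_circuit d C k"
  | "w \<notin> circuit_string ` {(C, k). circuit C \<and> weft C \<le> 1 \<and> depth C \<le> d}" "reduce_string d w = []"
proof (cases "circuit_string (decode_circuit w, decode_weight w) = w \<and> valid_circuit d (decode_circuit w)")
  case True
  then show thesis by (intro that(1)[of "decode_circuit w" "decode_weight w"])
      (auto simp: valid_circuit_iff reduce_string_def)
next
  case False
  then have "w \<notin> circuit_string ` {(C, k). circuit C \<and> weft C \<le> 1 \<and> depth C \<le> d}"
    by (auto simp: valid_circuit_iff decode_circuit_string)
  with False show thesis by (intro that(2)) (auto simp: reduce_string_def)
qed

lemma ptime_reduce_string: "ptime (reduce_string d)"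
proof -
  have C: "ptime decode_circuit" unfolding decode_circuit_def
    by (intro ptime_decode_gates ptime_decode_nats ptime_intros)
  have k: "ptime decode_weight" unfolding decode_weight_def
    by (intro ptime_decode_nats ptime_intros)
  show ?thesis unfolding reduce_string_def reduce_circuit_def
    by (intro ptime_intros ptime_circuit_string ptime_valid_circuit ptime_graph_string ptime_label_edges
        ptime_circuit_labels ptime_val C k)
qed

definition parameter_bound :: "nat \<Rightarrow> nat \<Rightarrow> nat" where
  "parameter_bound d k = k + (2 + length (subsets_upto (2 ^ d) [0..<k]))"

lemma ptime_parameter_bound: "ptime (parameter_bound d)"
  unfolding parameter_bound_def by (intro ptime_intros ptime_subsets_upto)

text \<open>Needed because the given reduction only bounds the parameter of the circuit instance
  from above.\<close>

lemma parameter_bound_mono: "k \<le> k' \<Longrightarrow> parameter_bound d k \<le> parameter_bound d k'"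
  unfolding parameter_bound_def
  by (simp add: length_subsets_upto) (intro add_mono card_mono finite_sub_q sub_q_mono; auto)

lemma encoded_problem_mem:
  assumes "inj enc" "x \<in> I"
  shows "enc x \<in> fst (encoded_problem enc I yes par) \<longleftrightarrow> yes x"
    "snd (encoded_problem enc I yes par) (enc x) = par x"
  using assms by (auto simp: encoded_problem_def inj_eq inv_into_f_f inj_on_subset[OF _ subset_UNIV])

lemma encoded_problem_not_mem:
  assumes "w \<notin> enc ` I"
  shows "w \<notin> fst (encoded_problem enc I yes par)" "snd (encoded_problem enc I yes par) w = 0"
  using assms by (auto simp: encoded_problem_def)

lemma empty_not_graph_string: "[] \<notin> graph_string ` I"
  by (auto simp: graph_string_def nats_string_def)

abbreviation (input) "bisection_problem \<equiv> vertex_bisection (\<lambda>G k. k + max_components G k)"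

lemma reduce_string_correct:
  assumes d: "1 \<le> d"
  shows "w \<in> fst (WCS 1 d) \<longleftrightarrow> reduce_string d w \<in> fst bisection_problem"
    and "snd bisection_problem (reduce_string d w) \<le> parameter_bound d (snd (WCS 1 d) w)"
proof -
  let ?I = "{(C, k). circuit C \<and> weft C \<le> 1 \<and> depth C \<le> d}"
  let ?J = "{(n, es, k). simple_graph (graph_of n es) \<and> 1 \<le> k}"
  have VB_mem: "graph_string (n, es, k) \<in> fst bisection_problem \<longleftrightarrow>
      (\<exists>S. balanced_separator (graph_of n es) S \<and> card S \<le> k)"
    "snd bisection_problem (graph_string (n, es, k)) = k + max_components (graph_of n es) k"
    if "simple_graph (graph_of n es)" "1 \<le> k" for n es k
    unfolding vertex_bisection_def
    using encoded_problem_mem[OF inj_graph_string, of "(n, es, k)" ?J] that by simp_all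
  have VB_empty: "[] \<notin> fst bisection_problem" "snd bisection_problem [] = 0"
    unfolding vertex_bisection_def by (intro encoded_problem_not_mem empty_not_graph_string)+
  have "(w \<in> fst (WCS 1 d) \<longleftrightarrow> reduce_string d w \<in> fst bisection_problem) \<and>
    snd bisection_problem (reduce_string d w) \<le> parameter_bound d (snd (WCS 1 d) w)"
  proof (cases rule: reduce_string_cases[of w d])
    case (1 C k)
    have WCS: "w \<in> fst (WCS 1 d) \<longleftrightarrow> has_weighted_solution C k" "snd (WCS 1 d) w = k"
      using encoded_problem_mem[OF inj_circuit_string, of "(C, k)" ?I] 1(1-4) by (simp_all add: WCS_def)
    show ?thesis
    proof (cases "k = 0")
      case True
      have out: "length C - 1 < length C" "gdepth C (length C - 1) \<le> d"
        using output_gate[OF 1(2)] 1(4) by simp_all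
      have sol: "has_weighted_solution C k \<longleftrightarrow> val d C [] (length C - 1)"
      proof -
        have "X = {}" if "X \<subseteq> {i. i < length C \<and> C ! i = Input}" "card X = 0" for X
          using that finite_subset[OF that(1)] by simp
        then have "has_weighted_solution C k \<longleftrightarrow> satisfies {} C"
          unfolding has_weighted_solution_def True by (metis card.empty empty_subsetI)
        then show ?thesis using output_gate(1)[OF 1(2)] val_eq[OF 1(2) out] by simp
      qed
      have simple: "simple_graph (graph_of 0 [])" by (simp add: graph_of_def)
      have "balanced_separator (graph_of 0 []) {}"
        unfolding balanced_separator_def by (auto simp: graph_of_def)
      then have yes: "graph_string (0, [], 1) \<in> fst bisection_problem" using VB_mem(1)[OF simple, of 1] by force
      \<comment> \<open>This trivial instance thus has parameter 1, which is below the summand 2 in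
        \<open>parameter_bound d 0\<close>.\<close>
      have "max_components (graph_of 0 []) 1 = 0"
        by (auto simp: max_components_def graph_of_def components_def quotient_def)
      then have "snd bisection_problem (graph_string (0, [], 1)) = 1" using VB_mem(2)[OF simple, of 1] by simp
      then show ?thesis
        using 1(5) True WCS sol yes VB_empty by (simp add: reduce_circuit_def parameter_bound_def)
    next
      case False
      let ?ls = "circuit_labels d C k"
      have graph: "graph_of (length ?ls) (label_edges ?ls) = label_graph ?ls" by (simp add: label_graph_def)
      have k: "1 \<le> k" using False by simp
      have simple: "simple_graph (graph_of (length ?ls) (label_edges ?ls))"
        unfolding graph by (rule simple_label_graph)
      have R: "reduce_string d w = graph_string (length ?ls, label_edges ?ls, k)"
        using 1(5) False by (simp add: reduce_circuit_def)
      show ?thesis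
        unfolding R VB_mem[OF simple k] graph WCS parameter_bound_def
        using circuit_labels_correct[OF 1(2-4) d k] by simp
    qed
  next
    case 2
    then show ?thesis using encoded_problem_not_mem[OF 2(1)] VB_empty by (simp add: WCS_def)
  qed
  then show "w \<in> fst (WCS 1 d) \<longleftrightarrow> reduce_string d w \<in> fst bisection_problem"
    "snd bisection_problem (reduce_string d w) \<le> parameter_bound d (snd (WCS 1 d) w)" by auto
qed

section \<open>Composition with an fpt reduction\<close>

text \<open>Height is used in place of size because one assignment of a pair of two copies doubles
  the size of a tree but raises its height by 1 only.\<close>

primrec height :: "tree \<Rightarrow> nat" where
  "height Atom = 0"
| "height (Pair a b) = Suc (max (height a) (height b))"

text \<open>Tests are not counted, since only assignments change the state.\<close>

primrec expr_size :: "com \<Rightarrow> nat" where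
  "expr_size (Assign x e) = size e"
| "expr_size (Seq c d) = max (expr_size c) (expr_size d)"
| "expr_size (Cond e c d) = max (expr_size c) (expr_size d)"
| "expr_size (While e c) = expr_size c"

lemma height_expr: "(\<And>i. height (s i) \<le> h) \<Longrightarrow> height (expr_val e s) \<le> h + size e"
proof (induction e)
  case (LeftE e)
  then show ?case by (cases "expr_val e s") auto
next
  case (RightE e)
  then show ?case by (cases "expr_val e s") auto
qed (auto intro: trans_le_add1)

lemma height_exec:
  "exec c s t s' \<Longrightarrow> (\<And>i. height (s i) \<le> h) \<Longrightarrow> expr_size c \<le> m \<Longrightarrow> height (s' i) \<le> h + t * m"
proof (induction arbitrary: h i rule: exec.induct)
  case (Assign x e s)
  then show ?case using height_expr[of s h e] by (auto intro: trans_le_add1 order_trans)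
next
  case (Seq c s t s' d u s'')
  have "height (s'' i) \<le> h + t * m + u * m" by (rule Seq.IH(2)) (use Seq in auto)
  then show ?case by (simp add: distrib_right)
next
  case (CondTrue e s c t s' d)
  have "height (s' i) \<le> h + t * m" by (rule CondTrue.IH) (use CondTrue in auto)
  then show ?case by simp
next
  case (CondFalse e s d t s' c)
  have "height (s' i) \<le> h + t * m" by (rule CondFalse.IH) (use CondFalse in auto)
  then show ?case by simp
next
  case (WhileFalse e s c)
  then show ?case by (simp add: trans_le_add1)
next
  case (WhileTrue e s c t s' u s'')
  have "height (s'' i) \<le> h + t * m + u * m" by (rule WhileTrue.IH(2)) (use WhileTrue in auto)
  then show ?case by (simp add: distrib_right)
qed

lemma height_string: "length w \<le> height (string_tree w)" "height (string_tree w) \<le> Suc (length w)"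
  by (induction w) (auto simp: bit_tree_def)

text \<open>Height grows by at most \<open>expr_size c\<close> per step, and a string is no longer
  than its tree is high. So the running time bounds the length of the output.\<close>

lemma halts_within_length:
  assumes "halts_within c (string_tree w) (string_tree u) T"
  shows "length u \<le> Suc (length w) + T * expr_size c"
proof -
  from assms obtain t s where s: "exec c ((\<lambda>_. Atom)(0 := string_tree w)) t s" "s 0 = string_tree u" "t \<le> T"
    unfolding halts_within_def by blast
  have "height (s 0) \<le> Suc (length w) + t * expr_size c"
    by (rule height_exec[OF s(1)]) (use height_string[of w] in auto)
  also have "\<dots> \<le> Suc (length w) + T * expr_size c" using s(3) by simp
  finally show ?thesis using height_string(1)[of u] s(2) by simp
qed

text \<open>The appended program tolerates whatever \<open>d\<close> has left in the other
  variables, because \<open>runs\<close> constrains variable 0 only at the start.\<close>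

lemma ptime_halts_after:
  assumes "ptime f"
  obtains c T where "polyb T"
    "\<And>d v x U. halts_within d v (code x) U \<Longrightarrow> halts_within (Seq d c) v (code (f x)) (U + T x)"
proof -
  obtain c N T where T: "polyb T" and r: "\<And>M x. N \<le> M \<Longrightarrow> runs c M (T x) (code x) (code (f x))"
    using assms by (rule ptimeE) blast
  have "halts_within (Seq d c) v (code (f x)) (U + T x)" if "halts_within d v (code x) U" for d v x U
  proof -
    from that obtain t s where s: "exec d ((\<lambda>_. Atom)(0 := v)) t s" "s 0 = code x" "t \<le> U"
      unfolding halts_within_def by blast
    have "runs c N (T x) (s 0) (code (f x))" using r[of N x] s(2) by simp
    then obtain t' s' where s': "exec c s t' s'" "t' \<le> T x" "s' 0 = code (f x)" by (rule runsE) blast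
    have "exec (Seq d c) ((\<lambda>_. Atom)(0 := v)) (t + t') s'" using s(1) s'(1) by (rule exec.Seq)
    with s s' show ?thesis unfolding halts_within_def by (meson add_mono)
  qed
  with T that show thesis by blast
qed

lemma computable_ptime:
  assumes "computable f" "ptime g" shows "computable (\<lambda>n. g (f n))"
proof -
  obtain d where d: "\<And>n. \<exists>T. halts_within d (nat_tree n) (nat_tree (f n)) T"
    using assms(1) unfolding computable_def by blast
  obtain c T where c: "\<And>d v x U. halts_within d v (code x) U \<Longrightarrow> halts_within (Seq d c) v (code (g x)) (U + T x)"
    using assms(2) by (rule ptime_halts_after) blast
  show ?thesis unfolding computable_def
    using d c[of d "nat_tree n" "f n" for n] unfolding code_nat_def by blast
qed

lemma ptime_power: assumes "ptime f" shows "ptime (\<lambda>x. f x ^ b :: nat)"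
proof (induction b)
  case (Suc b)
  then show ?case unfolding power_Suc by (intro ptime_mult assms)
qed (simp add: ptime_const)

text \<open>The intermediate string has length at most linear in the running time of
  \<open>R\<close> plus the input length, so a polynomial in it still splits into a function of the
  parameter times a power of the input length.\<close>

lemma fpt_computable_ptime:
  assumes R: "fpt_computable \<kappa> R" and g: "ptime g"
  shows "fpt_computable \<kappa> (\<lambda>w. g (R w))"
proof -
  obtain c f a where f: "computable f"
    and c: "\<And>w. halts_within c (string_tree w) (string_tree (R w)) (f (\<kappa> w) * Suc (length w) ^ a)"
    using R unfolding fpt_computable_def by blast
  obtain c' T where T: "polyb T"
    and c': "\<And>d v x U. halts_within d v (code x) U \<Longrightarrow> halts_within (Seq d c') v (code (g x)) (U + T x)"
    using g by (rule ptime_halts_after) blast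
  from T obtain b where b: "\<And>u. T u \<le> (sz u + 2) ^ b" unfolding polyb_def by blast
  define K where "K = expr_size c"
  \<comment> \<open>Collects the factors that depend on the parameter: the time of \<open>R\<close>
    itself, and \<open>(4 + 2 * K * x) ^ b\<close> from the polynomial bound on its output.\<close>
  define p where "p x = x + (4 + 2 * K * x) ^ b" for x :: nat
  have p: "ptime p" unfolding p_def by (intro ptime_intros ptime_power)
  have time: "f (\<kappa> w) * Suc (length w) ^ a + T (R w) \<le> p (f (\<kappa> w)) * Suc (length w) ^ (a + Suc a * b)" for w
  proof -
    let ?m = "Suc (length w)" and ?F = "f (\<kappa> w)"
    have "length (R w) \<le> ?m + ?F * ?m ^ a * K"
      unfolding K_def by (rule halts_within_length[OF c])
    then have "sz (R w) \<le> 2 * (?m + ?F * ?m ^ a * K)"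
      by (intro order_trans[OF sz_string] mult_le_mono2)
    then have "sz (R w) + 2 \<le> 2 * (?m + ?F * ?m ^ a * K) + 2" by (rule add_right_mono)
    \<comment> \<open>The terms \<open>2 * ?m\<close> and 2 are merged into \<open>4 * ?m\<close>,
      as \<open>?m\<close> is at least 1.\<close>
    also have "\<dots> \<le> 4 * ?m + 2 * K * ?F * ?m ^ a" by (simp add: mult.commute mult.left_commute)
    also have "\<dots> \<le> 4 * ?m ^ Suc a + 2 * K * ?F * ?m ^ Suc a"
    proof -
      have "?m \<le> ?m ^ Suc a" by (rule self_le_power) simp_all
      moreover have "?m ^ a \<le> ?m ^ Suc a" by (rule power_increasing) simp_all
      ultimately show ?thesis by (intro add_mono mult_left_mono) simp_all
    qed
    also have "\<dots> = (4 + 2 * K * ?F) * ?m ^ Suc a" by (simp add: distrib_right)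
    finally have "(sz (R w) + 2) ^ b \<le> ((4 + 2 * K * ?F) * ?m ^ Suc a) ^ b" by (rule power_mono) simp
    then have "T (R w) \<le> (4 + 2 * K * ?F) ^ b * ?m ^ (Suc a * b)"
      using b[of "R w"] by (simp only: power_mult_distrib power_mult)
    also have "\<dots> \<le> (4 + 2 * K * ?F) ^ b * ?m ^ (a + Suc a * b)"
      by (intro mult_left_mono power_increasing) auto
    finally have "T (R w) \<le> (4 + 2 * K * ?F) ^ b * ?m ^ (a + Suc a * b)" .
    moreover have "?F * ?m ^ a \<le> ?F * ?m ^ (a + Suc a * b)"
      by (intro mult_left_mono power_increasing) auto
    ultimately show ?thesis unfolding p_def distrib_right by linarith
  qed
  show ?thesis unfolding fpt_computable_def
  proof (intro exI conjI allI)
    show "computable (\<lambda>n. p (f n))" by (rule computable_ptime[OF f p])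
    fix w
    have "halts_within (Seq c c') (string_tree w) (string_tree (g (R w)))
      (f (\<kappa> w) * Suc (length w) ^ a + T (R w))"
      using c'[OF c[of w, folded code_string]] by (simp add: code_string)
    then show "halts_within (Seq c c') (string_tree w) (string_tree (g (R w)))
      (p (f (\<kappa> w)) * Suc (length w) ^ (a + Suc a * b))"
      using time[of w] unfolding halts_within_def by (meson le_trans)
  qed
qed

theorem theorem1:
  shows "W_hard 1 (vertex_bisection (\<lambda>G k. k + max_components G k))"
  unfolding W_hard_def
proof
  fix Q assume "Q \<in> W_class 1"
  \<comment> \<open>The depth \<open>d\<close> is fixed by \<open>Q\<close>, so \<open>2 ^ d\<close>
    is a constant in what follows.\<close>
  then obtain d where d: "1 \<le> d" and "Q \<le>\<^sub>f\<^sub>p\<^sub>t WCS 1 d" unfolding W_class_def by blast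
  then obtain R g where R: "\<And>w. w \<in> fst Q \<longleftrightarrow> R w \<in> fst (WCS 1 d)" "fpt_computable (snd Q) R"
    and g: "computable g" "\<And>w. snd (WCS 1 d) (R w) \<le> g (snd Q w)"
    by (cases Q; cases "WCS 1 d") auto
  have "(fst Q, snd Q) \<le>\<^sub>f\<^sub>p\<^sub>t (fst bisection_problem, snd bisection_problem)"
    unfolding fpt_reducible.simps
  proof (intro exI[of _ "\<lambda>w. reduce_string d (R w)"] conjI exI[of _ "\<lambda>n. parameter_bound d (g n)"] allI)
    show "w \<in> fst Q \<longleftrightarrow> reduce_string d (R w) \<in> fst bisection_problem" for w
      using R(1) reduce_string_correct(1)[OF d] by simp
    show "fpt_computable (snd Q) (\<lambda>w. reduce_string d (R w))"
      by (rule fpt_computable_ptime[OF R(2) ptime_reduce_string])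
    show "computable (\<lambda>n. parameter_bound d (g n))"
      by (rule computable_ptime[OF g(1) ptime_parameter_bound])
    show "snd bisection_problem (reduce_string d (R w)) \<le> parameter_bound d (g (snd Q w))" for w
      using reduce_string_correct(2)[OF d] parameter_bound_mono[OF g(2)] by (rule order_trans)
  qed
  then show "Q \<le>\<^sub>f\<^sub>p\<^sub>t bisection_problem" by simp
qed

end
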